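(* Let $1<p<\infty$, let $\Omega\subset\mathbf{R}^n$ be a nonempty open set, let $Q_1,Q_2,Q_3\ge1$, and let $u_i$ be a $Q_i$-quasisuperminimizer in $\Omega$ for $i=1,2,3$. Let $$P=2Q_1Q_2Q_3-Q_1Q_2-Q_2Q_3-Q_3Q_1+1$$ and, for $i\in\{1,2,3\}$, with $\{j,k\}=\{1,2,3\}\setminus\{i\}$, $$R_i=\begin{cases} 0, & \text{if } Q_j=Q_k=1,\\ \displaystyle\frac{(Q_j-1)(Q_k-1)(Q_j-1+Q_k-1)}{Q_jQ_k-1}, & \text{otherwise.}\end{cases}$$ Then $\min\{u_1,u_2,u_3\}$ is a $\overline{Q}$-quasisuperminimizer in $\Omega$ with $$\overline{Q}=\frac{Q_1Q_2Q_3}{P}(R_1+R_2+R_3),$$ unless at least two of the $Q_i$ equal $1$, say $Q_j=Q_k=1$ with $\{i,j,k\}=\{1,2,3\}$, in which case $\min\{u_1,u_2,u_3\}$ is a $\overline{Q}$-quasisuperminimizer in $\Omega$ with $\overline{Q}=Q_i$.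
   Context: Let $1<p<\infty$, let $\Omega\subset\mathbf{R}^n$ be a nonempty open set and $Q\ge1$. A function $u\in W^{1,p}_{\rm loc}(\Omega)$ is a $Q$-quasisuperminimizer in $\Omega$ if $$\int_{\varphi\ne0}|\nabla u|^p\,dx\le Q\int_{\varphi\ne0}|\nabla(u+\varphi)|^p\,dx$$ for all nonnegative $\varphi\in W^{1,p}_0(\Omega)$, where the integrals are over $\{x\in\Omega:\varphi(x)\ne0\}$. *)

theory Defs
  imports "HOL-Analysis.Analysis"
begin

text \<open>
  Functions on an open set \<open>\<Omega>\<close> are represented by total functions of which only the values on
  \<open>\<Omega>\<close> matter; Sobolev functions are represented by arbitrary members of their almost-everywhere
  equivalence classes. All measure theory is with respect to Lebesgue measure.
\<close>

primrec C_k :: "nat \<Rightarrow> ('a::euclidean_space \<Rightarrow> real) \<Rightarrow> bool" where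
  "C_k 0 f \<longleftrightarrow> continuous_on UNIV f"
| "C_k (Suc k) f \<longleftrightarrow>
     (\<forall>x. f differentiable (at x)) \<and>
     (\<forall>e\<in>Basis. C_k k (\<lambda>x. frechet_derivative f (at x) e))"

text \<open>\<open>C\<^sub>c\<^sup>\<infinity>(\<Omega>)\<close>, with test functions extended by zero to the whole space.\<close>

definition test_functions :: "'a::euclidean_space set \<Rightarrow> ('a \<Rightarrow> real) set" where
  "test_functions \<Omega> =
     {\<psi>. (\<forall>k. C_k k \<psi>) \<and> compact (closure {x. \<psi> x \<noteq> 0}) \<and> closure {x. \<psi> x \<noteq> 0} \<subseteq> \<Omega>}"

definition locally_integrable_on ::
    "('a::euclidean_space \<Rightarrow> 'b::euclidean_space) \<Rightarrow> 'a set \<Rightarrow> bool" where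
  "locally_integrable_on f \<Omega> \<longleftrightarrow> (\<forall>K. compact K \<and> K \<subseteq> \<Omega> \<longrightarrow> f absolutely_integrable_on K)"

definition has_weak_gradient ::
    "'a::euclidean_space set \<Rightarrow> ('a \<Rightarrow> real) \<Rightarrow> ('a \<Rightarrow> 'a) \<Rightarrow> bool" where
  "has_weak_gradient \<Omega> u g \<longleftrightarrow>
     locally_integrable_on u \<Omega> \<and> locally_integrable_on g \<Omega> \<and>
     (\<forall>\<psi>\<in>test_functions \<Omega>. \<forall>e\<in>Basis.
        (LINT x:\<Omega>|lebesgue. u x * frechet_derivative \<psi> (at x) e) =
        - (LINT x:\<Omega>|lebesgue. (g x \<bullet> e) * \<psi> x))"

text \<open>
  The weak gradient is only determined up to null sets; some representative is chosen. The value
  is meaningless if no weak gradient exists.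
\<close>

definition weak_gradient :: "'a::euclidean_space set \<Rightarrow> ('a \<Rightarrow> real) \<Rightarrow> 'a \<Rightarrow> 'a" where
  "weak_gradient \<Omega> u = (SOME g. has_weak_gradient \<Omega> u g)"

definition in_Lp :: "real \<Rightarrow> 'a::euclidean_space set \<Rightarrow> ('a \<Rightarrow> 'b::euclidean_space) \<Rightarrow> bool" where
  "in_Lp p \<Omega> f \<longleftrightarrow>
     f \<in> borel_measurable (lebesgue_on \<Omega>) \<and>
     integrable (lebesgue_on \<Omega>) (\<lambda>x. norm (f x) powr p)"

definition W1p :: "real \<Rightarrow> 'a::euclidean_space set \<Rightarrow> ('a \<Rightarrow> real) set" where
  "W1p p \<Omega> =
     {u. in_Lp p \<Omega> u \<and> (\<exists>g. has_weak_gradient \<Omega> u g) \<and> in_Lp p \<Omega> (weak_gradient \<Omega> u)}"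

definition W1p_norm :: "real \<Rightarrow> 'a::euclidean_space set \<Rightarrow> ('a \<Rightarrow> real) \<Rightarrow> real" where
  "W1p_norm p \<Omega> u =
     (LINT x|lebesgue_on \<Omega>. \<bar>u x\<bar> powr p + norm (weak_gradient \<Omega> u x) powr p) powr (1 / p)"

definition W1p_loc :: "real \<Rightarrow> 'a::euclidean_space set \<Rightarrow> ('a \<Rightarrow> real) set" where
  "W1p_loc p \<Omega> =
     {u. \<forall>V. open V \<and> compact (closure V) \<and> closure V \<subseteq> \<Omega> \<longrightarrow> u \<in> W1p p V}"

text \<open>\<open>W\<^sub>0\<^sup>1\<^sup>,\<^sup>p(\<Omega>)\<close>: the closure of the test functions in the Sobolev norm.\<close>

definition W1p_0 :: "real \<Rightarrow> 'a::euclidean_space set \<Rightarrow> ('a \<Rightarrow> real) set" where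
  "W1p_0 p \<Omega> =
     {\<phi> \<in> W1p p \<Omega>. \<forall>\<epsilon>>0. \<exists>\<psi>\<in>test_functions \<Omega>. W1p_norm p \<Omega> (\<lambda>x. \<phi> x - \<psi> x) < \<epsilon>}"

text \<open>
  Since the gradient of \<open>u\<close> is only locally in \<open>L\<^sup>p\<close>, both integrals may be infinite, so they are
  taken in the extended nonnegative reals.
\<close>

definition quasisuperminimizer ::
    "real \<Rightarrow> real \<Rightarrow> 'a::euclidean_space set \<Rightarrow> ('a \<Rightarrow> real) \<Rightarrow> bool" where
  "quasisuperminimizer p Q \<Omega> u \<longleftrightarrow>
     1 \<le> Q \<and> u \<in> W1p_loc p \<Omega> \<and>
     (\<forall>\<phi>\<in>W1p_0 p \<Omega>. (AE x in lebesgue_on \<Omega>. 0 \<le> \<phi> x) \<longrightarrow>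
        (\<integral>\<^sup>+x\<in>{x\<in>\<Omega>. \<phi> x \<noteq> 0}. ennreal (norm (weak_gradient \<Omega> u x) powr p) \<partial>lebesgue)
        \<le> ennreal Q *
          (\<integral>\<^sup>+x\<in>{x\<in>\<Omega>. \<phi> x \<noteq> 0}.
             ennreal (norm (weak_gradient \<Omega> (\<lambda>y. u y + \<phi> y) x) powr p) \<partial>lebesgue))"

definition P_const :: "real \<Rightarrow> real \<Rightarrow> real \<Rightarrow> real" where
  "P_const Q1 Q2 Q3 = 2 * Q1 * Q2 * Q3 - Q1 * Q2 - Q2 * Q3 - Q3 * Q1 + 1"

text \<open>\<open>R\<^sub>i\<close> is \<open>R_const Q\<^sub>j Q\<^sub>k\<close> with \<open>{j, k} = {1, 2, 3} - {i}\<close>; the expression is symmetric.\<close>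

definition R_const :: "real \<Rightarrow> real \<Rightarrow> real" where
  "R_const a b =
     (if a = 1 \<and> b = 1 then 0
      else (a - 1) * (b - 1) * (a - 1 + b - 1) / (a * b - 1))"

end

theory Submission
  imports Defs
begin

text \<open>
  Let \<open>u\<close> be the minimum of two quasisuperminimizers \<open>w\<close> and \<open>w'\<close> with constants \<open>Q\<close> and \<open>Q'\<close>, and let
  \<open>v \<ge> u\<close> differ from \<open>u\<close> only in a compact set. Let \<open>E\<close> and \<open>V\<close> be the energies of \<open>u\<close> and \<open>v\<close> over
  \<open>{u < v}\<close>, and let \<open>E\<^sub>1\<close> be the part of \<open>E\<close> over \<open>{w < w'}\<close>. The core of the proof is the inequality
  \<open>Q * E - (Q - 1) * E\<^sub>1 \<le> Q * Q' * V\<close> of lemma \<open>min_competitor\<close>. It is obtained by testing \<open>w\<close> with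
  \<open>max w (min v w')\<close> and \<open>w'\<close> with \<open>max w' v\<close>, and by eliminating the energy of \<open>w'\<close> between \<open>w\<close> and \<open>v\<close>
  from the two resulting inequalities.

  The rest of the argument about constants is linear algebra. For two functions the inequality is
  used in both orders (\<open>local_qsm_min2\<close>), and for three functions each of them is compared with the
  minimum of the other two (\<open>local_qsm_min3\<close>). In both cases the weights are chosen such that the
  partial energies \<open>E\<^sub>1\<close>, which live on disjoint sets, occur with equal factors, so that their sum is
  bounded by \<open>E\<close>. If \<open>Q = 1\<close>, the partial energy disappears and the constant \<open>Q'\<close> is inherited
  (\<open>local_qsm_min_superminimizer\<close>); two applications settle the cases in which two constants are \<open>1\<close>.

  Competitors that differ from \<open>u\<close> in a compact set are admissible in the definition
  (\<open>quasisuperminimizer_imp_local_qsm\<close>), and they suffice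
  (\<open>local_qsm_imp_quasisuperminimizer\<close>), since nonnegative functions in \<open>W1p_0\<close> can be truncated by
  test functions. This requires some Sobolev space theory: weak gradients are unique
  (\<open>weak_gradient_unique\<close>), those of maxima and minima are obtained by a case distinction
  (\<open>sobolev_loc_max\<close>, \<open>sobolev_loc_min\<close>), they agree almost everywhere on the set where two functions
  coincide (\<open>weak_gradient_agree\<close>), and compactly supported Sobolev functions lie in \<open>W1p_0\<close>
  (\<open>compact_support_W1p_0\<close>). All of this rests on the convergence of mollifications in \<open>L\<^sup>p\<close>
  (\<open>mollify_Lp\<close>).
\<close>

section \<open>Smooth bump functions and mollifiers\<close>

text \<open>
  The powers of \<open>t\<close> in the denominator make the linear span of the family closed under
  differentiation.
\<close>

definition flat :: "nat \<Rightarrow> real \<Rightarrow> real" where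
  "flat n t = (if t > 0 then exp (- 1 / t) / t ^ n else 0)"

lemma flat_tendsto_0: "(flat n \<longlongrightarrow> 0) (at 0)"
proof -
  have 1: "((\<lambda>s::real. s ^ n / exp s) \<longlongrightarrow> 0) at_top"
    by (rule tendsto_power_div_exp_0)
  have "((\<lambda>t::real. inverse t ^ n / exp (inverse t)) \<longlongrightarrow> 0) (at_right 0)"
    by (rule filterlim_compose[OF 1 filterlim_inverse_at_top_right])
  moreover have "\<forall>\<^sub>F t in at_right 0. inverse t ^ n / exp (inverse t) = flat n t"
    by (auto simp: eventually_at_right_less flat_def exp_minus field_simps
        intro!: eventually_mono[OF eventually_at_right_less])
  ultimately have R: "(flat n \<longlongrightarrow> 0) (at_right 0)"
    by (rule Lim_transform_eventually)
  have L: "(flat n \<longlongrightarrow> 0) (at_left 0)"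
    by (rule Lim_transform_eventually[OF tendsto_const])
      (auto simp: eventually_at_filter flat_def)
  show ?thesis using L R by (rule filterlim_split_at)
qed

text \<open>
  At \<open>0\<close> the difference quotient of \<open>flat n\<close> is \<open>flat (n + 1)\<close>, which tends to \<open>0\<close>.
\<close>

lemma flat_has_derivative:
  "(flat n has_real_derivative flat (n + 2) t - real n * flat (n + 1) t) (at t)"
proof -
  consider "t > 0" | "t < 0" | "t = 0" by linarith
  then show ?thesis
  proof cases
    case 1
    have e: "exp (- 1 / t) * (1 / t\<^sup>2) / t ^ n - exp (- 1 / t) * (n * t ^ (n - 1)) / (t ^ n * t ^ n)
        = flat (n + 2) t - real n * flat (n + 1) t"
      using 1 by (cases n) (auto simp: flat_def field_simps power2_eq_square)
    have "((\<lambda>t. exp (- 1 / t) / t ^ n) has_real_derivative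
        exp (- 1 / t) * (1 / t\<^sup>2) / t ^ n - exp (- 1 / t) * (n * t ^ (n - 1)) / (t ^ n * t ^ n)) (at t)"
      using 1 by (auto intro!: derivative_eq_intros simp: field_simps power2_eq_square)
    then show ?thesis unfolding e
      by (rule has_field_derivative_transform_within_open[where S="{0<..}"])
        (use 1 in \<open>auto simp: flat_def\<close>)
  next
    case 2
    have "((\<lambda>t. 0) has_real_derivative flat (n + 2) t - real n * flat (n + 1) t) (at t)"
      using 2 by (auto simp: flat_def)
    then show ?thesis
      by (rule has_field_derivative_transform_within_open[where S="{..<0}"])
        (use 2 in \<open>auto simp: flat_def\<close>)
  next
    case 3
    have "((\<lambda>y. (flat n y - flat n 0) / (y - 0)) \<longlongrightarrow> 0) (at 0)"
      by (rule Lim_transform_eventually[OF flat_tendsto_0[of "Suc n"]])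
        (auto simp: eventually_at_filter flat_def)
    then show ?thesis using 3 by (simp add: has_field_derivative_iff flat_def)
  qed
qed

text \<open>
  A class of functions that visibly contains the partial derivatives of its members. Membership
  therefore gives derivatives of every order, without product and chain rules for \<open>C_k\<close>.
\<close>

inductive_set smooth_alg :: "('a::euclidean_space \<Rightarrow> real) set" where
  const: "(\<lambda>x. c) \<in> smooth_alg"
| inner: "(\<lambda>x. x \<bullet> b) \<in> smooth_alg"
| flat: "f \<in> smooth_alg \<Longrightarrow> (\<lambda>x. flat n (f x)) \<in> smooth_alg"
| add: "f \<in> smooth_alg \<Longrightarrow> g \<in> smooth_alg \<Longrightarrow> (\<lambda>x. f x + g x) \<in> smooth_alg"
| mult: "f \<in> smooth_alg \<Longrightarrow> g \<in> smooth_alg \<Longrightarrow> (\<lambda>x. f x * g x) \<in> smooth_alg"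

lemma smooth_alg_sum:
  "finite A \<Longrightarrow> (\<And>i. i \<in> A \<Longrightarrow> f i \<in> smooth_alg) \<Longrightarrow> (\<lambda>x. \<Sum>i\<in>A. f i x) \<in> smooth_alg"
  by (induction A rule: finite_induct) (auto intro: smooth_alg.intros)

lemma smooth_alg_derivative:
  assumes "f \<in> smooth_alg"
  shows "\<exists>f'. (\<forall>x. (f has_derivative f' x) (at x)) \<and> (\<forall>e. (\<lambda>x. f' x e) \<in> smooth_alg)"
  using assms
proof induction
  case (const c)
  show ?case
    by (rule exI[of _ "\<lambda>x e. 0"]) (auto intro: smooth_alg.intros)
next
  case (inner b)
  show ?case
    by (rule exI[of _ "\<lambda>x e. e \<bullet> b"]) (auto intro: smooth_alg.intros derivative_eq_intros)
next
  case (flat f n)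
  then obtain f' where d: "\<And>x. (f has_derivative f' x) (at x)" and s: "\<And>e. (\<lambda>x. f' x e) \<in> smooth_alg"
    by blast
  have "((\<lambda>x. flat n (f x)) has_derivative
      (\<lambda>e. (flat (n + 2) (f x) + (- real n) * flat (n + 1) (f x)) * f' x e)) (at x)" for x
    using has_derivative_compose[OF d flat_has_derivative[unfolded has_field_derivative_def]]
    by (simp add: mult.commute)
  moreover have "(\<lambda>x. (flat (n + 2) (f x) + (- real n) * flat (n + 1) (f x)) * f' x e) \<in> smooth_alg" for e
    by (intro smooth_alg.intros s flat.hyps)
  ultimately show ?case 
    by (intro exI[of _ "\<lambda>x e. (flat (n + 2) (f x) + (- real n) * flat (n + 1) (f x)) * f' x e"]) blast
next
  case (add f g)
  then obtain f' g' where "\<And>x. (f has_derivative f' x) (at x)" "\<And>e. (\<lambda>x. f' x e) \<in> smooth_alg"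
    "\<And>x. (g has_derivative g' x) (at x)" "\<And>e. (\<lambda>x. g' x e) \<in> smooth_alg"
    by blast
  then show ?case
    by (intro exI[of _ "\<lambda>x e. f' x e + g' x e"]) (auto intro!: smooth_alg.intros has_derivative_add)
next
  case (mult f g)
  then obtain f' g' where "\<And>x. (f has_derivative f' x) (at x)" "\<And>e. (\<lambda>x. f' x e) \<in> smooth_alg"
    "\<And>x. (g has_derivative g' x) (at x)" "\<And>e. (\<lambda>x. g' x e) \<in> smooth_alg"
    by blast
  with mult.hyps show ?case
    by (intro exI[of _ "\<lambda>x e. f x * g' x e + f' x e * g x"])
      (auto intro!: smooth_alg.intros has_derivative_mult)
qed

lemma C_k_smooth_alg: "f \<in> smooth_alg \<Longrightarrow> C_k k f"
proof (induction k arbitrary: f)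
  case 0
  then obtain f' where "\<And>x. (f has_derivative f' x) (at x)"
    using smooth_alg_derivative by blast
  then show ?case
    by (auto intro!: continuous_at_imp_continuous_on has_derivative_continuous)
next
  case (Suc k)
  then obtain f' where d: "\<And>x. (f has_derivative f' x) (at x)" and s: "\<And>e. (\<lambda>x. f' x e) \<in> smooth_alg"
    using smooth_alg_derivative by blast
  have "frechet_derivative f (at x) = f' x" for x
    using frechet_derivative_at[OF d] by metis
  then show ?case using d s Suc.IH by (auto simp: differentiable_def)
qed

definition bump :: "real \<Rightarrow> 'a::euclidean_space \<Rightarrow> real" where
  "bump r x = flat 0 (r\<^sup>2 - x \<bullet> x)"

lemma C_k_bump: "C_k k (bump r :: 'a::euclidean_space \<Rightarrow> real)"
proof -
  have "(\<lambda>x::'a. flat 0 (r\<^sup>2 + (- 1) * (\<Sum>b\<in>Basis. (x \<bullet> b) * (x \<bullet> b)))) \<in> smooth_alg"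
    by (intro smooth_alg.intros smooth_alg_sum finite_Basis)
  moreover have "(\<lambda>x::'a. flat 0 (r\<^sup>2 + (- 1) * (\<Sum>b\<in>Basis. (x \<bullet> b) * (x \<bullet> b)))) = bump r"
    by (auto simp: bump_def euclidean_inner[symmetric])
  ultimately show ?thesis using C_k_smooth_alg by metis
qed

lemma bump_nonneg: "0 \<le> bump r x"
  by (simp add: bump_def flat_def)

lemma bump_pos_iff: "r > 0 \<Longrightarrow> 0 < bump r x \<longleftrightarrow> norm x < r"
proof -
  assume "r > 0"
  have "0 < bump r x \<longleftrightarrow> x \<bullet> x < r\<^sup>2"
    by (simp add: bump_def flat_def)
  also have "\<dots> \<longleftrightarrow> norm x < r"
    using \<open>r > 0\<close> by (simp add: norm_lt_square)
  finally show ?thesis .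
qed

lemma C_k_differentiable:
  assumes "\<forall>k. C_k k f"
  shows "(f has_derivative frechet_derivative f (at x)) (at x)"
  using assms[rule_format, of "Suc 0"] by (simp add: frechet_derivative_works)

lemma C_k_partial:
  assumes "\<forall>k. C_k k f" "e \<in> Basis"
  shows "\<forall>k. C_k k (\<lambda>x. frechet_derivative f (at x) e)"
proof
  fix k show "C_k k (\<lambda>x. frechet_derivative f (at x) e)"
    using assms(1)[rule_format, of "Suc k"] assms(2) by simp
qed

lemma C_k_continuous: "\<forall>k. C_k k f \<Longrightarrow> continuous_on S f"
  using continuous_on_subset[of UNIV f S] by (metis C_k.simps(1) subset_UNIV)

lemma has_derivative_reflect:
  fixes f :: "'a::euclidean_space \<Rightarrow> real"
  assumes "(f has_derivative f') (at (x - y))"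
  shows "((\<lambda>y. c * f (x - y)) has_derivative (\<lambda>h. - c * f' h)) (at y)"
proof -
  have "((\<lambda>y. x - y) has_derivative (\<lambda>h. - h)) (at y)"
    by (auto intro!: derivative_eq_intros)
  from has_derivative_mult_right[OF has_derivative_compose[OF this assms], of c]
  have "((\<lambda>y. c * f (x - y)) has_derivative (\<lambda>h. c * f' (- h))) (at y)" .
  moreover have "c * f' (- h) = - c * f' h" for h
    using linear_neg[OF has_derivative_linear[OF assms]] by simp
  ultimately show ?thesis by simp
qed

text \<open>
  Mollification pairs a function with \<open>y \<mapsto> \<eta> (x - y)\<close>, which has to be a test function again.
  The factor \<open>c\<close> absorbs the sign that each differentiation produces.
\<close>

lemma C_k_reflect:
  "C_k k f \<Longrightarrow> C_k k (\<lambda>y. c * f (x - y))"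
proof (induction k arbitrary: f c)
  case 0
  then show ?case
    by (auto intro!: continuous_intros intro: continuous_on_compose2[of UNIV f])
next
  case (Suc k)
  have d: "((\<lambda>y. c * f (x - y)) has_derivative (\<lambda>h. - c * frechet_derivative f (at (x - y)) h)) (at y)" for y
    using Suc.prems by (intro has_derivative_reflect) (simp add: frechet_derivative_works)
  have "frechet_derivative (\<lambda>y. c * f (x - y)) (at y) = (\<lambda>h. - c * frechet_derivative f (at (x - y)) h)" for y
    using frechet_derivative_at[OF d] by metis
  then have "C_k k (\<lambda>y. frechet_derivative (\<lambda>y. c * f (x - y)) (at y) e)" if "e \<in> Basis" for e
    using Suc.IH[of "\<lambda>x. frechet_derivative f (at x) e" "- c"] Suc.prems that by simp
  then show ?case using d by (auto simp: differentiable_def)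
qed

lemma C_k_cmult: "C_k k f \<Longrightarrow> C_k k (\<lambda>y. c * f y)"
  using C_k_reflect[OF C_k_reflect[of k f c 0], of 1 0] by simp

lemma test_functionsD:
  assumes "\<psi> \<in> test_functions \<Omega>"
  shows "\<forall>k. C_k k \<psi>" "compact (closure {x. \<psi> x \<noteq> 0})" "closure {x. \<psi> x \<noteq> 0} \<subseteq> \<Omega>"
  using assms by (auto simp: test_functions_def)

lemma test_functionsI:
  assumes "\<forall>k. C_k k \<psi>" "compact K" "K \<subseteq> \<Omega>" "\<And>x. x \<notin> K \<Longrightarrow> \<psi> x = 0"
  shows "\<psi> \<in> test_functions \<Omega>"
proof -
  have "closure {x. \<psi> x \<noteq> 0} \<subseteq> K"
    using assms by (intro closure_minimal) (auto intro: compact_imp_closed)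
  moreover from this have "compact (closure {x. \<psi> x \<noteq> 0})"
    using compact_Int_closed[OF assms(2) closed_closure, of "{x. \<psi> x \<noteq> 0}"]
    by (simp add: Int_absorb1)
  ultimately show ?thesis using assms by (auto simp: test_functions_def)
qed

lemma frechet_derivative_zero_outside:
  fixes \<psi> :: "'a::euclidean_space \<Rightarrow> real"
  assumes "closed K" "\<And>x. x \<notin> K \<Longrightarrow> \<psi> x = 0" "x \<notin> K"
  shows "frechet_derivative \<psi> (at x) = (\<lambda>h. 0)"
proof -
  have "(\<psi> has_derivative (\<lambda>h. 0)) (at x)"
    by (rule has_derivative_transform_within_open[where f="\<lambda>x. 0" and s="- K"])
      (use assms in auto)
  then show ?thesis using frechet_derivative_at by metis
qed

lemma test_functions_outside:
  assumes "\<psi> \<in> test_functions \<Omega>" "x \<notin> closure {x. \<psi> x \<noteq> 0}"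
  shows "\<psi> x = 0" "frechet_derivative \<psi> (at x) = (\<lambda>h. 0)"
proof -
  have *: "\<psi> x = 0" if "x \<notin> closure {x. \<psi> x \<noteq> 0}" for x
    using that closure_subset[of "{x. \<psi> x \<noteq> 0}"] by blast
  show "\<psi> x = 0" using * assms(2) .
  show "frechet_derivative \<psi> (at x) = (\<lambda>h. 0)"
    by (rule frechet_derivative_zero_outside[OF closed_closure * assms(2)])
qed

lemma test_functions_mono: "V \<subseteq> \<Omega> \<Longrightarrow> \<psi> \<in> test_functions V \<Longrightarrow> \<psi> \<in> test_functions \<Omega>"
  by (auto simp: test_functions_def)

lemma test_functions_partial:
  assumes "\<psi> \<in> test_functions \<Omega>" "e \<in> Basis"
  shows "(\<lambda>x. frechet_derivative \<psi> (at x) e) \<in> test_functions \<Omega>"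
proof (rule test_functionsI)
  show "\<forall>k. C_k k (\<lambda>x. frechet_derivative \<psi> (at x) e)"
    by (rule C_k_partial[OF test_functionsD(1)[OF assms(1)] assms(2)])
  show "frechet_derivative \<psi> (at x) e = 0" if "x \<notin> closure {x. \<psi> x \<noteq> 0}" for x
    by (simp add: test_functions_outside(2)[OF assms(1) that])
qed (fact test_functionsD(2,3)[OF assms(1)])+

lemma compactly_supported_bounded:
  fixes f :: "'a::euclidean_space \<Rightarrow> real"
  assumes "continuous_on UNIV f" "compact K" "\<And>x. x \<notin> K \<Longrightarrow> f x = 0"
  shows "\<exists>B>0. \<forall>x. \<bar>f x\<bar> \<le> B"
proof -
  have "bounded (f ` K)"
    by (intro compact_imp_bounded compact_continuous_image assms(2) continuous_on_subset[OF assms(1)]) auto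
  then obtain B where "B > 0" "\<forall>x\<in>K. \<bar>f x\<bar> \<le> B"
    by (auto simp: bounded_pos)
  then show ?thesis using assms(3) by (intro exI[of _ B]) force
qed

lemma compactly_supported_integrable:
  fixes f :: "'a::euclidean_space \<Rightarrow> real"
  assumes "continuous_on UNIV f" "compact K" "\<And>x. x \<notin> K \<Longrightarrow> f x = 0"
  shows "integrable lborel f" "integrable lebesgue f" "(LINT x|lebesgue. f x) = (LINT x|lborel. f x)"
proof -
  have "set_integrable lborel K f"
    unfolding set_integrable_def
    by (intro borel_integrable_compact assms continuous_on_subset[OF assms(1)]) auto
  moreover have "(\<lambda>x. indicator K x *\<^sub>R f x) = f"
    using assms(3) by (auto simp: indicator_def fun_eq_iff)
  ultimately show 1: "integrable lborel f" by (simp add: set_integrable_def)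
  have [measurable]: "f \<in> borel_measurable lborel" using 1 by auto
  show "integrable lebesgue f" using 1 integrable_completion[of f lborel] by simp
  show "(LINT x|lebesgue. f x) = (LINT x|lborel. f x)" by (simp add: integral_completion)
qed

definition mollifier :: "real \<Rightarrow> 'a::euclidean_space \<Rightarrow> real" where
  "mollifier r x = inverse (LINT y|lborel. bump r (y::'a)) * bump r x"

lemma bump_outside: "r > 0 \<Longrightarrow> x \<notin> cball 0 r \<Longrightarrow> bump r x = 0"
  using bump_pos_iff[of r x] bump_nonneg[of r x] by auto

lemma bump_integral_pos:
  assumes "r > 0"
  shows "(LINT y|lborel. bump r (y::'a::euclidean_space)) > 0"
proof -
  have int: "integrable lborel (bump r :: 'a \<Rightarrow> real)"
    using C_k_continuous C_k_bump bump_outside assms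
    by (intro compactly_supported_integrable(1)[where K="cball 0 r"]) auto
  have "(LINT y|lborel. bump r (y::'a)) \<noteq> 0"
  proof
    assume "(LINT y|lborel. bump r (y::'a)) = 0"
    then have "AE y in lborel. bump r (y::'a) = 0"
      using integral_nonneg_eq_0_iff_AE[OF int] bump_nonneg by auto
    then have "AE y in lborel. y \<notin> ball (0::'a) r"
      by eventually_elim (use bump_pos_iff[OF assms] in \<open>force\<close>)
    then have "ball (0::'a) r \<in> null_sets lborel"
      by (simp add: AE_iff_null_sets)
    then have "emeasure lborel (ball (0::'a) r) = 0"
      by auto
    then have "measure lborel (ball (0::'a) r) = 0"
      by (simp add: measure_def)
    then show False using content_ball_pos[OF assms, of "0::'a"] by simp
  qed
  moreover have "(LINT y|lborel. bump r (y::'a)) \<ge> 0"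
    using bump_nonneg by (intro integral_nonneg_AE) auto
  ultimately show ?thesis by linarith
qed

lemma mollifier_facts:
  fixes r :: real
  assumes "r > 0"
  shows mollifier_C_k: "\<forall>k. C_k k (mollifier r :: 'a::euclidean_space \<Rightarrow> real)"
    and mollifier_nonneg: "0 \<le> mollifier r (x::'a)"
    and mollifier_outside: "\<And>x::'a. x \<notin> cball 0 r \<Longrightarrow> mollifier r x = 0"
    and mollifier_integral: "(LINT y|lborel. mollifier r (y::'a)) = 1"
    and mollifier_integrable: "integrable lborel (mollifier r :: 'a \<Rightarrow> real)"
    and mollifier_continuous: "continuous_on UNIV (mollifier r :: 'a \<Rightarrow> real)"
proof -
  have eq: "mollifier r = (\<lambda>x::'a. inverse (LINT y|lborel. bump r (y::'a)) * bump r x)"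
    by (auto simp: mollifier_def)
  show 1: "\<forall>k. C_k k (mollifier r :: 'a::euclidean_space \<Rightarrow> real)"
    unfolding eq using C_k_cmult[OF C_k_bump] by blast
  show "0 \<le> mollifier r (x::'a)"
    using bump_integral_pos[OF assms, where 'a='a] bump_nonneg[of r x] by (simp add: mollifier_def)
  show 2: "mollifier r x = 0" if "x \<notin> cball 0 r" for x :: 'a
    using bump_outside[OF assms that] by (simp add: mollifier_def)
  show "(LINT y|lborel. mollifier r (y::'a)) = 1"
    using bump_integral_pos[OF assms, where 'a='a] by (simp add: eq)
  show 3: "continuous_on UNIV (mollifier r :: 'a \<Rightarrow> real)"
    using C_k_continuous[OF 1] .
  show "integrable lborel (mollifier r :: 'a \<Rightarrow> real)"
    by (rule compactly_supported_integrable(1)[OF 3 compact_cball 2])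
qed

section \<open>Convolution with test functions\<close>

lemma compactly_supported_uniformly_continuous:
  fixes f :: "'a::euclidean_space \<Rightarrow> real"
  assumes "continuous_on UNIV f" "compact K" "\<And>x. x \<notin> K \<Longrightarrow> f x = 0" "\<epsilon> > 0"
  shows "\<exists>\<delta>>0. \<forall>x y. dist x y < \<delta> \<longrightarrow> \<bar>f x - f y\<bar> < \<epsilon>"
proof -
  obtain R where R: "K \<subseteq> cball 0 R"
    using compact_imp_bounded[OF assms(2)] unfolding bounded_pos by (auto simp: subset_iff)
  have "uniformly_continuous_on (cball 0 (R + 1)) f"
    by (intro compact_uniformly_continuous continuous_on_subset[OF assms(1)]) auto
  then obtain d where d: "d > 0"
      "\<And>x y. x \<in> cball 0 (R + 1) \<Longrightarrow> y \<in> cball 0 (R + 1) \<Longrightarrow> dist y x < d \<Longrightarrow> dist (f y) (f x) < \<epsilon>"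
    unfolding uniformly_continuous_on_def using assms(4) by blast
  have "\<bar>f x - f y\<bar> < \<epsilon>" if xy: "dist x y < min d 1" for x y
  proof (cases "x \<in> cball 0 (R + 1) \<and> y \<in> cball 0 (R + 1)")
    case True
    then show ?thesis using d(2)[of y x] xy by (auto simp: dist_real_def)
  next
    case False
    have "dist 0 x \<le> dist 0 y + dist x y" "dist 0 y \<le> dist 0 x + dist x y"
      using dist_triangle[of 0 x y] dist_triangle[of 0 y x] by (auto simp: dist_commute)
    then have "x \<notin> K \<and> y \<notin> K"
      using False R xy by (auto simp: subset_iff)
    then show ?thesis using assms(3,4) by simp
  qed
  then show ?thesis using d(1) by (intro exI[of _ "min d 1"]) auto
qed

lemma linear_functional_bound:
  fixes L :: "'a::euclidean_space \<Rightarrow> real"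
  assumes "linear L"
  shows "\<bar>L h\<bar> \<le> (\<Sum>e\<in>Basis. \<bar>L e\<bar>) * norm h"
proof -
  have "L h = L (\<Sum>e\<in>Basis. (h \<bullet> e) *\<^sub>R e)" by (simp add: euclidean_representation)
  also have "\<dots> = (\<Sum>e\<in>Basis. (h \<bullet> e) * L e)"
    using assms by (simp add: linear_sum linear_cmul)
  finally have "\<bar>L h\<bar> \<le> (\<Sum>e\<in>Basis. \<bar>(h \<bullet> e) * L e\<bar>)" by (metis sum_abs)
  also have "\<dots> \<le> (\<Sum>e\<in>Basis. \<bar>L e\<bar> * norm h)"
  proof (rule sum_mono)
    fix e :: 'a assume "e \<in> Basis"
    then show "\<bar>(h \<bullet> e) * L e\<bar> \<le> \<bar>L e\<bar> * norm h"
      using mult_left_mono[OF Basis_le_norm, of e "\<bar>L e\<bar>" h] by (simp add: abs_mult mult.commute)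
  qed
  finally show ?thesis by (simp add: sum_distrib_right)
qed

text \<open>
  The partial derivatives are uniformly continuous, so the error of the linear approximation is
  small uniformly in the base point. This permits differentiation under the integral sign against a
  function that is merely integrable.
\<close>

lemma uniformly_differentiable:
  fixes \<eta> :: "'a::euclidean_space \<Rightarrow> real"
  assumes \<eta>: "\<eta> \<in> test_functions UNIV" and "\<epsilon> > 0"
  shows "\<exists>\<delta>>0. \<forall>z h. norm h < \<delta> \<longrightarrow>
    \<bar>\<eta> (z + h) - \<eta> z - frechet_derivative \<eta> (at z) h\<bar> \<le> \<epsilon> * norm h"
proof -
  let ?D = "\<lambda>x. frechet_derivative \<eta> (at x)"
  define \<epsilon>' where "\<epsilon>' = \<epsilon> / DIM('a)"
  have "\<epsilon>' > 0" using assms by (simp add: \<epsilon>'_def)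
  have "\<forall>e\<in>Basis. \<exists>\<delta>>0. \<forall>x y. dist x y < \<delta> \<longrightarrow> \<bar>?D x e - ?D y e\<bar> < \<epsilon>'"
  proof
    fix e :: 'a assume e: "e \<in> Basis"
    note p = test_functions_partial[OF \<eta> e]
    show "\<exists>\<delta>>0. \<forall>x y. dist x y < \<delta> \<longrightarrow> \<bar>?D x e - ?D y e\<bar> < \<epsilon>'"
      by (rule compactly_supported_uniformly_continuous[OF C_k_continuous[OF test_functionsD(1)[OF p]]
            test_functionsD(2)[OF p] test_functions_outside(1)[OF p] \<open>\<epsilon>' > 0\<close>])
  qed
  then obtain d where d: "\<And>e. e \<in> Basis \<Longrightarrow> d e > 0"
      "\<And>e x y. e \<in> Basis \<Longrightarrow> dist x y < d e \<Longrightarrow> \<bar>?D x e - ?D y e\<bar> < \<epsilon>'"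
    by metis
  define \<delta> where "\<delta> = Min (d ` Basis)"
  have \<delta>: "\<delta> > 0" "\<And>e. e \<in> Basis \<Longrightarrow> \<delta> \<le> d e"
    using d(1) by (auto simp: \<delta>_def)
  have der: "(\<eta> has_derivative ?D x) (at x)" for x
    by (rule C_k_differentiable[OF test_functionsD(1)[OF \<eta>]])
  have "\<bar>\<eta> (z + h) - \<eta> z - ?D z h\<bar> \<le> \<epsilon> * norm h" if h: "norm h < \<delta>" for z h
  proof -
    have "norm (\<eta> (z + h) - \<eta> z - ?D z (z + h - z)) \<le> norm (z + h - z) * \<epsilon>"
    proof (rule differentiable_bound_linearization[where S="cball z (norm h)"])
      show "z + t *\<^sub>R (z + h - z) \<in> cball z (norm h)" if "t \<in> {0..1}" for t
        using that by (auto simp: dist_norm intro!: mult_left_le_one_le)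
      show "(\<eta> has_derivative ?D x) (at x within cball z (norm h))" for x
        by (rule has_derivative_at_withinI[OF der])
      show "onorm (?D x - ?D z) \<le> \<epsilon>" if "x \<in> cball z (norm h)" for x
      proof (rule onorm_le)
        fix v
        have "linear (\<lambda>v. ?D x v - ?D z v)"
          by (intro linear_compose_sub has_derivative_linear[OF der])
        from linear_functional_bound[OF this]
        have "\<bar>?D x v - ?D z v\<bar> \<le> (\<Sum>e\<in>Basis. \<bar>?D x e - ?D z e\<bar>) * norm v" .
        also have "(\<Sum>e\<in>Basis. \<bar>?D x e - ?D z e\<bar>) \<le> (\<Sum>e\<in>(Basis::'a set). \<epsilon>')"
          using that h \<delta>(2) by (intro sum_mono less_imp_le d(2)) (force simp: dist_commute)+
        also have "\<dots> = \<epsilon>" by (simp add: \<epsilon>'_def)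
        finally show "norm ((?D x - ?D z) v) \<le> \<epsilon> * norm v"
          by (simp add: mult_right_mono)
      qed
    qed auto
    then show ?thesis by (simp add: mult.commute)
  qed
  then show ?thesis using \<delta>(1) by blast
qed

definition conv :: "('a::euclidean_space \<Rightarrow> real) \<Rightarrow> ('a \<Rightarrow> real) \<Rightarrow> 'a \<Rightarrow> real" where
  "conv w \<eta> x = (LINT y|lebesgue. w y * \<eta> (x - y))"

lemma conv_integrand_measurable:
  fixes \<eta> :: "'a::euclidean_space \<Rightarrow> real"
  assumes "continuous_on UNIV \<eta>"
  shows "(\<lambda>y. \<eta> (x - y)) \<in> borel_measurable lborel" "(\<lambda>y. \<eta> (x - y)) \<in> borel_measurable lebesgue"
proof -
  have "continuous_on UNIV (\<lambda>y. \<eta> (x - y))"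
    by (rule continuous_on_compose2[OF assms]) (auto intro!: continuous_intros)
  then show 1: "(\<lambda>y. \<eta> (x - y)) \<in> borel_measurable lborel"
    by (simp add: borel_measurable_continuous_onI)
  then show "(\<lambda>y. \<eta> (x - y)) \<in> borel_measurable lebesgue"
    by (rule measurable_completion)
qed

lemma conv_integrand_integrable:
  fixes \<eta> :: "'a::euclidean_space \<Rightarrow> real"
  assumes "integrable lebesgue w" "continuous_on UNIV \<eta>" "\<And>x. \<bar>\<eta> x\<bar> \<le> B"
  shows "integrable lebesgue (\<lambda>y. w y * \<eta> (x - y))"
proof (rule Bochner_Integration.integrable_bound)
  show "integrable lebesgue (\<lambda>y. B * w y)" using assms(1) by simp
  have [measurable]: "w \<in> borel_measurable lebesgue" using assms(1) by simp
  note conv_integrand_measurable[OF assms(2), measurable]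
  show "(\<lambda>y. w y * \<eta> (x - y)) \<in> borel_measurable lebesgue" by measurable
  have "\<bar>w y * \<eta> (x - y)\<bar> \<le> \<bar>B * w y\<bar>" for y
    using mult_left_mono[OF order_trans[OF assms(3)[of "x - y"] abs_ge_self], of "\<bar>w y\<bar>"]
    by (simp add: abs_mult mult.commute)
  then show "AE y in lebesgue. norm (w y * \<eta> (x - y)) \<le> norm (B * w y)" by simp
qed

lemma test_function_bounded:
  "\<eta> \<in> test_functions \<Omega> \<Longrightarrow> \<exists>B>0. \<forall>x. \<bar>\<eta> x\<bar> \<le> B"
  by (rule compactly_supported_bounded[OF C_k_continuous[OF test_functionsD(1)]
        test_functionsD(2) test_functions_outside(1)])

lemma conv_test_integrable:
  "integrable lebesgue w \<Longrightarrow> \<eta> \<in> test_functions \<Omega> \<Longrightarrow> integrable lebesgue (\<lambda>y. w y * \<eta> (x - y))"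
proof -
  assume w: "integrable lebesgue w" and \<eta>: "\<eta> \<in> test_functions \<Omega>"
  obtain B where "\<And>x. \<bar>\<eta> x\<bar> \<le> B" using test_function_bounded[OF \<eta>] by blast
  then show ?thesis
    by (rule conv_integrand_integrable[OF w C_k_continuous[OF test_functionsD(1)[OF \<eta>]]])
qed

text \<open>
  The derivative falls on the kernel, whose linear approximation has an error that is small uniformly
  in the variable of integration.
\<close>

lemma conv_has_derivative:
  fixes \<eta> :: "'a::euclidean_space \<Rightarrow> real"
  assumes w: "integrable lebesgue w" and \<eta>: "\<eta> \<in> test_functions UNIV"
  shows "(conv w \<eta> has_derivative
    (\<lambda>h. \<Sum>e\<in>Basis. (h \<bullet> e) * conv w (\<lambda>z. frechet_derivative \<eta> (at z) e) x)) (at x)"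
    (is "(_ has_derivative ?L) _")
  unfolding has_derivative_at_alt
proof (intro conjI allI impI)
  show "bounded_linear ?L"
    by (intro linear_conv_bounded_linear[THEN iffD1])
      (auto simp: linear_iff inner_add_left sum.distrib algebra_simps sum_distrib_left)
next
  fix \<epsilon> :: real assume "\<epsilon> > 0"
  let ?D = "\<lambda>z. frechet_derivative \<eta> (at z)"
  define W where "W = (LINT y|lebesgue. \<bar>w y\<bar>)"
  have "W \<ge> 0" by (simp add: W_def)
  obtain \<delta> where \<delta>: "\<delta> > 0"
    "\<And>z h. norm h < \<delta> \<Longrightarrow> \<bar>\<eta> (z + h) - \<eta> z - ?D z h\<bar> \<le> \<epsilon> / (W + 1) * norm h"
    using uniformly_differentiable[OF \<eta>, of "\<epsilon> / (W + 1)"] \<open>\<epsilon> > 0\<close> \<open>W \<ge> 0\<close> by auto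
  have lin: "linear (?D z)" for z
    by (rule has_derivative_linear[OF C_k_differentiable[OF test_functionsD(1)[OF \<eta>]]])
  have Dh: "?D z h = (\<Sum>e\<in>Basis. (h \<bullet> e) * ?D z e)" for z h
  proof -
    have "?D z h = ?D z (\<Sum>e\<in>Basis. (h \<bullet> e) *\<^sub>R e)" by (simp add: euclidean_representation)
    also have "\<dots> = (\<Sum>e\<in>Basis. (h \<bullet> e) * ?D z e)"
      using lin by (simp add: linear_sum linear_cmul)
    finally show ?thesis .
  qed
  have "norm (conv w \<eta> y - conv w \<eta> x - ?L (y - x)) \<le> \<epsilon> * norm (y - x)" if y: "norm (y - x) < \<delta>" for y
  proof -
    let ?h = "y - x"
    note i1 = conv_test_integrable[OF w \<eta>]
    note i2 = conv_test_integrable[OF w test_functions_partial[OF \<eta>]]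
    have L: "?L ?h = (LINT u|lebesgue. w u * ?D (x - u) ?h)"
    proof -
      have "?L ?h = (\<Sum>e\<in>Basis. (LINT u|lebesgue. (?h \<bullet> e) * (w u * ?D (x - u) e)))"
        by (simp add: conv_def)
      also have "\<dots> = (LINT u|lebesgue. (\<Sum>e\<in>Basis. (?h \<bullet> e) * (w u * ?D (x - u) e)))"
        by (subst Bochner_Integration.integral_sum) (use i2 in auto)
      finally show ?thesis by (subst Dh) (simp add: sum_distrib_left mult.left_commute)
    qed
    have i3: "integrable lebesgue (\<lambda>u. w u * ?D (x - u) ?h)"
    proof -
      have "integrable lebesgue (\<lambda>u. \<Sum>e\<in>Basis. (?h \<bullet> e) * (w u * ?D (x - u) e))"
        using i2 by (intro Bochner_Integration.integrable_sum integrable_mult_right) auto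
      then show ?thesis by (subst Dh) (simp add: sum_distrib_left mult.left_commute)
    qed
    have "conv w \<eta> y - conv w \<eta> x - ?L ?h =
       (LINT u|lebesgue. w u * \<eta> (y - u) - w u * \<eta> (x - u) - w u * ?D (x - u) ?h)"
      unfolding L unfolding conv_def using i1 i3 by simp
    also have "norm \<dots> \<le> (LINT u|lebesgue. \<epsilon> / (W + 1) * norm ?h * \<bar>w u\<bar>)"
    proof (rule order_trans[OF integral_norm_bound integral_mono])
      show "integrable lebesgue (\<lambda>u. norm (w u * \<eta> (y - u) - w u * \<eta> (x - u) - w u * ?D (x - u) ?h))"
        using i1 i3 by simp
      show "integrable lebesgue (\<lambda>u. \<epsilon> / (W + 1) * norm ?h * \<bar>w u\<bar>)" using w by simp
      fix u
      have "\<bar>\<eta> (y - u) - \<eta> (x - u) - ?D (x - u) ?h\<bar> \<le> \<epsilon> / (W + 1) * norm ?h"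
        using \<delta>(2)[OF y, of "x - u"] by (simp add: algebra_simps)
      then have "\<bar>w u\<bar> * \<bar>\<eta> (y - u) - \<eta> (x - u) - ?D (x - u) ?h\<bar> \<le> \<bar>w u\<bar> * (\<epsilon> / (W + 1) * norm ?h)"
        by (intro mult_left_mono) auto
      then show "norm (w u * \<eta> (y - u) - w u * \<eta> (x - u) - w u * ?D (x - u) ?h) \<le> \<epsilon> / (W + 1) * norm ?h * \<bar>w u\<bar>"
        by (simp add: abs_mult[symmetric] right_diff_distrib mult.commute)
    qed
    also have "\<dots> = (\<epsilon> * norm ?h) * (W / (W + 1))" by (simp add: W_def)
    also have "\<dots> \<le> \<epsilon> * norm ?h"
      using \<open>W \<ge> 0\<close> \<open>\<epsilon> > 0\<close> by (intro mult_left_le) auto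
    finally show ?thesis .
  qed
  then show "\<exists>d>0. \<forall>y. norm (y - x) < d \<longrightarrow> norm (conv w \<eta> y - conv w \<eta> x - ?L (y - x)) \<le> \<epsilon> * norm (y - x)"
    using \<delta>(1) by blast
qed

lemma conv_partial:
  fixes \<eta> :: "'a::euclidean_space \<Rightarrow> real"
  assumes "integrable lebesgue w" "\<eta> \<in> test_functions UNIV" "e \<in> Basis"
  shows "frechet_derivative (conv w \<eta>) (at x) e = conv w (\<lambda>z. frechet_derivative \<eta> (at z) e) x"
proof -
  have "frechet_derivative (conv w \<eta>) (at x) =
     (\<lambda>h. \<Sum>e\<in>Basis. (h \<bullet> e) * conv w (\<lambda>z. frechet_derivative \<eta> (at z) e) x)"
    by (rule frechet_derivative_at[OF conv_has_derivative[OF assms(1,2)], symmetric])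
  then show ?thesis using assms(3)
    by (simp add: inner_Basis if_distrib if_distribR cong: if_cong)
qed

lemma C_k_conv:
  fixes \<eta> :: "'a::euclidean_space \<Rightarrow> real"
  assumes "integrable lebesgue w"
  shows "\<eta> \<in> test_functions UNIV \<Longrightarrow> C_k k (conv w \<eta>)"
proof (induction k arbitrary: \<eta>)
  case 0
  then show ?case
    using has_derivative_continuous[OF conv_has_derivative[OF assms]]
    by (auto intro!: continuous_at_imp_continuous_on)
next
  case (Suc k)
  have "conv w \<eta> differentiable at x" for x
    using conv_has_derivative[OF assms Suc.prems] by (auto simp: differentiable_def)
  moreover have "C_k k (\<lambda>x. frechet_derivative (conv w \<eta>) (at x) e)" if "e \<in> Basis" for e
    unfolding conv_partial[OF assms Suc.prems that]
    using Suc.IH[OF test_functions_partial[OF Suc.prems that]] by simp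
  ultimately show ?case by simp
qed

lemma conv_outside:
  assumes "AE y in lebesgue. y \<notin> K \<longrightarrow> w y = 0" "\<And>z. z \<notin> cball 0 r \<Longrightarrow> \<eta> z = 0" "cball x r \<inter> K = {}"
  shows "conv w \<eta> x = 0"
proof -
  have "AE y in lebesgue. w y * \<eta> (x - y) = 0"
    using assms(1)
  proof eventually_elim
    case (elim y)
    show ?case
    proof (cases "y \<in> K")
      case True
      then have "y \<notin> cball x r" using assms(3) by blast
      then have "x - y \<notin> cball 0 r" by (simp add: dist_norm norm_minus_commute)
      then show ?thesis using assms(2) by simp
    qed (use elim in auto)
  qed
  then show ?thesis unfolding conv_def by (simp add: integral_eq_zero_AE)
qed

lemma conv_cong_AE:
  assumes "AE y in lebesgue. w y = w' y" "w \<in> borel_measurable lebesgue" "w' \<in> borel_measurable lebesgue"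
    "continuous_on UNIV \<eta>"
  shows "conv w \<eta> x = conv w' \<eta> x"
proof -
  note assms(2,3)[measurable] conv_integrand_measurable[OF assms(4), measurable]
  show ?thesis unfolding conv_def
    by (rule integral_cong_AE) (measurable, use assms(1) in auto)
qed

lemma conv_diff:
  assumes "integrable lebesgue v" "integrable lebesgue w" "\<eta> \<in> test_functions UNIV"
  shows "conv (\<lambda>y. v y - w y) \<eta> x = conv v \<eta> x - conv w \<eta> x"
  unfolding conv_def using conv_test_integrable[OF assms(1,3)] conv_test_integrable[OF assms(2,3)]
  by (simp add: left_diff_distrib)

section \<open>Approximation in \<open>L\<^sup>p\<close> by mollification\<close>

text \<open>
  Compare \<open>t\<close> with \<open>d * s\<close>. The factor of \<open>s powr p\<close> tends to \<open>1\<close> as \<open>d\<close> tends to \<open>0\<close>, so that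
  perturbations which are small in \<open>L\<^sup>p\<close> do not spoil a sharp constant.
\<close>

lemma powr_add_le:
  fixes s t d p :: real
  assumes "s \<ge> 0" "t \<ge> 0" "d > 0" "p \<ge> 0"
  shows "(s + t) powr p \<le> (1 + d) powr p * s powr p + (1 + 1 / d) powr p * t powr p"
proof (cases "t \<le> d * s")
  case True
  have "(s + t) powr p \<le> ((1 + d) * s) powr p"
    using True assms by (intro powr_mono2) (auto simp: algebra_simps)
  also have "\<dots> = (1 + d) powr p * s powr p" using assms by (simp add: powr_mult)
  finally show ?thesis using powr_ge_zero by (simp add: add_increasing2)
next
  case False
  then have "s \<le> t / d" using assms by (simp add: field_simps)
  then have "(s + t) powr p \<le> ((1 + 1 / d) * t) powr p"
    using assms by (intro powr_mono2) (auto simp: algebra_simps)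
  also have "\<dots> = (1 + 1 / d) powr p * t powr p" using assms by (simp add: powr_mult)
  finally show ?thesis by (simp add: add_increasing)
qed

lemma powr_sum3_le:
  fixes s t u p :: real
  assumes "s \<ge> 0" "t \<ge> 0" "u \<ge> 0" "p \<ge> 0"
  shows "(s + t + u) powr p \<le> 3 powr p * (s powr p + t powr p + u powr p)"
proof -
  define m where "m = Max {s, t, u}"
  have m: "m \<ge> s" "m \<ge> t" "m \<ge> u" "m = s \<or> m = t \<or> m = u" by (auto simp: m_def max_def)
  have "(s + t + u) powr p \<le> (3 * m) powr p"
    using m assms by (intro powr_mono2) auto
  also have "\<dots> = 3 powr p * m powr p" using m assms by (simp add: powr_mult)
  also have "m powr p \<le> s powr p + t powr p + u powr p"
    using m(4) powr_ge_zero[of s p] powr_ge_zero[of t p] powr_ge_zero[of u p] by auto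
  finally show ?thesis by simp
qed

lemma nn_integral_lborel_translate:
  fixes f :: "'a::euclidean_space \<Rightarrow> ennreal"
  assumes [measurable]: "f \<in> borel_measurable borel"
  shows "(\<integral>\<^sup>+x. f (x + c) \<partial>lborel) = (\<integral>\<^sup>+x. f x \<partial>lborel)"
proof -
  have "(\<integral>\<^sup>+x. f x \<partial>lborel) = (\<integral>\<^sup>+x. f x \<partial>distr lborel borel ((+) c))"
    by (simp add: lborel_distr_plus)
  also have "\<dots> = (\<integral>\<^sup>+x. f (c + x) \<partial>lborel)"
    by (subst nn_integral_distr) auto
  finally show ?thesis by (simp add: add.commute)
qed

lemma nn_integral_lborel_reflect:
  fixes f :: "'a::euclidean_space \<Rightarrow> ennreal"
  assumes [measurable]: "f \<in> borel_measurable borel"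
  shows "(\<integral>\<^sup>+y. f (x - y) \<partial>lborel) = (\<integral>\<^sup>+y. f y \<partial>lborel)"
proof -
  have "lborel = distr lborel borel (\<lambda>y::'a. x - y)"
    by (subst lborel_affine[of "- 1" x]) (auto simp: density_1 one_ennreal_def[symmetric])
  then have "(\<integral>\<^sup>+y. f y \<partial>lborel) = (\<integral>\<^sup>+y. f y \<partial>distr lborel borel (\<lambda>y. x - y))"
    by simp
  also have "\<dots> = (\<integral>\<^sup>+y. f (x - y) \<partial>lborel)"
    by (subst nn_integral_distr) auto
  finally show ?thesis by simp
qed

lemma mollifier_measurable [measurable]: "mollifier r \<in> borel_measurable borel"
proof -
  have "continuous_on UNIV (bump r :: 'a \<Rightarrow> real)"
    using C_k_bump[of 0] by simp
  then have [measurable]: "(bump r :: 'a \<Rightarrow> real) \<in> borel_measurable borel"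
    by (rule borel_measurable_continuous_onI)
  have "mollifier r = (\<lambda>x::'a. inverse (LINT y|lborel. bump r (y::'a)) * bump r x)"
    by (auto simp: mollifier_def)
  then show ?thesis by simp
qed

lemma mollifier_nn_integral:
  fixes x :: "'a::euclidean_space"
  assumes "r > 0"
  shows "(\<integral>\<^sup>+y. ennreal (mollifier r (x - y)) \<partial>lborel) = 1"
    and "(\<integral>\<^sup>+z. ennreal (mollifier r (z - x)) \<partial>lborel) = 1"
proof -
  have 1: "(\<integral>\<^sup>+y. ennreal (mollifier r (y::'a)) \<partial>lborel) = 1"
    using nn_integral_eq_integral[OF mollifier_integrable[OF assms]]
    by (simp add: mollifier_nonneg[OF assms] mollifier_integral[OF assms])
  then show "(\<integral>\<^sup>+y. ennreal (mollifier r (x - y)) \<partial>lborel) = 1"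
    using nn_integral_lborel_reflect[of "\<lambda>y. ennreal (mollifier r y)" x] by simp
  show "(\<integral>\<^sup>+z. ennreal (mollifier r (z - x)) \<partial>lborel) = 1"
    using 1 nn_integral_lborel_translate[of "\<lambda>y. ennreal (mollifier r y)" "- x"] by simp
qed

lemma mollifier_test:
  "r > 0 \<Longrightarrow> mollifier r \<in> test_functions UNIV"
  by (rule test_functionsI[where K="cball 0 r"]) (simp_all add: mollifier_C_k mollifier_outside)

text \<open>
  Jensen's inequality up to the factor \<open>2 powr p\<close>. Values of \<open>\<bar>w\<bar>\<close> below \<open>s / 2\<close> contribute at most
  \<open>s / 2\<close> to the average, and above this level \<open>\<bar>w\<bar>\<close> is at most \<open>(s / 2) powr (1 - p) * \<bar>w\<bar> powr p\<close>.
\<close>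

lemma powr_average_le:
  fixes w h :: "'a \<Rightarrow> real" and p s :: real
  assumes [measurable]: "w \<in> borel_measurable M" "h \<in> borel_measurable M"
    and h: "\<And>y. 0 \<le> h y" "(\<integral>\<^sup>+y. ennreal (h y) \<partial>M) = 1"
    and s: "ennreal s \<le> (\<integral>\<^sup>+y. ennreal (\<bar>w y\<bar> * h y) \<partial>M)" "s > 0" and "p \<ge> 1"
  shows "ennreal ((s / 2) powr p) \<le> (\<integral>\<^sup>+y. ennreal (\<bar>w y\<bar> powr p * h y) \<partial>M)"
proof (cases "(\<integral>\<^sup>+y. ennreal (\<bar>w y\<bar> powr p * h y) \<partial>M) = \<infinity>")
  case False
  then obtain J where J: "(\<integral>\<^sup>+y. ennreal (\<bar>w y\<bar> powr p * h y) \<partial>M) = ennreal J" "J \<ge> 0"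
    by (cases "\<integral>\<^sup>+y. ennreal (\<bar>w y\<bar> powr p * h y) \<partial>M") auto
  define m where "m = (s / 2) powr (1 - p)"
  have "m > 0" using s by (simp add: m_def)
  have ptw: "\<bar>w y\<bar> \<le> s / 2 + m * \<bar>w y\<bar> powr p" for y
  proof (cases "\<bar>w y\<bar> \<le> s / 2")
    case True
    then show ?thesis using \<open>m > 0\<close> by (simp add: add_increasing2)
  next
    case False
    then have "1 \<le> (\<bar>w y\<bar> / (s / 2)) powr (p - 1)"
      using s \<open>p \<ge> 1\<close> by (intro ge_one_powr_ge_zero) (auto simp: field_simps)
    also have "\<dots> = \<bar>w y\<bar> powr (p - 1) * m"
    proof -
      have "(s / 2) powr (1 - p) = inverse ((s / 2) powr (p - 1))"
        by (metis minus_diff_eq powr_minus)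
      then show ?thesis
        using s unfolding m_def by (subst powr_divide) (auto simp only: divide_inverse)
    qed
    finally have "\<bar>w y\<bar> * 1 \<le> \<bar>w y\<bar> * (\<bar>w y\<bar> powr (p - 1) * m)"
      by (intro mult_left_mono) auto
    also have "\<dots> = m * \<bar>w y\<bar> powr p"
      using False s powr_mult_base[of "\<bar>w y\<bar>" "p - 1"] by (simp add: mult.assoc[symmetric] mult.commute)
    finally show ?thesis using s by simp
  qed
  have "ennreal s \<le> (\<integral>\<^sup>+y. ennreal (\<bar>w y\<bar> * h y) \<partial>M)" by (rule s)
  also have "\<dots> \<le> (\<integral>\<^sup>+y. ennreal (s / 2) * ennreal (h y) + ennreal m * ennreal (\<bar>w y\<bar> powr p * h y) \<partial>M)"
  proof (rule nn_integral_mono)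
    fix y
    have "\<bar>w y\<bar> * h y \<le> (s / 2 + m * \<bar>w y\<bar> powr p) * h y"
      by (intro mult_right_mono ptw h)
    then have "ennreal (\<bar>w y\<bar> * h y) \<le> ennreal (s / 2 * h y + m * (\<bar>w y\<bar> powr p * h y))"
      by (intro ennreal_leI) (simp add: algebra_simps)
    then show "ennreal (\<bar>w y\<bar> * h y) \<le> ennreal (s / 2) * ennreal (h y) + ennreal m * ennreal (\<bar>w y\<bar> powr p * h y)"
      using h(1)[of y] s \<open>m > 0\<close> by (simp only: ennreal_plus[of "s / 2 * h y" "m * (\<bar>w y\<bar> powr p * h y)"]
          ennreal_mult[of "s / 2" "h y"] ennreal_mult[of m "\<bar>w y\<bar> powr p * h y"]
          zero_le_mult_iff powr_ge_zero less_imp_le half_gt_zero simp_thms)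
  qed
  also have "\<dots> = ennreal (s / 2) + ennreal m * ennreal J"
    by (subst nn_integral_add) (auto simp: nn_integral_cmult h J)
  also have "\<dots> = ennreal (s / 2 + m * J)"
    using s \<open>m > 0\<close> J by (simp add: ennreal_mult' ennreal_plus)
  finally have "ennreal s \<le> ennreal (s / 2 + m * J)" .
  then have "s \<le> s / 2 + m * J"
    by (rule ennreal_le_iff[THEN iffD1, rotated]) (use s \<open>m > 0\<close> J in simp)
  then have "s / 2 \<le> (s / 2) powr (1 - p) * J" by (simp add: m_def)
  then have "(s / 2) powr (p - 1) * (s / 2) \<le> (s / 2) powr (p - 1) * ((s / 2) powr (1 - p) * J)"
    by (intro mult_left_mono) auto
  also have "\<dots> = J" using s by (simp add: mult.assoc[symmetric] powr_add[symmetric])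
  also have "(s / 2) powr (p - 1) * (s / 2) = (s / 2) powr p"
    using s powr_mult_base[of "s / 2" "p - 1"] by (simp add: mult.commute)
  finally show ?thesis using J by (simp add: ennreal_leI)
qed auto

text \<open>
  The factor does not depend on the radius \<open>r\<close>: for each \<open>x\<close> the kernel is a probability density,
  so \<open>powr_average_le\<close> applies, and Fubini's theorem removes the kernel again. A Borel representative
  of \<open>w\<close> makes the integrand measurable for the product measure.
\<close>

lemma conv_Lp_bound:
  fixes w :: "'a::euclidean_space \<Rightarrow> real"
  assumes w: "integrable lebesgue w" and "p \<ge> 1" "r > 0"
  shows "(\<integral>\<^sup>+x. ennreal (\<bar>conv w (mollifier r) x\<bar> powr p) \<partial>lebesgue)
    \<le> ennreal (2 powr p) * (\<integral>\<^sup>+x. ennreal (\<bar>w x\<bar> powr p) \<partial>lebesgue)"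
proof -
  let ?\<eta> = "mollifier r :: 'a \<Rightarrow> real"
  obtain v where v[measurable]: "v \<in> borel_measurable lborel" and "AE x in lborel. w x = v x"
    using completion_ex_borel_measurable_real[OF borel_measurable_integrable[OF w]] by blast
  then have wv: "AE x in lebesgue. w x = v x" by (simp add: AE_completion_iff)
  have [measurable]: "v \<in> borel_measurable borel" using v by simp
  have [measurable]: "v \<in> borel_measurable lebesgue" by (rule measurable_completion[OF v])
  have intv: "integrable lebesgue v"
    using w by (rule integrable_cong_AE_imp) (use wv in auto)
  have ptw: "ennreal (\<bar>conv w ?\<eta> x\<bar> powr p)
     \<le> ennreal (2 powr p) * (\<integral>\<^sup>+y. ennreal (\<bar>v y\<bar> powr p * ?\<eta> (x - y)) \<partial>lborel)" for x
  proof -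
    define s where "s = \<bar>conv w ?\<eta> x\<bar>"
    have "conv w ?\<eta> x = conv v ?\<eta> x"
      by (rule conv_cong_AE[OF wv]) (use w mollifier_continuous[OF \<open>r > 0\<close>] in auto)
    then have "ennreal s = ennreal (norm (LINT y|lebesgue. v y * ?\<eta> (x - y)))" by (simp add: s_def conv_def)
    also have "\<dots> \<le> (\<integral>\<^sup>+y. norm (v y * ?\<eta> (x - y)) \<partial>lebesgue)"
      by (rule integral_norm_bound_ennreal)
        (rule conv_test_integrable[OF intv mollifier_test[OF \<open>r > 0\<close>]])
    also have "\<dots> = (\<integral>\<^sup>+y. ennreal (\<bar>v y\<bar> * ?\<eta> (x - y)) \<partial>lborel)"
      by (simp add: nn_integral_completion abs_mult mollifier_nonneg[OF \<open>r > 0\<close>])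
    finally have s: "ennreal s \<le> (\<integral>\<^sup>+y. ennreal (\<bar>v y\<bar> * ?\<eta> (x - y)) \<partial>lborel)" .
    show ?thesis
    proof (cases "s > 0")
      case True
      have "ennreal ((s / 2) powr p) \<le> (\<integral>\<^sup>+y. ennreal (\<bar>v y\<bar> powr p * ?\<eta> (x - y)) \<partial>lborel)"
        by (rule powr_average_le[OF _ _ _ _ s True \<open>p \<ge> 1\<close>])
          (use mollifier_nonneg[OF \<open>r > 0\<close>] mollifier_nn_integral[OF \<open>r > 0\<close>] in auto)
      then have "ennreal (2 powr p) * ennreal ((s / 2) powr p)
          \<le> ennreal (2 powr p) * (\<integral>\<^sup>+y. ennreal (\<bar>v y\<bar> powr p * ?\<eta> (x - y)) \<partial>lborel)"
        by (rule mult_left_mono) auto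
      moreover have "ennreal (2 powr p) * ennreal ((s / 2) powr p) = ennreal (s powr p)"
        using True by (simp add: ennreal_mult[symmetric] powr_mult[symmetric])
      ultimately show ?thesis by (simp add: s_def)
    next
      case False
      then show ?thesis by (simp add: s_def)
    qed
  qed
  have "(\<integral>\<^sup>+x. ennreal (\<bar>conv w ?\<eta> x\<bar> powr p) \<partial>lebesgue)
    \<le> (\<integral>\<^sup>+x. ennreal (2 powr p) * (\<integral>\<^sup>+y. ennreal (\<bar>v y\<bar> powr p * ?\<eta> (x - y)) \<partial>lborel) \<partial>lborel)"
    unfolding nn_integral_completion by (intro nn_integral_mono ptw)
  also have "\<dots> = ennreal (2 powr p) * (\<integral>\<^sup>+x. (\<integral>\<^sup>+y. ennreal (\<bar>v y\<bar> powr p * ?\<eta> (x - y)) \<partial>lborel) \<partial>lborel)"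
    by (rule nn_integral_cmult) measurable
  also have "(\<integral>\<^sup>+x. (\<integral>\<^sup>+y. ennreal (\<bar>v y\<bar> powr p * ?\<eta> (x - y)) \<partial>lborel) \<partial>lborel)
    = (\<integral>\<^sup>+y. (\<integral>\<^sup>+x. ennreal (\<bar>v y\<bar> powr p * ?\<eta> (x - y)) \<partial>lborel) \<partial>lborel)"
    by (rule lborel_pair.Fubini') measurable
  also have "\<dots> = (\<integral>\<^sup>+y. ennreal (\<bar>v y\<bar> powr p) \<partial>lborel)"
    by (simp add: ennreal_mult mollifier_nonneg[OF \<open>r > 0\<close>] nn_integral_cmult mollifier_nn_integral[OF \<open>r > 0\<close>])
  also have "\<dots> = (\<integral>\<^sup>+y. ennreal (\<bar>w y\<bar> powr p) \<partial>lebesgue)"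
    unfolding nn_integral_completion[of lborel "\<lambda>y. ennreal (\<bar>v y\<bar> powr p)", symmetric]
    by (rule nn_integral_cong_AE) (use wv in auto)
  finally show ?thesis .
qed

lemma mollify_continuous:
  fixes c :: "'a::euclidean_space \<Rightarrow> real"
  assumes c: "continuous_on UNIV c" "\<And>x. x \<notin> cball 0 R \<Longrightarrow> c x = 0" and "\<epsilon> > 0"
  shows "\<exists>r0>0. \<forall>r x. 0 < r \<and> r \<le> r0 \<longrightarrow> \<bar>conv c (mollifier r) x - c x\<bar> \<le> \<epsilon>"
proof -
  obtain d where d: "d > 0" "\<And>x y. dist x y < d \<Longrightarrow> \<bar>c x - c y\<bar> < \<epsilon>"
    using compactly_supported_uniformly_continuous[OF c(1) compact_cball c(2) \<open>\<epsilon> > 0\<close>] by blast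
  have "\<bar>conv c (mollifier r) x - c x\<bar> \<le> \<epsilon>" if r: "0 < r" "r \<le> d / 2" for r x
  proof -
    let ?\<eta> = "\<lambda>y::'a. mollifier r (x - y)"
    have \<eta>m: "?\<eta> \<in> borel_measurable lebesgue"
      using conv_integrand_measurable(2)[OF mollifier_continuous[OF r(1)]] .
    have nn: "(\<integral>\<^sup>+y. ennreal (?\<eta> y) \<partial>lebesgue) = 1"
      by (simp add: nn_integral_completion mollifier_nn_integral[OF r(1)])
    have i\<eta>: "integrable lebesgue ?\<eta>"
      by (rule integrableI_nonneg[OF \<eta>m]) (auto simp: nn mollifier_nonneg[OF r(1)])
    have int1: "(LINT y|lebesgue. ?\<eta> y) = 1"
      using integral_eq_nn_integral[OF \<eta>m] nn by (simp add: mollifier_nonneg[OF r(1)])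
    have ic: "integrable lebesgue (\<lambda>y. c y * ?\<eta> y)"
      by (rule conv_test_integrable[OF compactly_supported_integrable(2)[OF c(1) compact_cball c(2)] mollifier_test[OF r(1)]])
    have "conv c (mollifier r) x - c x = (LINT y|lebesgue. c y * ?\<eta> y - c x * ?\<eta> y)"
      unfolding conv_def using ic i\<eta> int1 by simp
    also have "norm \<dots> \<le> (LINT y|lebesgue. \<epsilon> * ?\<eta> y)"
    proof (rule order_trans[OF integral_norm_bound integral_mono])
      show "integrable lebesgue (\<lambda>y. norm (c y * ?\<eta> y - c x * ?\<eta> y))" using ic i\<eta> by simp
      show "integrable lebesgue (\<lambda>y. \<epsilon> * ?\<eta> y)" using i\<eta> by simp
      fix y
      show "norm (c y * ?\<eta> y - c x * ?\<eta> y) \<le> \<epsilon> * ?\<eta> y"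
      proof (cases "x - y \<in> cball 0 r")
        case True
        then have "\<bar>c y - c x\<bar> \<le> \<epsilon>"
          using d(1) r by (intro less_imp_le d(2)) (auto simp: dist_norm norm_minus_commute)
        then have "\<bar>c y - c x\<bar> * ?\<eta> y \<le> \<epsilon> * ?\<eta> y"
          by (intro mult_right_mono mollifier_nonneg[OF r(1)])
        then show ?thesis
          unfolding left_diff_distrib[symmetric] by (simp add: abs_mult mollifier_nonneg[OF r(1)])
      next
        case False
        then have "?\<eta> y = 0" by (rule mollifier_outside[OF r(1)])
        then show ?thesis by simp
      qed
    qed
    also have "\<dots> = \<epsilon>" using int1 by simp
    finally show ?thesis by simp
  qed
  then show ?thesis using d(1) by (intro exI[of _ "d / 2"]) auto
qed

definition clip :: "real \<Rightarrow> real \<Rightarrow> real" where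
  "clip m t = max (- m) (min m t)"

lemma clip_bound: "m \<ge> 0 \<Longrightarrow> \<bar>clip m t\<bar> \<le> m"
  by (auto simp: clip_def)

lemma clip_error: "m \<ge> 0 \<Longrightarrow> \<bar>t - clip m t\<bar> \<le> \<bar>t\<bar>"
  by (auto simp: clip_def max_def min_def)

lemma clip_eq: "\<bar>t\<bar> \<le> m \<Longrightarrow> clip m t = t"
  by (auto simp: clip_def)

lemma clip_measurable [measurable]: "clip m \<in> borel_measurable borel"
  unfolding clip_def by measurable

lemma Lp_approx_clip:
  fixes w :: "'a::euclidean_space \<Rightarrow> real"
  assumes w[measurable]: "w \<in> borel_measurable lebesgue" and p: "p > 0"
    and fin: "(\<integral>\<^sup>+x. ennreal (\<bar>w x\<bar> powr p) \<partial>lebesgue) < \<infinity>"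
  shows "(\<lambda>m. \<integral>\<^sup>+x. ennreal (\<bar>w x - clip (real m) (w x)\<bar> powr p) \<partial>lebesgue) \<longlonglongrightarrow> 0"
proof -
  have "(\<lambda>m. \<integral>\<^sup>+x. ennreal (\<bar>w x - clip (real m) (w x)\<bar> powr p) \<partial>lebesgue) \<longlonglongrightarrow> (\<integral>\<^sup>+x. 0 \<partial>(lebesgue::'a measure))"
  proof (rule nn_integral_dominated_convergence[where w="\<lambda>x. ennreal (\<bar>w x\<bar> powr p)"])
    show "AE x in lebesgue. ennreal (\<bar>w x - clip (real m) (w x)\<bar> powr p) \<le> ennreal (\<bar>w x\<bar> powr p)" for m
      using p by (intro AE_I2 ennreal_leI powr_mono2 clip_error) auto
    show "AE x in lebesgue. (\<lambda>m. ennreal (\<bar>w x - clip (real m) (w x)\<bar> powr p)) \<longlonglongrightarrow> 0"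
    proof (rule AE_I2)
      fix x :: 'a
      obtain N where "\<bar>w x\<bar> \<le> real N" using real_arch_simple by blast
      then have "\<And>m. m \<ge> N \<Longrightarrow> ennreal (\<bar>w x - clip (real m) (w x)\<bar> powr p) = 0"
        by (subst clip_eq) auto
      then show "(\<lambda>m. ennreal (\<bar>w x - clip (real m) (w x)\<bar> powr p)) \<longlonglongrightarrow> 0"
        by (intro tendsto_eventually) (auto simp: eventually_sequentially)
    qed
  qed (use fin in auto)
  then show ?thesis by simp
qed

text \<open>
  A Lebesgue measurable function is an almost everywhere limit of continuous functions. Cutting
  these off in height and in space makes dominated convergence applicable.
\<close>

lemma Lp_approx_bounded:
  fixes w :: "'a::euclidean_space \<Rightarrow> real"
  assumes w[measurable]: "w \<in> borel_measurable lebesgue" and p: "p > 0"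
    and m: "\<And>x. \<bar>w x\<bar> \<le> m" and R: "R \<ge> 0" "\<And>x. x \<notin> cball 0 R \<Longrightarrow> w x = 0"
  shows "\<exists>c. (\<forall>n. continuous_on UNIV (c n) \<and> (\<forall>x. x \<notin> cball 0 (R + 1) \<longrightarrow> c n x = (0::real))) \<and>
    (\<lambda>n::nat. \<integral>\<^sup>+x. ennreal (\<bar>w x - c n x\<bar> powr p) \<partial>lebesgue) \<longlonglongrightarrow> 0"
proof -
  have "m \<ge> 0" using m[of 0] by linarith
  have "w measurable_on UNIV"
    by (rule lebesgue_measurable_imp_measurable_on) auto
  then obtain N g where N: "negligible N" and g: "\<And>n. continuous_on UNIV (g n)"
      "\<And>x. x \<notin> N \<Longrightarrow> (\<lambda>n::nat. g n x) \<longlonglongrightarrow> w x"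
    unfolding measurable_on_def by auto
  define \<theta> where "\<theta> x = max 0 (min 1 (R + 1 - norm x))" for x :: 'a
  have \<theta>: "0 \<le> \<theta> x" "\<theta> x \<le> 1" "norm x \<le> R \<Longrightarrow> \<theta> x = 1" "norm x > R + 1 \<Longrightarrow> \<theta> x = 0" for x
    by (auto simp: \<theta>_def)
  define c where "c n x = \<theta> x * clip m (g n x)" for n x
  have cont: "continuous_on UNIV (c n)" for n
    unfolding c_def \<theta>_def clip_def by (intro continuous_intros g)
  have [measurable]: "c n \<in> borel_measurable lebesgue" for n
    using borel_measurable_continuous_onI[OF cont] by (intro measurable_completion) simp
  have "(\<lambda>n. \<integral>\<^sup>+x. ennreal (\<bar>w x - c n x\<bar> powr p) \<partial>lebesgue) \<longlonglongrightarrow> (\<integral>\<^sup>+x. 0 \<partial>(lebesgue::'a measure))"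
  proof (rule nn_integral_dominated_convergence[where w="\<lambda>x. ennreal ((2 * m) powr p) * indicator (cball 0 (R + 1)) x"])
    have "\<bar>w x - c n x\<bar> powr p \<le> (2 * m) powr p" for n x
    proof (rule powr_mono2)
      have "\<bar>c n x\<bar> \<le> 1 * m"
        unfolding c_def abs_mult using \<theta>[of x] clip_bound[OF \<open>m \<ge> 0\<close>] by (intro mult_mono) auto
      then show "\<bar>w x - c n x\<bar> \<le> 2 * m" using m[of x] by linarith
    qed (use p in auto)
    moreover have "w x - c n x = 0" if "x \<notin> cball 0 (R + 1)" for n x
      using that R(2)[of x] \<theta>(4)[of x] by (auto simp: c_def)
    ultimately show "AE x in lebesgue. ennreal (\<bar>w x - c n x\<bar> powr p) \<le> ennreal ((2 * m) powr p) * indicator (cball 0 (R + 1)) x" for n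
      by (intro AE_I2) (auto simp: indicator_def intro!: ennreal_leI)
    have "emeasure lebesgue (cball (0::'a) (R + 1)) < \<infinity>"
      using emeasure_lborel_cball_finite by (simp add: emeasure_completion)
    then show "(\<integral>\<^sup>+x. ennreal ((2 * m) powr p) * indicator (cball (0::'a) (R + 1)) x \<partial>lebesgue) < \<infinity>"
      by (simp add: nn_integral_cmult_indicator ennreal_mult_less_top)
    have "AE x in lebesgue. x \<notin> N"
      using N by (simp add: AE_not_in negligible_iff_null_sets)
    then show "AE x in lebesgue. (\<lambda>n. ennreal (\<bar>w x - c n x\<bar> powr p)) \<longlonglongrightarrow> 0"
    proof eventually_elim
      case (elim x)
      have "(\<lambda>n. c n x) \<longlonglongrightarrow> \<theta> x * clip m (w x)"
        unfolding c_def clip_def by (intro tendsto_intros g(2) elim)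
      also have "\<theta> x * clip m (w x) = w x"
        using clip_eq[OF m, of x] \<theta>(3)[of x] R(2)[of x] by (cases "norm x \<le> R") auto
      finally have "(\<lambda>n. \<bar>w x - c n x\<bar>) \<longlonglongrightarrow> \<bar>w x - w x\<bar>" by (intro tendsto_intros)
      then have "(\<lambda>n. \<bar>w x - c n x\<bar> powr p) \<longlonglongrightarrow> 0"
        using p by (intro tendsto_zero_powrI[OF _ tendsto_const]) auto
      then show ?case using tendsto_ennrealI by fastforce
    qed
    show "(\<lambda>x. ennreal (\<bar>w x - c n x\<bar> powr p)) \<in> borel_measurable lebesgue" for n
      by measurable
    have [measurable]: "cball 0 (R + 1) \<in> sets (lebesgue::'a measure)" by (intro lmeasurable_cball fmeasurableD)
    show "(\<lambda>x. ennreal ((2 * m) powr p) * indicator (cball (0::'a) (R + 1)) x) \<in> borel_measurable lebesgue"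
      by measurable
  qed simp_all
  then have lim: "(\<lambda>n. \<integral>\<^sup>+x. ennreal (\<bar>w x - c n x\<bar> powr p) \<partial>lebesgue) \<longlonglongrightarrow> 0"
    by simp
  have "c n x = 0" if "x \<notin> cball 0 (R + 1)" for n x
    using \<theta>(4)[of x] that by (simp add: c_def)
  with cont lim show ?thesis by (intro exI[of _ c] conjI allI impI) auto
qed

lemma nn_integral_powr_sum3_le:
  fixes f g h :: "'a::euclidean_space \<Rightarrow> real"
  assumes [measurable]: "f \<in> borel_measurable lebesgue" "g \<in> borel_measurable lebesgue" "h \<in> borel_measurable lebesgue"
    and "p \<ge> 0" and u: "\<And>x. \<bar>u x\<bar> \<le> \<bar>f x\<bar> + \<bar>g x\<bar> + \<bar>h x\<bar>"
  shows "(\<integral>\<^sup>+x. ennreal (\<bar>u x\<bar> powr p) \<partial>lebesgue) \<le> ennreal (3 powr p) *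
    ((\<integral>\<^sup>+x. ennreal (\<bar>f x\<bar> powr p) \<partial>lebesgue) + (\<integral>\<^sup>+x. ennreal (\<bar>g x\<bar> powr p) \<partial>lebesgue)
      + (\<integral>\<^sup>+x. ennreal (\<bar>h x\<bar> powr p) \<partial>lebesgue))"
proof -
  have "(\<integral>\<^sup>+x. ennreal (\<bar>u x\<bar> powr p) \<partial>lebesgue) \<le>
    (\<integral>\<^sup>+x. ennreal (3 powr p) * (ennreal (\<bar>f x\<bar> powr p) + ennreal (\<bar>g x\<bar> powr p) + ennreal (\<bar>h x\<bar> powr p)) \<partial>lebesgue)"
  proof (rule nn_integral_mono)
    fix x
    have "\<bar>u x\<bar> powr p \<le> (\<bar>f x\<bar> + \<bar>g x\<bar> + \<bar>h x\<bar>) powr p"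
      using u[of x] \<open>p \<ge> 0\<close> by (intro powr_mono2) auto
    also have "\<dots> \<le> 3 powr p * (\<bar>f x\<bar> powr p + \<bar>g x\<bar> powr p + \<bar>h x\<bar> powr p)"
      using \<open>p \<ge> 0\<close> by (intro powr_sum3_le) auto
    finally have "ennreal (\<bar>u x\<bar> powr p) \<le> ennreal (3 powr p * (\<bar>f x\<bar> powr p + \<bar>g x\<bar> powr p + \<bar>h x\<bar> powr p))"
      by (rule ennreal_leI)
    then show "ennreal (\<bar>u x\<bar> powr p) \<le>
      ennreal (3 powr p) * (ennreal (\<bar>f x\<bar> powr p) + ennreal (\<bar>g x\<bar> powr p) + ennreal (\<bar>h x\<bar> powr p))"
      by (simp add: ennreal_mult' ennreal_plus)
  qed
  also have "\<dots> = ennreal (3 powr p) *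
    ((\<integral>\<^sup>+x. ennreal (\<bar>f x\<bar> powr p) \<partial>lebesgue) + (\<integral>\<^sup>+x. ennreal (\<bar>g x\<bar> powr p) \<partial>lebesgue)
      + (\<integral>\<^sup>+x. ennreal (\<bar>h x\<bar> powr p) \<partial>lebesgue))"
    by (simp add: nn_integral_cmult nn_integral_add)
  finally show ?thesis .
qed

lemma Lp_approx_continuous:
  fixes w :: "'a::euclidean_space \<Rightarrow> real"
  assumes w[measurable]: "w \<in> borel_measurable lebesgue" and p: "p > 0"
    and fin: "(\<integral>\<^sup>+x. ennreal (\<bar>w x\<bar> powr p) \<partial>lebesgue) < \<infinity>"
    and R: "R \<ge> 0" "\<And>x. x \<notin> cball 0 R \<Longrightarrow> w x = 0" and "\<epsilon> > 0"
  shows "\<exists>c. continuous_on UNIV c \<and> (\<forall>x. x \<notin> cball 0 (R + 1) \<longrightarrow> c x = 0) \<and>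
    (\<integral>\<^sup>+x. ennreal (\<bar>w x - c x\<bar> powr p) \<partial>lebesgue) < ennreal \<epsilon>"
proof -
  define \<epsilon>' where "\<epsilon>' = \<epsilon> / (2 * 3 powr p)"
  have "\<epsilon>' > 0" using \<open>\<epsilon> > 0\<close> by (simp add: \<epsilon>'_def)
  from order_tendstoD(2)[OF Lp_approx_clip[OF w p fin], of "ennreal \<epsilon>'"] \<open>\<epsilon>' > 0\<close>
  obtain m :: nat where m: "(\<integral>\<^sup>+x. ennreal (\<bar>w x - clip (real m) (w x)\<bar> powr p) \<partial>lebesgue) < ennreal \<epsilon>'"
    by (auto simp: eventually_sequentially)
  define v where "v x = clip (real m) (w x)" for x
  have [measurable]: "v \<in> borel_measurable lebesgue" unfolding v_def by measurable
  have v: "\<And>x. \<bar>v x\<bar> \<le> real m" "\<And>x. x \<notin> cball 0 R \<Longrightarrow> v x = 0"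
    using clip_bound[of "real m"] R(2) by (auto simp: v_def clip_eq)
  obtain c where c: "\<And>n. continuous_on UNIV (c n)" "\<And>n x. x \<notin> cball 0 (R + 1) \<Longrightarrow> c n x = 0"
    "(\<lambda>n::nat. \<integral>\<^sup>+x. ennreal (\<bar>v x - c n x\<bar> powr p) \<partial>lebesgue) \<longlonglongrightarrow> 0"
    using Lp_approx_bounded[OF \<open>v \<in> borel_measurable lebesgue\<close> p v(1) R(1) v(2)] by blast
  from order_tendstoD(2)[OF c(3), of "ennreal \<epsilon>'"] \<open>\<epsilon>' > 0\<close>
  obtain n where n: "(\<integral>\<^sup>+x. ennreal (\<bar>v x - c n x\<bar> powr p) \<partial>lebesgue) < ennreal \<epsilon>'"
    by (auto simp: eventually_sequentially)
  have [measurable]: "c n \<in> borel_measurable lebesgue"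
    using borel_measurable_continuous_onI[OF c(1)] by (intro measurable_completion) simp
  have "(\<integral>\<^sup>+x. ennreal (\<bar>w x - c n x\<bar> powr p) \<partial>lebesgue) \<le> ennreal (3 powr p) *
    ((\<integral>\<^sup>+x. ennreal (\<bar>w x - v x\<bar> powr p) \<partial>lebesgue) + (\<integral>\<^sup>+x. ennreal (\<bar>v x - c n x\<bar> powr p) \<partial>lebesgue)
      + (\<integral>\<^sup>+x. ennreal (\<bar>0\<bar> powr p) \<partial>(lebesgue::'a measure)))"
    using p by (intro nn_integral_powr_sum3_le) auto
  also have "\<dots> < ennreal (3 powr p) * (ennreal \<epsilon>' + ennreal \<epsilon>')"
    using add_strict_mono[OF m n] unfolding v_def by (intro ennreal_mult_strict_left_mono) auto
  also have "\<dots> = ennreal \<epsilon>"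
    using \<open>\<epsilon>' > 0\<close> by (simp add: ennreal_plus[symmetric] ennreal_mult'[symmetric] del: ennreal_plus)
      (simp add: \<epsilon>'_def)
  finally show ?thesis using c by (intro exI[of _ "c n"]) auto
qed

abbreviation moll :: "nat \<Rightarrow> 'a::euclidean_space \<Rightarrow> real" where
  "moll n \<equiv> mollifier (inverse (real (Suc n)))"

lemma eventually_moll_radius:
  "r0 > 0 \<Longrightarrow> \<forall>\<^sub>F n in sequentially. inverse (real (Suc n)) \<le> r0"
  using order_tendstoD(2)[OF LIMSEQ_inverse_real_of_nat, of r0]
  by (auto elim!: eventually_mono)

lemma conv_continuous:
  "integrable lebesgue w \<Longrightarrow> \<eta> \<in> test_functions UNIV \<Longrightarrow> continuous_on UNIV (conv w \<eta>)"
  using C_k_conv[of w \<eta> 0] by simp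

text \<open>
  By \<open>conv_Lp_bound\<close>, replacing \<open>w\<close> by a nearby continuous function costs a small error that is
  uniform in the radius; mollifications of a continuous function converge uniformly, with supports
  in a fixed ball.
\<close>

lemma mollify_Lp:
  fixes w :: "'a::euclidean_space \<Rightarrow> real"
  assumes w: "integrable lebesgue w" and p: "p \<ge> 1"
    and fin: "(\<integral>\<^sup>+x. ennreal (\<bar>w x\<bar> powr p) \<partial>lebesgue) < \<infinity>"
    and R: "R \<ge> 0" "\<And>x. x \<notin> cball 0 R \<Longrightarrow> w x = 0"
  shows "(\<lambda>n. \<integral>\<^sup>+x. ennreal (\<bar>conv w (moll n) x - w x\<bar> powr p) \<partial>lebesgue) \<longlonglongrightarrow> 0"
proof (rule order_tendstoI)
  fix a :: ennreal assume "0 < a"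
  then obtain x where x: "0 < x" "x < a" using dense by blast
  obtain b where b: "b > 0" "ennreal b < a"
    using x by (cases x) auto
  define C where "C = 3 powr p * (2 powr p + 2)"
  have "C > 0" by (simp add: C_def add_pos_nonneg)
  define \<epsilon> where "\<epsilon> = b / C"
  have "\<epsilon> > 0" using b \<open>C > 0\<close> by (simp add: \<epsilon>_def)
  obtain c where c: "continuous_on UNIV c" "\<And>x. x \<notin> cball 0 (R + 1) \<Longrightarrow> c x = 0"
    "(\<integral>\<^sup>+x. ennreal (\<bar>w x - c x\<bar> powr p) \<partial>lebesgue) < ennreal \<epsilon>"
    using Lp_approx_continuous[OF borel_measurable_integrable[OF w] _ fin R \<open>\<epsilon> > 0\<close>] p by auto
  have ic: "integrable lebesgue c"
    by (rule compactly_supported_integrable(2)[OF c(1) compact_cball c(2)])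
  define V where "V = measure lborel (cball (0::'a) (R + 2))"
  \<comment> \<open>A uniform error \<open>\<delta>\<close> on the ball of volume \<open>V\<close> contributes at most \<open>\<epsilon>\<close> to the integral of the \<open>p\<close>-th power.\<close>
  define \<delta> where "\<delta> = (\<epsilon> / (V + 1)) powr (1 / p)"
  have "V \<ge> 0" by (simp add: V_def)
  have "\<delta> > 0" using \<open>\<epsilon> > 0\<close> \<open>V \<ge> 0\<close> by (simp add: \<delta>_def add_nonneg_pos)
  have \<delta>p: "\<delta> powr p * V \<le> \<epsilon>"
  proof -
    have "\<delta> powr p = \<epsilon> / (V + 1)" using p \<open>\<epsilon> > 0\<close> \<open>V \<ge> 0\<close> by (simp add: \<delta>_def powr_powr)
    then have "\<delta> powr p * V = \<epsilon> * (V / (V + 1))" by simp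
    also have "\<dots> \<le> \<epsilon>" using \<open>\<epsilon> > 0\<close> \<open>V \<ge> 0\<close> by (intro mult_left_le) auto
    finally show ?thesis .
  qed
  have "\<exists>r0>0. \<forall>r x. 0 < r \<and> r \<le> r0 \<longrightarrow> \<bar>conv c (mollifier r) x - c x\<bar> \<le> \<delta>"
    by (rule mollify_continuous[OF c(1) _ \<open>\<delta> > 0\<close>, where R="R + 1"]) (rule c(2))
  then obtain r0 where "r0 > 0 \<and> (\<forall>r x. 0 < r \<and> r \<le> r0 \<longrightarrow> \<bar>conv c (mollifier r) x - c x\<bar> \<le> \<delta>)"
    by (rule exE)
  then have r0: "r0 > 0" "\<And>r x. 0 < r \<Longrightarrow> r \<le> r0 \<Longrightarrow> \<bar>conv c (mollifier r) x - c x\<bar> \<le> \<delta>"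
    by simp_all
  have "(\<integral>\<^sup>+x. ennreal (\<bar>conv w (mollifier r) x - w x\<bar> powr p) \<partial>lebesgue) < a"
    if r: "0 < r" "r \<le> r0" "r \<le> 1" for r
  proof -
    let ?\<eta> = "mollifier r :: 'a \<Rightarrow> real"
    note \<eta> = mollifier_test[OF r(1), where 'a='a]
    have [measurable]: "w \<in> borel_measurable lebesgue" "c \<in> borel_measurable lebesgue"
      using w ic by auto
    have conv_meas: "conv v ?\<eta> \<in> borel_measurable lebesgue" if "integrable lebesgue v" for v
      using borel_measurable_continuous_onI[OF conv_continuous[OF that \<eta>]]
      by (intro measurable_completion) simp
    note [measurable] = conv_meas[OF w] conv_meas[OF ic] conv_meas[OF Bochner_Integration.integrable_diff[OF w ic]]
    have A: "(\<integral>\<^sup>+x. ennreal (\<bar>conv (\<lambda>y. w y - c y) ?\<eta> x\<bar> powr p) \<partial>lebesgue)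
        \<le> ennreal (2 powr p) * (\<integral>\<^sup>+x. ennreal (\<bar>w x - c x\<bar> powr p) \<partial>lebesgue)"
      using w ic by (intro conv_Lp_bound p r) auto
    have B: "(\<integral>\<^sup>+x. ennreal (\<bar>conv c ?\<eta> x - c x\<bar> powr p) \<partial>lebesgue) \<le> ennreal \<epsilon>"
    proof -
      have "(\<integral>\<^sup>+x. ennreal (\<bar>conv c ?\<eta> x - c x\<bar> powr p) \<partial>lebesgue)
         \<le> (\<integral>\<^sup>+x. ennreal (\<delta> powr p) * indicator (cball (0::'a) (R + 2)) x \<partial>lebesgue)"
      proof (rule nn_integral_mono)
        fix x :: 'a
        have "\<bar>conv c ?\<eta> x - c x\<bar> powr p \<le> \<delta> powr p"
          using p r0(2)[OF r(1,2)] by (intro powr_mono2) auto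
        moreover have "conv c ?\<eta> x - c x = 0" if "x \<notin> cball 0 (R + 2)"
        proof -
          have "cball x r \<inter> cball 0 (R + 1) = {}"
          proof safe
            fix y assume "y \<in> cball x r" "y \<in> cball 0 (R + 1)"
            then have "norm x \<le> R + 2"
              using norm_triangle_ineq[of y "x - y"] r(3) by (auto simp: dist_norm)
            then show "y \<in> {}" using that by simp
          qed
          then have "conv c ?\<eta> x = 0"
            using c(2) by (intro conv_outside[where K="cball 0 (R + 1)" and r=r] mollifier_outside[OF r(1)]) auto
          moreover have "c x = 0" using that by (intro c(2)) auto
          ultimately show ?thesis by simp
        qed
        ultimately show "ennreal (\<bar>conv c ?\<eta> x - c x\<bar> powr p) \<le> ennreal (\<delta> powr p) * indicator (cball 0 (R + 2)) x"
          by (auto simp: indicator_def intro!: ennreal_leI)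
      qed
      also have "\<dots> = ennreal (\<delta> powr p) * emeasure lborel (cball (0::'a) (R + 2))"
        by (simp add: nn_integral_cmult_indicator)
      also have "\<dots> = ennreal (\<delta> powr p * V)"
        unfolding V_def using emeasure_lborel_cball_finite[of "0::'a" "R + 2"]
        by (simp add: ennreal_mult' emeasure_eq_ennreal_measure)
      also have "\<dots> \<le> ennreal \<epsilon>" using \<delta>p by (rule ennreal_leI)
      finally show ?thesis .
    qed
    have D: "(\<integral>\<^sup>+x. ennreal (\<bar>c x - w x\<bar> powr p) \<partial>lebesgue) < ennreal \<epsilon>"
      using c(3) by (simp add: abs_minus_commute)
    have "(\<integral>\<^sup>+x. ennreal (\<bar>conv w ?\<eta> x - w x\<bar> powr p) \<partial>lebesgue) \<le> ennreal (3 powr p) *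
      ((\<integral>\<^sup>+x. ennreal (\<bar>conv (\<lambda>y. w y - c y) ?\<eta> x\<bar> powr p) \<partial>lebesgue) +
       (\<integral>\<^sup>+x. ennreal (\<bar>conv c ?\<eta> x - c x\<bar> powr p) \<partial>lebesgue) +
       (\<integral>\<^sup>+x. ennreal (\<bar>c x - w x\<bar> powr p) \<partial>lebesgue))"
    proof (rule nn_integral_powr_sum3_le)
      fix x
      show "\<bar>conv w ?\<eta> x - w x\<bar> \<le> \<bar>conv (\<lambda>y. w y - c y) ?\<eta> x\<bar> + \<bar>conv c ?\<eta> x - c x\<bar> + \<bar>c x - w x\<bar>"
        using conv_diff[OF w ic \<eta>, of x] by linarith
    qed (use p in auto)
    also have "\<dots> \<le> ennreal (3 powr p) * (ennreal (2 powr p) * ennreal \<epsilon> + ennreal \<epsilon> + ennreal \<epsilon>)"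
      using c(3) D by (intro mult_left_mono add_mono B order_trans[OF A] less_imp_le) (auto intro: less_imp_le)
    also have "\<dots> = ennreal (C * \<epsilon>)"
      using \<open>\<epsilon> > 0\<close> by (simp add: ennreal_plus[symmetric] ennreal_mult'[symmetric] del: ennreal_plus)
        (simp add: C_def algebra_simps)
    also have "\<dots> = ennreal b" using \<open>C > 0\<close> by (simp add: \<epsilon>_def)
    finally show ?thesis using b by simp
  qed
  moreover have "\<forall>\<^sub>F n in sequentially. inverse (real (Suc n)) \<le> r0 \<and> inverse (real (Suc n)) \<le> 1"
    using eventually_moll_radius[OF r0(1)] eventually_moll_radius[of 1] by (auto elim: eventually_elim2)
  ultimately show "\<forall>\<^sub>F n in sequentially. (\<integral>\<^sup>+x. ennreal (\<bar>conv w (moll n) x - w x\<bar> powr p) \<partial>lebesgue) < a"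
    by (auto elim!: eventually_mono)
qed auto

section \<open>Mollification and uniqueness of weak gradients\<close>

lemma compact_neighbourhood:
  fixes K :: "'a::euclidean_space set"
  assumes "compact K" "open \<Omega>" "K \<subseteq> \<Omega>"
  shows "\<exists>r K'. r > 0 \<and> compact K' \<and> K' \<subseteq> \<Omega> \<and> (\<forall>x\<in>K. cball x r \<subseteq> K')"
proof -
  obtain r where r: "r > 0" "(\<Union>x\<in>K. cball x r) \<subseteq> \<Omega>"
    using compact_subset_open_imp_cball_epsilon_subset[OF assms] by blast
  have eq: "(\<Union>x\<in>K. cball x r) = {x + y |x y. x \<in> K \<and> y \<in> cball 0 r}"
  proof safe
    fix x z assume "x \<in> K" "z \<in> cball x r"
    then show "\<exists>x' y. z = x' + y \<and> x' \<in> K \<and> y \<in> cball 0 r"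
      by (intro exI[of _ x] exI[of _ "z - x"]) (auto simp: dist_norm norm_minus_commute)
  next
    fix x y :: 'a assume "x \<in> K" "y \<in> cball 0 r"
    then show "x + y \<in> (\<Union>x\<in>K. cball x r)"
      by (intro UN_I[of x]) (auto simp: dist_norm)
  qed
  have "compact (\<Union>x\<in>K. cball x r)"
    unfolding eq by (intro compact_sums assms(1) compact_cball)
  then show ?thesis using r by blast
qed

lemma locally_integrable_indicator:
  fixes u :: "'a::euclidean_space \<Rightarrow> 'b::euclidean_space"
  shows "locally_integrable_on u \<Omega> \<Longrightarrow> compact K \<Longrightarrow> K \<subseteq> \<Omega> \<Longrightarrow>
    integrable lebesgue (\<lambda>x. indicator K x *\<^sub>R u x)"
  by (auto simp: locally_integrable_on_def set_integrable_def)

lemma locally_integrable_indicator_real: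
  fixes u :: "'a::euclidean_space \<Rightarrow> real"
  shows "locally_integrable_on u \<Omega> \<Longrightarrow> compact K \<Longrightarrow> K \<subseteq> \<Omega> \<Longrightarrow>
    integrable lebesgue (\<lambda>x. indicator K x * u x)"
  using locally_integrable_indicator[of u \<Omega> K] by simp

lemma locally_integrable_indicator_inner:
  fixes g :: "'a::euclidean_space \<Rightarrow> 'a"
  assumes "locally_integrable_on g \<Omega>" "compact K" "K \<subseteq> \<Omega>"
  shows "integrable lebesgue (\<lambda>x. indicator K x * (g x \<bullet> e))"
  using integrable_inner_left[OF locally_integrable_indicator[OF assms], of e] by simp

lemma has_weak_gradientD:
  assumes "has_weak_gradient \<Omega> u g"
  shows "locally_integrable_on u \<Omega>" "locally_integrable_on g \<Omega>"
    and "\<And>\<psi> e. \<psi> \<in> test_functions \<Omega> \<Longrightarrow> e \<in> Basis \<Longrightarrow>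
      (LINT x:\<Omega>|lebesgue. u x * frechet_derivative \<psi> (at x) e) = - (LINT x:\<Omega>|lebesgue. (g x \<bullet> e) * \<psi> x)"
  using assms by (auto simp: has_weak_gradient_def)

text \<open>
  Cutting \<open>u\<close> and \<open>g\<close> off outside a compact set turns locally integrable functions into integrable
  ones, and a test function supported in that set does not notice.
\<close>

lemma weak_gradient_localised:
  assumes \<psi>: "\<psi> \<in> test_functions UNIV" and "\<forall>x. x \<notin> K0 \<longrightarrow> \<psi> x = 0" "closed K0" "K0 \<subseteq> S" "S \<subseteq> \<Omega>"
  shows "(LINT x:\<Omega>|lebesgue. u x * frechet_derivative \<psi> (at x) e)
      = (LINT x|lebesgue. (indicator S x * u x) * frechet_derivative \<psi> (at x) e)"
    and "(LINT x:\<Omega>|lebesgue. (g x \<bullet> e) * \<psi> x) = (LINT x|lebesgue. (indicator S x * (g x \<bullet> e)) * \<psi> x)"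
proof -
  have z: "frechet_derivative \<psi> (at x) e = 0" "\<psi> x = 0" if "x \<notin> K0" for x
    using frechet_derivative_zero_outside[OF assms(3) _ that, of \<psi>] assms(2) that by auto
  have "indicator \<Omega> x * (u x * frechet_derivative \<psi> (at x) e) = (indicator S x * u x) * frechet_derivative \<psi> (at x) e"
    "indicator \<Omega> x * ((g x \<bullet> e) * \<psi> x) = (indicator S x * (g x \<bullet> e)) * \<psi> x" for x
    using z[of x] assms(4,5) by (cases "x \<in> K0"; auto simp: indicator_def)+
  then show "(LINT x:\<Omega>|lebesgue. u x * frechet_derivative \<psi> (at x) e)
      = (LINT x|lebesgue. (indicator S x * u x) * frechet_derivative \<psi> (at x) e)"
    "(LINT x:\<Omega>|lebesgue. (g x \<bullet> e) * \<psi> x) = (LINT x|lebesgue. (indicator S x * (g x \<bullet> e)) * \<psi> x)"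
    unfolding set_lebesgue_integral_def real_scaleR_def by presburger+
qed

text \<open>
  The reflected and translated kernel is an admissible test function as long as its support stays
  inside \<open>\<Omega>\<close>; hence mollification commutes with weak differentiation.
\<close>

lemma weak_gradient_conv:
  fixes u :: "'a::euclidean_space \<Rightarrow> real"
  assumes wg: "has_weak_gradient \<Omega> u g" and e: "e \<in> Basis"
    and \<eta>: "\<eta> \<in> test_functions UNIV" "\<And>z. z \<notin> cball 0 r \<Longrightarrow> \<eta> z = 0"
    and K: "cball x r \<subseteq> K" "K \<subseteq> \<Omega>"
  shows "conv (\<lambda>y. indicator K y * u y) (\<lambda>z. frechet_derivative \<eta> (at z) e) x
    = conv (\<lambda>y. indicator K y * (g y \<bullet> e)) \<eta> x"
proof -
  define \<psi> where "\<psi> y = 1 * \<eta> (x - y)" for y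
  have z: "\<psi> y = 0" if "y \<notin> cball x r" for y
    using that \<eta>(2)[of "x - y"] by (simp add: \<psi>_def dist_norm norm_minus_commute)
  have z': "\<forall>y. y \<notin> cball x r \<longrightarrow> \<psi> y = 0" using z by blast
  have C: "\<forall>k. C_k k \<psi>"
    unfolding \<psi>_def using C_k_reflect test_functionsD(1)[OF \<eta>(1)] by blast
  have t: "\<psi> \<in> test_functions \<Omega>" "\<psi> \<in> test_functions UNIV"
    by (rule test_functionsI[OF C compact_cball _ z]; use K in auto)+
  have d: "frechet_derivative \<psi> (at y) e = - frechet_derivative \<eta> (at (x - y)) e" for y
  proof -
    have "(\<psi> has_derivative (\<lambda>h. - 1 * frechet_derivative \<eta> (at (x - y)) h)) (at y)"
      unfolding \<psi>_def
      by (rule has_derivative_reflect[OF C_k_differentiable[OF test_functionsD(1)[OF \<eta>(1)]]])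
    from frechet_derivative_at[OF this, symmetric] show ?thesis by simp
  qed
  have "- conv (\<lambda>y. indicator K y * u y) (\<lambda>z. frechet_derivative \<eta> (at z) e) x
      = (LINT y|lebesgue. (indicator K y * u y) * frechet_derivative \<psi> (at y) e)"
    unfolding conv_def d by simp
  also have "\<dots> = (LINT y:\<Omega>|lebesgue. u y * frechet_derivative \<psi> (at y) e)"
    by (rule weak_gradient_localised(1)[OF t(2) z' closed_cball K, symmetric])
  also have "\<dots> = - (LINT y:\<Omega>|lebesgue. (g y \<bullet> e) * \<psi> y)"
    by (rule has_weak_gradientD(3)[OF wg t(1) e])
  also have "(LINT y:\<Omega>|lebesgue. (g y \<bullet> e) * \<psi> y) = (LINT y|lebesgue. (indicator K y * (g y \<bullet> e)) * \<psi> y)"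
    by (rule weak_gradient_localised(2)[OF t(2) z' closed_cball K])
  also have "\<dots> = conv (\<lambda>y. indicator K y * (g y \<bullet> e)) \<eta> x"
    by (simp add: conv_def \<psi>_def)
  finally show ?thesis by simp
qed

lemma mollify_compact_support:
  fixes w :: "'a::euclidean_space \<Rightarrow> real"
  assumes "integrable lebesgue w" "p \<ge> 1" "(\<integral>\<^sup>+x. ennreal (\<bar>w x\<bar> powr p) \<partial>lebesgue) < \<infinity>"
    and "compact K" "\<And>x. x \<notin> K \<Longrightarrow> w x = 0"
  shows "(\<lambda>n. \<integral>\<^sup>+x. ennreal (\<bar>conv w (moll n) x - w x\<bar> powr p) \<partial>lebesgue) \<longlonglongrightarrow> 0"
proof -
  obtain R where R: "R > 0" "\<And>x. x \<in> K \<Longrightarrow> norm x \<le> R"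
    using compact_imp_bounded[OF assms(4)] unfolding bounded_pos by auto
  show ?thesis
  proof (rule mollify_Lp[OF assms(1-3)])
    show "w x = 0" if "x \<notin> cball 0 R" for x
      using that R(2)[of x] assms(5)[of x] by auto
  qed (use R in simp)
qed

lemma mollify_L1:
  fixes w :: "'a::euclidean_space \<Rightarrow> real"
  assumes "integrable lebesgue w" "compact K" "\<And>x. x \<notin> K \<Longrightarrow> w x = 0"
  shows "(\<lambda>n. \<integral>\<^sup>+x. ennreal \<bar>conv w (moll n) x - w x\<bar> \<partial>lebesgue) \<longlonglongrightarrow> 0"
proof -
  have "(\<integral>\<^sup>+x. ennreal (\<bar>w x\<bar> powr 1) \<partial>lebesgue) < \<infinity>"
    using assms(1) by (simp add: integrable_iff_bounded)
  from mollify_compact_support[OF assms(1) _ this assms(2,3)] show ?thesis by simp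
qed

lemma compact_exhaustion:
  fixes \<Omega> :: "'a::euclidean_space set"
  assumes "open \<Omega>"
  shows "\<exists>C::nat \<Rightarrow> 'a set. (\<forall>n. compact (C n) \<and> C n \<subseteq> \<Omega> \<and> C n \<subseteq> interior (C (Suc n))) \<and>
    (\<forall>K. compact K \<longrightarrow> K \<subseteq> \<Omega> \<longrightarrow> (\<exists>N. \<forall>n\<ge>N. K \<subseteq> C n))"
proof (rule open_Union_compact_subsets[OF assms], goal_cases)
  case (1 C)
  show ?case
    by (intro exI[of _ C] conjI allI impI 1(1-3) 1(5))
qed

lemma AE_on_open_from_compact:
  fixes \<Omega> :: "'a::euclidean_space set"
  assumes "open \<Omega>" "\<And>K. compact K \<Longrightarrow> K \<subseteq> \<Omega> \<Longrightarrow> AE x in lebesgue. x \<in> K \<longrightarrow> P x"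
  shows "AE x in lebesgue. x \<in> \<Omega> \<longrightarrow> P x"
proof -
  obtain C :: "nat \<Rightarrow> 'a set" where C: "\<And>n. compact (C n)" "\<And>n. C n \<subseteq> \<Omega>" "\<Union>(range C) = \<Omega>"
    using open_Union_compact_subsets[OF assms(1)] by metis
  have "AE x in lebesgue. \<forall>n. x \<in> C n \<longrightarrow> P x"
    unfolding AE_all_countable using assms(2)[OF C(1,2)] by blast
  then show ?thesis by eventually_elim (use C(3) in blast)
qed

text \<open>
  On a compact set the mollifications of two weak gradients of \<open>u\<close> are eventually both equal to the
  derivative of the mollification of \<open>u\<close>, and they converge to the gradients in \<open>L\<^sup>1\<close>.
\<close>

lemma weak_gradient_unique:
  fixes u :: "'a::euclidean_space \<Rightarrow> real"
  assumes "open \<Omega>" and g: "has_weak_gradient \<Omega> u g" and h: "has_weak_gradient \<Omega> u h"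
  shows "AE x in lebesgue. x \<in> \<Omega> \<longrightarrow> g x = h x"
proof (rule AE_on_open_from_compact[OF assms(1)])
  fix K assume K: "compact K" "K \<subseteq> \<Omega>"
  obtain r K' where r: "r > 0" "compact K'" "K' \<subseteq> \<Omega>" "\<And>x. x \<in> K \<Longrightarrow> cball x r \<subseteq> K'"
    using compact_neighbourhood[OF K(1) assms(1) K(2)] by blast
  have "AE x in lebesgue. \<forall>e\<in>Basis. x \<in> K \<longrightarrow> g x \<bullet> e = h x \<bullet> e"
  proof (rule AE_finite_allI[OF finite_Basis])
    fix e :: 'a assume e: "e \<in> Basis"
    define G where "G y = indicator K' y * (g y \<bullet> e)" for y
    define H where "H y = indicator K' y * (h y \<bullet> e)" for y
    have int: "integrable lebesgue G" "integrable lebesgue H"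
      unfolding G_def H_def
      using locally_integrable_indicator_inner[OF has_weak_gradientD(2)[OF g] r(2,3)]
        locally_integrable_indicator_inner[OF has_weak_gradientD(2)[OF h] r(2,3)] by auto
    define w where "w y = G y - H y" for y
    have iw: "integrable lebesgue w" unfolding w_def using int by simp
    then have [measurable]: "w \<in> borel_measurable lebesgue" by auto
    have [measurable]: "K \<in> sets lebesgue" using K(1) by (intro fmeasurableD lmeasurable_compact)
    have "\<forall>\<^sub>F n in sequentially. (\<integral>\<^sup>+x. ennreal \<bar>w x\<bar> * indicator K x \<partial>lebesgue)
        \<le> (\<integral>\<^sup>+x. ennreal \<bar>conv w (moll n) x - w x\<bar> \<partial>lebesgue)"
      using eventually_moll_radius[OF r(1)]
    proof eventually_elim
      case (elim n)
      show ?case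
      proof (rule nn_integral_mono)
        fix x
        have "conv w (moll n) x = 0" if "x \<in> K"
        proof -
          have t: "moll n \<in> test_functions (UNIV :: 'a set)" by (rule mollifier_test) simp
          have z: "moll n z = 0" if "z \<notin> cball 0 r" for z :: 'a
            using that elim by (intro mollifier_outside) auto
          have "conv w (moll n) x = conv G (moll n) x - conv H (moll n) x"
            unfolding w_def by (rule conv_diff[OF int t])
          also have "conv G (moll n) x = conv H (moll n) x"
            unfolding G_def H_def
            using weak_gradient_conv[OF g e t z r(4)[OF that] r(3)]
              weak_gradient_conv[OF h e t z r(4)[OF that] r(3)] by simp
          finally show ?thesis by simp
        qed
        then show "ennreal \<bar>w x\<bar> * indicator K x \<le> ennreal \<bar>conv w (moll n) x - w x\<bar>"
          by (auto simp: indicator_def)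
      qed
    qed
    moreover have "(\<lambda>n. \<integral>\<^sup>+x. ennreal \<bar>conv w (moll n) x - w x\<bar> \<partial>lebesgue) \<longlonglongrightarrow> 0"
      by (rule mollify_L1[OF iw r(2)]) (simp add: w_def G_def H_def)
    ultimately have "(\<integral>\<^sup>+x. ennreal \<bar>w x\<bar> * indicator K x \<partial>lebesgue) \<le> 0"
      by (intro tendsto_lowerbound[where F=sequentially]) auto
    then have "(\<integral>\<^sup>+x. ennreal \<bar>w x\<bar> * indicator K x \<partial>lebesgue) = 0" by simp
    then have "AE x in lebesgue. ennreal \<bar>w x\<bar> * indicator K x = 0"
      by (subst (asm) nn_integral_0_iff_AE) auto
    then show "AE x in lebesgue. x \<in> K \<longrightarrow> g x \<bullet> e = h x \<bullet> e"
    proof eventually_elim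
      case (elim x)
      have "x \<in> K'" if "x \<in> K" using r(4)[OF that] r(1) centre_in_cball[of x r] by auto
      with elim show ?case
        by (auto simp: w_def G_def H_def indicator_def split: if_splits)
    qed
  qed
  then show "AE x in lebesgue. x \<in> K \<longrightarrow> g x = h x"
    by eventually_elim (auto intro: euclidean_eqI)
qed

section \<open>Integration by parts\<close>

lemma integral_translate:
  fixes P :: "'a::euclidean_space \<Rightarrow> real"
  assumes [measurable]: "P \<in> borel_measurable borel"
  shows "(LINT x|lborel. P (x + c)) = (LINT x|lborel. P x)"
proof -
  have "(LINT x|lborel. P x) = (LINT x|distr lborel borel ((+) c). P x)"
    by (simp add: lborel_distr_plus)
  also have "\<dots> = (LINT x|lborel. P (c + x))"
    by (rule integral_distr) auto
  finally show ?thesis by (simp add: add.commute)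
qed

lemma derivative_along_line:
  assumes "\<And>x. (P has_derivative P' x) (at x)"
  shows "((\<lambda>s. P (x + s *\<^sub>R e)) has_real_derivative P' (x + s *\<^sub>R e) e) (at s)"
proof -
  have "((\<lambda>s. x + s *\<^sub>R e) has_derivative (\<lambda>t. t *\<^sub>R e)) (at s)"
    by (auto intro!: derivative_eq_intros)
  from has_derivative_compose[OF this assms]
  have "((\<lambda>s. P (x + s *\<^sub>R e)) has_derivative (\<lambda>t. P' (x + s *\<^sub>R e) (t *\<^sub>R e))) (at s)" .
  moreover have "P' (x + s *\<^sub>R e) (t *\<^sub>R e) = P' (x + s *\<^sub>R e) e * t" for t
    using linear_scale[OF has_derivative_linear[OF assms]] by (simp add: mult.commute)
  ultimately show ?thesis by (simp add: has_field_derivative_def)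
qed

text \<open>
  Difference quotients of \<open>P\<close> have integral \<open>0\<close> by translation invariance. They are uniformly
  bounded, have supports in a fixed compact set, and converge to the derivative.
\<close>

lemma integral_partial_zero:
  fixes P :: "'a::euclidean_space \<Rightarrow> real"
  assumes d: "\<And>x. (P has_derivative P' x) (at x)" and cont: "continuous_on UNIV (\<lambda>x. P' x e)"
    and K: "compact K" "\<And>x. x \<notin> K \<Longrightarrow> P x = 0"
  shows "(LINT x|lebesgue. P' x e) = 0"
proof -
  have P'z: "P' x e = 0" if "x \<notin> K" for x
  proof -
    have "P' x = frechet_derivative P (at x)" by (rule frechet_derivative_at[OF d])
    also have "\<dots> = (\<lambda>h. 0)"
      by (rule frechet_derivative_zero_outside[OF compact_imp_closed[OF K(1)] K(2) that])
    finally show ?thesis by simp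
  qed
  obtain B where B: "B > 0" "\<And>x. \<bar>P' x e\<bar> \<le> B"
    using compactly_supported_bounded[OF cont K(1) P'z] by blast
  have contP: "continuous_on UNIV P"
    using d by (auto intro!: continuous_at_imp_continuous_on has_derivative_continuous)
  have [measurable]: "P \<in> borel_measurable borel" "(\<lambda>x. P' x e) \<in> borel_measurable borel"
    using contP cont by (auto intro: borel_measurable_continuous_onI)
  note iP = compactly_supported_integrable(1)[OF contP K]
  define t where "t n = inverse (real (Suc n))" for n
  have t: "0 < t n" "t n \<le> 1" for n by (auto simp: t_def field_simps)
  have t0: "t \<longlonglongrightarrow> 0" unfolding t_def by (rule LIMSEQ_inverse_real_of_nat)
  define f where "f n x = (P (x + t n *\<^sub>R e) - P x) / t n" for n x
  define K1 where "K1 = {x + y |x y. x \<in> K \<and> y \<in> cball 0 (norm e)}"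
  have K1: "compact K1" unfolding K1_def by (intro compact_sums K(1) compact_cball)
  have mvt: "\<bar>f n x\<bar> \<le> B" for n x
  proof -
    have "\<bar>P (x + t n *\<^sub>R e) - P (x + 0 *\<^sub>R e)\<bar> \<le> B * \<bar>t n - 0\<bar>"
      using field_differentiable_bound[of UNIV "\<lambda>s. P (x + s *\<^sub>R e)" "\<lambda>s. P' (x + s *\<^sub>R e) e" B "t n" 0]
        derivative_along_line[OF d] B(2) by simp
    then show ?thesis using t[of n] by (simp add: f_def field_simps)
  qed
  have fz: "f n x = 0" if "x \<notin> K1" for n x
  proof -
    have "x \<notin> K"
    proof
      assume "x \<in> K"
      then have "x + 0 \<in> K1" unfolding K1_def by (intro CollectI exI[of _ x] exI[of _ 0]) auto
      then show False using that by simp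
    qed
    moreover have "x + t n *\<^sub>R e \<notin> K"
    proof
      assume "x + t n *\<^sub>R e \<in> K"
      moreover have "- (t n *\<^sub>R e) \<in> cball 0 (norm e)"
        using t[of n] by (auto intro!: mult_left_le_one_le)
      ultimately have "(x + t n *\<^sub>R e) + - (t n *\<^sub>R e) \<in> K1" unfolding K1_def by blast
      then show False using that by simp
    qed
    ultimately show ?thesis using K(2) by (simp add: f_def)
  qed
  have "(LINT x|lborel. f n x) = 0" for n
  proof -
    have [measurable]: "(\<lambda>x. P (x + t n *\<^sub>R e)) \<in> borel_measurable borel" by measurable
    have "integrable lborel (\<lambda>x. P (x + t n *\<^sub>R e))"
    proof -
      have "integrable (distr lborel borel ((+) (t n *\<^sub>R e))) P"
        unfolding lborel_distr_plus by (rule iP)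
      then have "integrable lborel (\<lambda>x. P (t n *\<^sub>R e + x))"
        by (subst (asm) integrable_distr_eq) auto
      then show ?thesis by (simp add: add.commute)
    qed
    then have "(LINT x|lborel. f n x) = ((LINT x|lborel. P (x + t n *\<^sub>R e)) - (LINT x|lborel. P x)) / t n"
      unfolding f_def using iP by simp
    then show ?thesis by (simp add: integral_translate)
  qed
  moreover have "(\<lambda>n. LINT x|lborel. f n x) \<longlonglongrightarrow> (LINT x|lborel. P' x e)"
  proof (rule integral_dominated_convergence[where w="\<lambda>x. B * indicator K1 x"])
    show "(\<lambda>x. P' x e) \<in> borel_measurable lborel" by measurable
    show "f n \<in> borel_measurable lborel" for n unfolding f_def by measurable
    have "integrable lborel (indicator K1 :: 'a \<Rightarrow> real)"
      using K1 emeasure_compact_finite[OF K1]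
      by (intro integrable_real_indicator) (auto intro: borel_compact)
    then show "integrable lborel (\<lambda>x. B * indicator K1 x)" by simp
    show "AE x in lborel. norm (f n x) \<le> B * indicator K1 x" for n
      using mvt[of n] fz[of _ n] by (intro AE_I2) (auto simp: indicator_def)
    show "AE x in lborel. (\<lambda>n. f n x) \<longlonglongrightarrow> P' x e"
    proof (rule AE_I2)
      fix x
      have "((\<lambda>h. (P (x + (0 + h) *\<^sub>R e) - P (x + 0 *\<^sub>R e)) / h) \<longlongrightarrow> P' (x + 0 *\<^sub>R e) e) (at 0)"
        by (rule DERIV_D[OF derivative_along_line[OF d]])
      moreover have "filterlim t (at 0) sequentially"
        using t0 t(1) by (auto simp: filterlim_at less_imp_neq[symmetric] intro!: always_eventually)
      ultimately have "((\<lambda>n. (P (x + (0 + t n) *\<^sub>R e) - P (x + 0 *\<^sub>R e)) / t n) \<longlongrightarrow> P' (x + 0 *\<^sub>R e) e) sequentially"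
        by (rule filterlim_compose)
      then show "(\<lambda>n. f n x) \<longlonglongrightarrow> P' x e" by (simp add: f_def)
    qed
  qed
  ultimately have "(LINT x|lborel. P' x e) = 0" by (simp add: LIMSEQ_const_iff)
  then show ?thesis by (simp add: integral_completion)
qed

lemma integration_by_parts:
  fixes F :: "'a::euclidean_space \<Rightarrow> real"
  assumes F: "\<And>x. (F has_derivative F' x) (at x)" "continuous_on UNIV (\<lambda>x. F' x e)"
    and \<psi>: "\<psi> \<in> test_functions \<Omega>" and e: "e \<in> Basis"
  shows "(LINT x|lebesgue. F x * frechet_derivative \<psi> (at x) e) = - (LINT x|lebesgue. F' x e * \<psi> x)"
proof -
  let ?K = "closure {x. \<psi> x \<noteq> 0}"
  note K = test_functionsD(2)[OF \<psi>]
  note out = test_functions_outside[OF \<psi>]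
  have cF: "continuous_on UNIV F"
    using F(1) by (auto intro!: continuous_at_imp_continuous_on has_derivative_continuous)
  note c\<psi> = C_k_continuous[OF test_functionsD(1)[OF \<psi>]]
  note cd = C_k_continuous[OF test_functionsD(1)[OF test_functions_partial[OF \<psi> e]]]
  have d\<psi>: "(\<psi> has_derivative frechet_derivative \<psi> (at x)) (at x)" for x
    by (rule C_k_differentiable[OF test_functionsD(1)[OF \<psi>]])
  have z1: "F x * frechet_derivative \<psi> (at x) e = 0" if "x \<notin> ?K" for x
    unfolding out(2)[OF that] by simp
  have z2: "G x * \<psi> x = 0" if "x \<notin> ?K" for x G
    unfolding out(1)[OF that] by simp
  have i1: "integrable lebesgue (\<lambda>x. F x * frechet_derivative \<psi> (at x) e)"
    by (rule compactly_supported_integrable(2)[OF continuous_on_mult[OF cF cd] K]) (rule z1)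
  have i2: "integrable lebesgue (\<lambda>x. F' x e * \<psi> x)"
    by (rule compactly_supported_integrable(2)[OF continuous_on_mult[OF F(2) c\<psi>] K]) (rule z2)
  have "(LINT x|lebesgue. F x * frechet_derivative \<psi> (at x) e + F' x e * \<psi> x) = 0"
  proof (rule integral_partial_zero)
    show "((\<lambda>x. F x * \<psi> x) has_derivative (\<lambda>h. F x * frechet_derivative \<psi> (at x) h + F' x h * \<psi> x)) (at x)" for x
      by (rule has_derivative_mult[OF F(1) d\<psi>])
    show "continuous_on UNIV (\<lambda>x. F x * frechet_derivative \<psi> (at x) e + F' x e * \<psi> x)"
      by (intro continuous_on_add continuous_on_mult cF cd c\<psi> F(2))
    show "F x * \<psi> x = 0" if "x \<notin> ?K" for x by (rule z2[OF that])
  qed (rule K)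
  then show ?thesis using i1 i2 by simp
qed

definition grad :: "('a::euclidean_space \<Rightarrow> real) \<Rightarrow> 'a \<Rightarrow> 'a" where
  "grad \<psi> x = (\<Sum>e\<in>Basis. frechet_derivative \<psi> (at x) e *\<^sub>R e)"

lemma grad_inner: "e \<in> Basis \<Longrightarrow> grad \<psi> x \<bullet> e = frechet_derivative \<psi> (at x) e"
  by (simp add: grad_def inner_sum_left inner_Basis if_distrib cong: if_cong)

lemma grad_continuous: "\<psi> \<in> test_functions \<Omega> \<Longrightarrow> continuous_on UNIV (grad \<psi>)"
  unfolding grad_def
  by (intro continuous_on_sum continuous_on_scaleR continuous_on_const
      C_k_continuous[OF test_functionsD(1)[OF test_functions_partial]])

lemma locally_integrable_continuous:
  fixes f :: "'a::euclidean_space \<Rightarrow> 'b::euclidean_space"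
  assumes "continuous_on UNIV f"
  shows "locally_integrable_on f \<Omega>"
  unfolding locally_integrable_on_def set_integrable_def
proof (intro allI impI)
  fix K assume "compact K \<and> K \<subseteq> \<Omega>"
  then have "integrable lborel (\<lambda>x. indicator K x *\<^sub>R f x)"
    by (intro borel_integrable_compact continuous_on_subset[OF assms]) auto
  then show "integrable lebesgue (\<lambda>x. indicator K x *\<^sub>R f x)"
    by (simp add: integrable_completion borel_measurable_integrable)
qed

lemma test_function_weak_gradient:
  assumes \<psi>: "\<psi> \<in> test_functions V"
  shows "has_weak_gradient \<Omega> \<psi> (grad \<psi>)"
  unfolding has_weak_gradient_def
proof (intro conjI ballI)
  show "locally_integrable_on \<psi> \<Omega>"
    by (rule locally_integrable_continuous[OF C_k_continuous[OF test_functionsD(1)[OF \<psi>]]])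
  show "locally_integrable_on (grad \<psi>) \<Omega>"
    by (rule locally_integrable_continuous[OF grad_continuous[OF \<psi>]])
  fix \<phi> and e :: 'a assume \<phi>: "\<phi> \<in> test_functions \<Omega>" and e: "e \<in> Basis"
  have \<phi>': "\<phi> \<in> test_functions UNIV" using test_functions_mono[OF _ \<phi>] by simp
  have z: "\<forall>x. x \<notin> closure {x. \<phi> x \<noteq> 0} \<longrightarrow> \<phi> x = 0" using test_functions_outside(1)[OF \<phi>] by blast
  have "(LINT x:\<Omega>|lebesgue. \<psi> x * frechet_derivative \<phi> (at x) e)
    = (LINT x:UNIV|lebesgue. \<psi> x * frechet_derivative \<phi> (at x) e)"
    using weak_gradient_localised(1)[OF \<phi>' z closed_closure test_functionsD(3)[OF \<phi>] subset_refl]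
      weak_gradient_localised(1)[OF \<phi>' z closed_closure test_functionsD(3)[OF \<phi>] subset_UNIV] by simp
  also have "\<dots> = (LINT x|lebesgue. \<psi> x * frechet_derivative \<phi> (at x) e)"
    by (simp add: set_lebesgue_integral_def)
  also have "\<dots> = - (LINT x|lebesgue. frechet_derivative \<psi> (at x) e * \<phi> x)"
    by (rule integration_by_parts[OF C_k_differentiable[OF test_functionsD(1)[OF \<psi>]]
          C_k_continuous[OF test_functionsD(1)[OF test_functions_partial[OF \<psi> e]]] \<phi> e])
  also have "(LINT x|lebesgue. frechet_derivative \<psi> (at x) e * \<phi> x) = (LINT x:UNIV|lebesgue. (grad \<psi> x \<bullet> e) * \<phi> x)"
    using e by (simp add: set_lebesgue_integral_def grad_inner)
  also have "\<dots> = (LINT x:\<Omega>|lebesgue. (grad \<psi> x \<bullet> e) * \<phi> x)"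
    using weak_gradient_localised(2)[OF \<phi>' z closed_closure test_functionsD(3)[OF \<phi>] subset_refl]
      weak_gradient_localised(2)[OF \<phi>' z closed_closure test_functionsD(3)[OF \<phi>] subset_UNIV] by simp
  finally show "(LINT x:\<Omega>|lebesgue. \<psi> x * frechet_derivative \<phi> (at x) e)
    = - (LINT x:\<Omega>|lebesgue. (grad \<psi> x \<bullet> e) * \<phi> x)" .
qed

section \<open>Chain rule for a smoothed positive part\<close>

text \<open>
  A continuously differentiable approximation of the positive part that is 1-Lipschitz and vanishes
  for \<open>t \<le> 0\<close>; its derivative is the function \<open>soft_pos'\<close> below.
\<close>

definition soft_pos :: "real \<Rightarrow> real \<Rightarrow> real" where
  "soft_pos \<delta> t = (max 0 t)\<^sup>2 / (max 0 t + \<delta>)"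

definition soft_pos' :: "real \<Rightarrow> real \<Rightarrow> real" where
  "soft_pos' \<delta> t = 1 - (\<delta> / (max 0 t + \<delta>))\<^sup>2"

lemma soft_pos_derivative:
  assumes "\<delta> > 0"
  shows "(soft_pos \<delta> has_real_derivative soft_pos' \<delta> t) (at t)"
proof -
  consider "t > 0" | "t < 0" | "t = 0" by linarith
  then show ?thesis
  proof cases
    case 1
    have "((\<lambda>t. t\<^sup>2 / (t + \<delta>)) has_real_derivative (2 * t * (t + \<delta>) - t\<^sup>2) / ((t + \<delta>) * (t + \<delta>))) (at t)"
      using 1 assms by (auto intro!: derivative_eq_intros)
    moreover have "(2 * t * (t + \<delta>) - t\<^sup>2) / ((t + \<delta>) * (t + \<delta>)) = soft_pos' \<delta> t"
    proof -
      have nz: "(t + \<delta>)\<^sup>2 \<noteq> 0" using 1 assms by simp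
      have "soft_pos' \<delta> t = 1 - \<delta>\<^sup>2 / (t + \<delta>)\<^sup>2"
        using 1 by (simp add: soft_pos'_def power_divide)
      also have "\<dots> = ((t + \<delta>)\<^sup>2 - \<delta>\<^sup>2) / (t + \<delta>)\<^sup>2"
        using nz by (simp add: diff_divide_distrib)
      also have "(t + \<delta>)\<^sup>2 - \<delta>\<^sup>2 = 2 * t * (t + \<delta>) - t\<^sup>2"
        by (simp add: power2_eq_square algebra_simps)
      finally show ?thesis by (simp add: power2_eq_square)
    qed
    ultimately have "((\<lambda>t. t\<^sup>2 / (t + \<delta>)) has_real_derivative soft_pos' \<delta> t) (at t)" by simp
    then show ?thesis
      by (rule has_field_derivative_transform_within_open[where S="{0<..}"])
        (use 1 in \<open>auto simp: soft_pos_def\<close>)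
  next
    case 2
    have "((\<lambda>t. 0) has_real_derivative soft_pos' \<delta> t) (at t)"
      using 2 assms by (simp add: soft_pos'_def)
    then show ?thesis
      by (rule has_field_derivative_transform_within_open[where S="{..<0}"])
        (use 2 in \<open>auto simp: soft_pos_def\<close>)
  next
    case 3
    have "((\<lambda>h. \<bar>h\<bar> / \<delta>) \<longlongrightarrow> \<bar>0\<bar> / \<delta>) (at (0::real))"
      by (intro tendsto_intros) (use assms in auto)
    then have lim: "((\<lambda>h. \<bar>h\<bar> / \<delta>) \<longlongrightarrow> 0) (at (0::real))" by simp
    have "((\<lambda>h. (soft_pos \<delta> (0 + h) - soft_pos \<delta> 0) / h) \<longlongrightarrow> 0) (at 0)"
    proof (rule Lim_null_comparison[OF _ lim])
      have "norm ((soft_pos \<delta> (0 + h) - soft_pos \<delta> 0) / h) \<le> \<bar>h\<bar> / \<delta>" for h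
      proof (cases "h > 0")
        case True
        have "h * h / (h + \<delta>) / h = h / (h + \<delta>)" using True by simp
        also have "\<dots> \<le> h / \<delta>" using True assms by (intro divide_left_mono) auto
        finally show ?thesis using True assms by (simp add: soft_pos_def power2_eq_square)
      next
        case False
        then have "soft_pos \<delta> (0 + h) - soft_pos \<delta> 0 = 0" by (simp add: soft_pos_def max_def)
        then show ?thesis using assms by simp
      qed
      then show "\<forall>\<^sub>F h in at 0. norm ((soft_pos \<delta> (0 + h) - soft_pos \<delta> 0) / h) \<le> \<bar>h\<bar> / \<delta>"
        by simp
    qed
    then show ?thesis using 3 assms by (simp add: DERIV_def soft_pos'_def)
  qed
qed

lemma soft_pos'_bounds: "\<delta> > 0 \<Longrightarrow> 0 \<le> soft_pos' \<delta> t" "\<delta> > 0 \<Longrightarrow> soft_pos' \<delta> t \<le> 1"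
  by (auto simp: soft_pos'_def power_le_one)

lemma soft_pos_lipschitz: "\<delta> > 0 \<Longrightarrow> \<bar>soft_pos \<delta> s - soft_pos \<delta> t\<bar> \<le> \<bar>s - t\<bar>"
  using field_differentiable_bound[of UNIV "soft_pos \<delta>" "soft_pos' \<delta>" 1 s t]
    soft_pos_derivative soft_pos'_bounds by (simp add: abs_le_iff)

lemma soft_pos_bound: "\<delta> > 0 \<Longrightarrow> \<bar>soft_pos \<delta> t\<bar> \<le> \<bar>t\<bar>"
  using soft_pos_lipschitz[of \<delta> t 0] by (simp add: soft_pos_def)

lemma soft_pos'_continuous: "\<delta> > 0 \<Longrightarrow> continuous_on UNIV (soft_pos' \<delta>)"
  unfolding soft_pos'_def by (intro continuous_intros) (auto simp: max_def)

lemma soft_pos_continuous: "\<delta> > 0 \<Longrightarrow> continuous_on UNIV (soft_pos \<delta>)"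
  unfolding soft_pos_def by (intro continuous_intros) (auto simp: max_def)

lemma soft_pos_limit:
  "(\<lambda>n. soft_pos (inverse (real (Suc n))) t) \<longlonglongrightarrow> max 0 t"
  "(\<lambda>n. soft_pos' (inverse (real (Suc n))) t) \<longlonglongrightarrow> (if t > 0 then 1 else 0)"
proof -
  note L = LIMSEQ_inverse_real_of_nat
  have "(\<lambda>n. soft_pos (inverse (real (Suc n))) t) \<longlonglongrightarrow> t\<^sup>2 / (t + 0)" if "t > 0"
  proof -
    have "(\<lambda>n. t\<^sup>2 / (t + inverse (real (Suc n)))) \<longlonglongrightarrow> t\<^sup>2 / (t + 0)"
      by (intro tendsto_intros L) (use that in simp)
    then show ?thesis using that by (simp add: soft_pos_def)
  qed
  moreover have "soft_pos (inverse (real (Suc n))) t = 0" if "t \<le> 0" for n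
    using that by (simp add: soft_pos_def max_def)
  ultimately show "(\<lambda>n. soft_pos (inverse (real (Suc n))) t) \<longlonglongrightarrow> max 0 t"
    by (cases "t > 0") (auto simp: power2_eq_square max_def)
  have "(\<lambda>n. soft_pos' (inverse (real (Suc n))) t) \<longlonglongrightarrow> 1 - (0 / (t + 0))\<^sup>2" if "t > 0"
  proof -
    have "(\<lambda>n. 1 - (inverse (real (Suc n)) / (t + inverse (real (Suc n))))\<^sup>2) \<longlonglongrightarrow> 1 - (0 / (t + 0))\<^sup>2"
      by (intro tendsto_intros L) (use that in simp)
    then show ?thesis using that by (simp add: soft_pos'_def)
  qed
  moreover have "soft_pos' (inverse (real (Suc n))) t = 0" if "t \<le> 0" for n
    using that by (simp add: soft_pos'_def max_def)
  ultimately show "(\<lambda>n. soft_pos' (inverse (real (Suc n))) t) \<longlonglongrightarrow> (if t > 0 then 1 else 0)"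
    by (cases "t > 0") auto
qed

lemma ennreal_squeeze_0:
  fixes f g :: "'b \<Rightarrow> ennreal"
  assumes "(g \<longlongrightarrow> 0) F" "\<And>n. f n \<le> g n"
  shows "(f \<longlongrightarrow> 0) F"
  by (rule tendsto_sandwich[OF _ _ tendsto_const assms(1)]) (simp_all add: assms(2))

lemma integrable_mult_bounded:
  fixes k :: "'a \<Rightarrow> real"
  assumes k: "integrable M k" and [measurable]: "h \<in> borel_measurable M" and B: "\<And>x. \<bar>h x\<bar> \<le> B"
  shows "integrable M (\<lambda>x. k x * h x)"
proof (rule Bochner_Integration.integrable_bound)
  show "integrable M (\<lambda>x. B * k x)" using k by simp
  have [measurable]: "k \<in> borel_measurable M" using k by simp
  show "(\<lambda>x. k x * h x) \<in> borel_measurable M" by measurable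
  show "AE x in M. norm (k x * h x) \<le> norm (B * k x)"
  proof (rule AE_I2)
    fix x
    have "\<bar>k x\<bar> * \<bar>h x\<bar> \<le> \<bar>k x\<bar> * \<bar>B\<bar>"
      using B[of x] by (intro mult_left_mono) auto
    then show "norm (k x * h x) \<le> norm (B * k x)" by (simp add: abs_mult mult.commute)
  qed
qed

lemma tendsto_integral_mult_bounded:
  fixes f :: "nat \<Rightarrow> 'a \<Rightarrow> real"
  assumes f: "\<And>n. integrable M (f n)" "integrable M g"
    and L: "(\<lambda>n. \<integral>\<^sup>+x. ennreal \<bar>f n x - g x\<bar> \<partial>M) \<longlonglongrightarrow> 0"
    and h[measurable]: "h \<in> borel_measurable M" and B: "\<And>x. \<bar>h x\<bar> \<le> B"
  shows "(\<lambda>n. LINT x|M. f n x * h x) \<longlonglongrightarrow> (LINT x|M. g x * h x)"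
proof (rule tendsto_L1_int)
  have [measurable]: "f n \<in> borel_measurable M" "g \<in> borel_measurable M" for n
    using f by auto
  note int = integrable_mult_bounded[OF _ h B]
  show "integrable M (\<lambda>x. f n x * h x)" for n by (rule int[OF f(1)])
  show "integrable M (\<lambda>x. g x * h x)" by (rule int[OF f(2)])
  have le: "(\<integral>\<^sup>+x. ennreal (norm (f n x * h x - g x * h x)) \<partial>M) \<le> ennreal \<bar>B\<bar> * (\<integral>\<^sup>+x. ennreal \<bar>f n x - g x\<bar> \<partial>M)" for n
  proof -
    have "(\<integral>\<^sup>+x. ennreal (norm (f n x * h x - g x * h x)) \<partial>M) \<le> (\<integral>\<^sup>+x. ennreal \<bar>B\<bar> * ennreal \<bar>f n x - g x\<bar> \<partial>M)"
    proof (rule nn_integral_mono)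
      fix x
      have "\<bar>f n x - g x\<bar> * \<bar>h x\<bar> \<le> \<bar>f n x - g x\<bar> * \<bar>B\<bar>"
        using B[of x] by (intro mult_left_mono) auto
      then have "norm (f n x * h x - g x * h x) \<le> \<bar>B\<bar> * \<bar>f n x - g x\<bar>"
        unfolding left_diff_distrib[symmetric] by (simp add: abs_mult mult.commute)
      then have "ennreal (norm (f n x * h x - g x * h x)) \<le> ennreal (\<bar>B\<bar> * \<bar>f n x - g x\<bar>)"
        by (rule ennreal_leI)
      then show "ennreal (norm (f n x * h x - g x * h x)) \<le> ennreal \<bar>B\<bar> * ennreal \<bar>f n x - g x\<bar>"
        by (simp add: ennreal_mult)
    qed
    then show ?thesis by (simp add: nn_integral_cmult)
  qed
  have "(\<lambda>n. ennreal \<bar>B\<bar> * (\<integral>\<^sup>+x. ennreal \<bar>f n x - g x\<bar> \<partial>M)) \<longlonglongrightarrow> ennreal \<bar>B\<bar> * 0"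
    by (intro ennreal_tendsto_cmult L) auto
  then have "(\<lambda>n. ennreal \<bar>B\<bar> * (\<integral>\<^sup>+x. ennreal \<bar>f n x - g x\<bar> \<partial>M)) \<longlonglongrightarrow> 0" by simp
  then show "(\<lambda>n. \<integral>\<^sup>+x. ennreal (norm (f n x * h x - g x * h x)) \<partial>M) \<longlonglongrightarrow> 0"
    by (rule ennreal_squeeze_0) (rule le)
qed

lemma conv_moll_measurable:
  "integrable lebesgue w \<Longrightarrow> conv w (moll n) \<in> borel_measurable lebesgue"
  by (intro measurable_completion)
    (simp add: borel_measurable_continuous_onI[OF conv_continuous[OF _ mollifier_test]] del: of_nat_Suc)

lemma conv_moll_integrable:
  assumes "integrable lebesgue w"
  shows "integrable lebesgue (conv w (moll n))"
proof (rule integrableI_bounded[OF conv_moll_measurable[OF assms]])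
  have "(\<integral>\<^sup>+x. ennreal (\<bar>conv w (moll n) x\<bar> powr 1) \<partial>lebesgue)
    \<le> ennreal (2 powr 1) * (\<integral>\<^sup>+x. ennreal (\<bar>w x\<bar> powr 1) \<partial>lebesgue)"
    by (rule conv_Lp_bound[OF assms]) auto
  also have "\<dots> < \<infinity>"
    using assms by (simp add: integrable_iff_bounded ennreal_mult_less_top)
  finally show "(\<integral>\<^sup>+x. ennreal (norm (conv w (moll n) x)) \<partial>lebesgue) < \<infinity>" by simp
qed

lemma L1_limit_AE_subseq:
  fixes f :: "nat \<Rightarrow> 'a \<Rightarrow> real"
  assumes f: "\<And>n. integrable M (f n)" "integrable M g"
    and L: "(\<lambda>n. \<integral>\<^sup>+x. ennreal \<bar>f n x - g x\<bar> \<partial>M) \<longlonglongrightarrow> 0"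
  shows "\<exists>s::nat\<Rightarrow>nat. strict_mono s \<and> (AE x in M. (\<lambda>n. f (s n) x) \<longlonglongrightarrow> g x)"
proof -
  have int: "integrable M (\<lambda>x. f n x - g x)" for n using f by simp
  have "(LINT x|M. norm (f n x - g x)) = enn2real (\<integral>\<^sup>+x. ennreal \<bar>f n x - g x\<bar> \<partial>M)" for n
    using int[of n] by (subst integral_eq_nn_integral) auto
  moreover have "(\<lambda>n. enn2real (\<integral>\<^sup>+x. ennreal \<bar>f n x - g x\<bar> \<partial>M)) \<longlonglongrightarrow> 0"
    using tendsto_enn2real[of _ 0] L by simp
  ultimately have "(\<lambda>n. LINT x|M. norm (f n x - g x)) \<longlonglongrightarrow> 0" by simp
  from tendsto_L1_AE_subseq[OF int this] obtain s where
    "strict_mono s" "AE x in M. (\<lambda>n. f (s n) x - g x) \<longlonglongrightarrow> 0" by auto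
  moreover have "(\<lambda>n. f (s n) x) \<longlonglongrightarrow> g x" if "(\<lambda>n. f (s n) x - g x) \<longlonglongrightarrow> 0" for x
    using that by (simp add: LIM_zero_iff)
  ultimately show ?thesis by (auto intro!: exI[of _ s])
qed

text \<open>
  For the mollifications of \<open>u\<close> this is the classical chain rule and integration by parts. On the
  left the limit exists because \<open>soft_pos \<delta>\<close> is 1-Lipschitz; on the right one passes to a
  subsequence of the mollifications that converges almost everywhere.
\<close>

lemma weak_gradient_soft_pos:
  fixes u :: "'a::euclidean_space \<Rightarrow> real"
  assumes "open \<Omega>" and wg: "has_weak_gradient \<Omega> u g" and \<delta>: "\<delta> > 0"
    and \<psi>: "\<psi> \<in> test_functions \<Omega>" and e: "e \<in> Basis"
  shows "(LINT x:\<Omega>|lebesgue. soft_pos \<delta> (u x) * frechet_derivative \<psi> (at x) e)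
    = - (LINT x:\<Omega>|lebesgue. (soft_pos' \<delta> (u x) * (g x \<bullet> e)) * \<psi> x)"
proof -
  let ?K = "closure {x. \<psi> x \<noteq> 0}"
  let ?d = "\<lambda>x. frechet_derivative \<psi> (at x) e"
  note \<psi>e = test_functions_partial[OF \<psi> e]
  have out: "\<psi> x = 0" "?d x = 0" if "x \<notin> ?K" for x
    using test_functions_outside(1)[OF \<psi> that] fun_cong[OF test_functions_outside(2)[OF \<psi> that], of e] .
  obtain r K' where r: "r > 0" "compact K'" "K' \<subseteq> \<Omega>" "\<And>x. x \<in> ?K \<Longrightarrow> cball x r \<subseteq> K'"
    using compact_neighbourhood[OF test_functionsD(2)[OF \<psi>] assms(1) test_functionsD(3)[OF \<psi>]] by auto
  have KK': "x \<in> K'" if "x \<in> ?K" for x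
    using r(4)[OF that] r(1) centre_in_cball[of x r] by auto
  define U where "U y = indicator K' y * u y" for y
  define G where "G y = indicator K' y * (g y \<bullet> e)" for y
  have iU: "integrable lebesgue U" unfolding U_def
    by (rule locally_integrable_indicator_real[OF has_weak_gradientD(1)[OF wg] r(2,3)])
  have iG: "integrable lebesgue G" unfolding G_def
    by (rule locally_integrable_indicator_inner[OF has_weak_gradientD(2)[OF wg] r(2,3)])
  have LU: "(\<lambda>n. \<integral>\<^sup>+x. ennreal \<bar>conv U (moll n) x - U x\<bar> \<partial>lebesgue) \<longlonglongrightarrow> 0"
    by (rule mollify_L1[OF iU r(2)]) (simp add: U_def)
  have LG: "(\<lambda>n. \<integral>\<^sup>+x. ennreal \<bar>conv G (moll n) x - G x\<bar> \<partial>lebesgue) \<longlonglongrightarrow> 0"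
    by (rule mollify_L1[OF iG r(2)]) (simp add: G_def)
  have [measurable]: "U \<in> borel_measurable lebesgue" "G \<in> borel_measurable lebesgue" using iU iG by auto
  note [measurable] = conv_moll_measurable[OF iU] conv_moll_measurable[OF iG]
  have [measurable]: "soft_pos \<delta> \<in> borel_measurable borel" "soft_pos' \<delta> \<in> borel_measurable borel"
    by (intro borel_measurable_continuous_onI soft_pos_continuous soft_pos'_continuous \<delta>)+
  have [measurable]: "\<psi> \<in> borel_measurable lebesgue" "?d \<in> borel_measurable lebesgue"
    using borel_measurable_continuous_onI[OF C_k_continuous[OF test_functionsD(1)[OF \<psi>]]]
      borel_measurable_continuous_onI[OF C_k_continuous[OF test_functionsD(1)[OF \<psi>e]]]
    by (auto intro: measurable_completion)
  obtain B where B: "\<And>x. \<bar>\<psi> x\<bar> \<le> B" using test_function_bounded[OF \<psi>] by auto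
  obtain B' where B': "\<And>x. \<bar>?d x\<bar> \<le> B'" using test_function_bounded[OF \<psi>e] by auto
  obtain s :: "nat \<Rightarrow> nat" where s: "strict_mono s" "AE x in lebesgue. (\<lambda>n. conv U (moll (s n)) x) \<longlonglongrightarrow> U x"
    using L1_limit_AE_subseq[OF conv_moll_integrable[OF iU] iU LU] by auto
  have int_soft: "integrable lebesgue (\<lambda>x. soft_pos \<delta> (v x))" if v: "integrable lebesgue v" for v
  proof (rule Bochner_Integration.integrable_bound[OF v])
    have [measurable]: "v \<in> borel_measurable lebesgue" using v by auto
    show "(\<lambda>x. soft_pos \<delta> (v x)) \<in> borel_measurable lebesgue" by measurable
  qed (use soft_pos_bound[OF \<delta>] in simp)
  have int_soft': "integrable lebesgue (\<lambda>x. soft_pos' \<delta> (v x) * h x)"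
    if h: "integrable lebesgue h" and [measurable]: "v \<in> borel_measurable lebesgue" for v h
  proof (rule Bochner_Integration.integrable_bound[OF h])
    have [measurable]: "h \<in> borel_measurable lebesgue" using h by auto
    show "(\<lambda>x. soft_pos' \<delta> (v x) * h x) \<in> borel_measurable lebesgue" by measurable
    show "AE x in lebesgue. norm (soft_pos' \<delta> (v x) * h x) \<le> norm (h x)"
      using soft_pos'_bounds[OF \<delta>] by (intro AE_I2) (auto simp: abs_mult intro!: mult_left_le_one_le)
  qed
  have lim1: "(\<lambda>n. LINT x|lebesgue. soft_pos \<delta> (conv U (moll n) x) * ?d x) \<longlonglongrightarrow> (LINT x|lebesgue. soft_pos \<delta> (U x) * ?d x)"
  proof (rule tendsto_integral_mult_bounded[OF int_soft[OF conv_moll_integrable[OF iU]] int_soft[OF iU] _ _ B'])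
    show "(\<lambda>n. \<integral>\<^sup>+x. ennreal \<bar>soft_pos \<delta> (conv U (moll n) x) - soft_pos \<delta> (U x)\<bar> \<partial>lebesgue) \<longlonglongrightarrow> 0"
      by (rule ennreal_squeeze_0[OF LU]) (intro nn_integral_mono ennreal_leI soft_pos_lipschitz[OF \<delta>])
  qed measurable
  have lim2: "(\<lambda>n. LINT x|lebesgue. (soft_pos' \<delta> (conv U (moll (s n)) x) * conv G (moll (s n)) x) * \<psi> x)
      \<longlonglongrightarrow> (LINT x|lebesgue. (soft_pos' \<delta> (U x) * G x) * \<psi> x)"
  proof (rule tendsto_integral_mult_bounded[OF int_soft'[OF conv_moll_integrable[OF iG]] int_soft'[OF iG] _ _ B])
    have A1: "(\<lambda>n. \<integral>\<^sup>+x. ennreal \<bar>conv G (moll (s n)) x - G x\<bar> \<partial>lebesgue) \<longlonglongrightarrow> 0"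
      using LIMSEQ_subseq_LIMSEQ[OF LG s(1)] by (simp add: comp_def)
    have A2: "(\<lambda>n. \<integral>\<^sup>+x. ennreal (\<bar>soft_pos' \<delta> (conv U (moll (s n)) x) - soft_pos' \<delta> (U x)\<bar> * \<bar>G x\<bar>) \<partial>lebesgue)
        \<longlonglongrightarrow> (\<integral>\<^sup>+x. 0 \<partial>(lebesgue::'a measure))"
    proof (rule nn_integral_dominated_convergence[where w="\<lambda>x. ennreal \<bar>G x\<bar>"])
      show "(\<integral>\<^sup>+x. ennreal \<bar>G x\<bar> \<partial>lebesgue) < \<infinity>" using iG by (simp add: integrable_iff_bounded)
      have "\<bar>soft_pos' \<delta> a - soft_pos' \<delta> b\<bar> \<le> 1" for a b
        using soft_pos'_bounds[OF \<delta>, of a] soft_pos'_bounds[OF \<delta>, of b] by (simp add: abs_le_iff)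
      then show "AE x in lebesgue. ennreal (\<bar>soft_pos' \<delta> (conv U (moll (s n)) x) - soft_pos' \<delta> (U x)\<bar> * \<bar>G x\<bar>) \<le> ennreal \<bar>G x\<bar>" for n
        by (intro AE_I2 ennreal_leI mult_left_le_one_le) auto
      show "AE x in lebesgue. (\<lambda>n. ennreal (\<bar>soft_pos' \<delta> (conv U (moll (s n)) x) - soft_pos' \<delta> (U x)\<bar> * \<bar>G x\<bar>)) \<longlonglongrightarrow> 0"
        using s(2)
      proof eventually_elim
        case (elim x)
        have "isCont (soft_pos' \<delta>) (U x)"
          using soft_pos'_continuous[OF \<delta>] by (simp add: continuous_on_eq_continuous_at)
        from isCont_tendsto_compose[OF this elim]
        have "(\<lambda>n. soft_pos' \<delta> (conv U (moll (s n)) x)) \<longlonglongrightarrow> soft_pos' \<delta> (U x)" .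
        then have "(\<lambda>n. \<bar>soft_pos' \<delta> (conv U (moll (s n)) x) - soft_pos' \<delta> (U x)\<bar> * \<bar>G x\<bar>)
            \<longlonglongrightarrow> \<bar>soft_pos' \<delta> (U x) - soft_pos' \<delta> (U x)\<bar> * \<bar>G x\<bar>"
          by (intro tendsto_mult tendsto_rabs tendsto_diff tendsto_const)
        from tendsto_ennrealI[OF this] show ?case by simp
      qed
    qed measurable
    have "(\<lambda>n. (\<integral>\<^sup>+x. ennreal \<bar>conv G (moll (s n)) x - G x\<bar> \<partial>lebesgue) +
       (\<integral>\<^sup>+x. ennreal (\<bar>soft_pos' \<delta> (conv U (moll (s n)) x) - soft_pos' \<delta> (U x)\<bar> * \<bar>G x\<bar>) \<partial>lebesgue)) \<longlonglongrightarrow> 0 + 0"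
      using A2 by (intro tendsto_add A1) simp
    moreover have "(\<integral>\<^sup>+x. ennreal \<bar>soft_pos' \<delta> (conv U (moll (s n)) x) * conv G (moll (s n)) x - soft_pos' \<delta> (U x) * G x\<bar> \<partial>lebesgue)
       \<le> (\<integral>\<^sup>+x. ennreal \<bar>conv G (moll (s n)) x - G x\<bar> \<partial>lebesgue) +
       (\<integral>\<^sup>+x. ennreal (\<bar>soft_pos' \<delta> (conv U (moll (s n)) x) - soft_pos' \<delta> (U x)\<bar> * \<bar>G x\<bar>) \<partial>lebesgue)" for n
    proof -
      have "\<bar>soft_pos' \<delta> a * b - soft_pos' \<delta> c * d\<bar> \<le> \<bar>b - d\<bar> + \<bar>soft_pos' \<delta> a - soft_pos' \<delta> c\<bar> * \<bar>d\<bar>" for a b c d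
      proof -
        have "soft_pos' \<delta> a * b - soft_pos' \<delta> c * d = soft_pos' \<delta> a * (b - d) + (soft_pos' \<delta> a - soft_pos' \<delta> c) * d"
          by (simp add: algebra_simps)
        also have "\<bar>\<dots>\<bar> \<le> \<bar>soft_pos' \<delta> a\<bar> * \<bar>b - d\<bar> + \<bar>soft_pos' \<delta> a - soft_pos' \<delta> c\<bar> * \<bar>d\<bar>"
          unfolding abs_mult[symmetric] by (rule abs_triangle_ineq)
        also have "\<bar>soft_pos' \<delta> a\<bar> * \<bar>b - d\<bar> \<le> \<bar>b - d\<bar>"
          using soft_pos'_bounds[OF \<delta>, of a] by (intro mult_left_le_one_le) auto
        finally show ?thesis by simp
      qed
      then have "(\<integral>\<^sup>+x. ennreal \<bar>soft_pos' \<delta> (conv U (moll (s n)) x) * conv G (moll (s n)) x - soft_pos' \<delta> (U x) * G x\<bar> \<partial>lebesgue)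
        \<le> (\<integral>\<^sup>+x. ennreal \<bar>conv G (moll (s n)) x - G x\<bar> + ennreal (\<bar>soft_pos' \<delta> (conv U (moll (s n)) x) - soft_pos' \<delta> (U x)\<bar> * \<bar>G x\<bar>) \<partial>lebesgue)"
        by (intro nn_integral_mono) (simp add: ennreal_plus[symmetric] ennreal_leI del: ennreal_plus)
      then show ?thesis by (subst (asm) nn_integral_add) (simp_all del: of_nat_Suc)
    qed
    ultimately show "(\<lambda>n. \<integral>\<^sup>+x. ennreal \<bar>soft_pos' \<delta> (conv U (moll (s n)) x) * conv G (moll (s n)) x - soft_pos' \<delta> (U x) * G x\<bar> \<partial>lebesgue) \<longlonglongrightarrow> 0"
      unfolding add_0_left by (rule ennreal_squeeze_0)
  qed measurable
  have "\<forall>\<^sub>F n in sequentially. (LINT x|lebesgue. soft_pos \<delta> (conv U (moll n) x) * ?d x)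
      = - (LINT x|lebesgue. (soft_pos' \<delta> (conv U (moll n) x) * conv G (moll n) x) * \<psi> x)"
    using eventually_moll_radius[OF r(1)]
  proof eventually_elim
    case (elim n)
    have t: "moll n \<in> test_functions (UNIV :: 'a set)" by (rule mollifier_test) simp
    have z: "moll n z = 0" if "z \<notin> cball 0 r" for z :: 'a
      using that elim by (intro mollifier_outside) auto
    have C: "\<forall>k. C_k k (conv U (moll n))" using C_k_conv[OF iU t] by blast
    have p: "frechet_derivative (conv U (moll n)) (at x) e = conv U (\<lambda>z. frechet_derivative (moll n) (at z) e) x" for x
      by (rule conv_partial[OF iU t e])
    have "(LINT x|lebesgue. soft_pos \<delta> (conv U (moll n) x) * ?d x)
      = - (LINT x|lebesgue. (soft_pos' \<delta> (conv U (moll n) x) * frechet_derivative (conv U (moll n)) (at x) e) * \<psi> x)"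
    proof (rule integration_by_parts[OF _ _ \<psi> e])
      show "((\<lambda>x. soft_pos \<delta> (conv U (moll n) x)) has_derivative
          (\<lambda>h. soft_pos' \<delta> (conv U (moll n) x) * frechet_derivative (conv U (moll n)) (at x) h)) (at x)" for x
        by (rule has_derivative_compose[OF C_k_differentiable[OF C] soft_pos_derivative[OF \<delta>, unfolded has_field_derivative_def]])
      show "continuous_on UNIV (\<lambda>x. soft_pos' \<delta> (conv U (moll n) x) * frechet_derivative (conv U (moll n)) (at x) e)"
        by (intro continuous_on_mult continuous_on_compose2[OF soft_pos'_continuous[OF \<delta>] C_k_continuous[OF C] subset_UNIV]
            C_k_continuous[OF C_k_partial[OF C e]])
    qed
    also have "(\<lambda>x. (soft_pos' \<delta> (conv U (moll n) x) * frechet_derivative (conv U (moll n)) (at x) e) * \<psi> x)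
       = (\<lambda>x. (soft_pos' \<delta> (conv U (moll n) x) * conv G (moll n) x) * \<psi> x)"
    proof
      fix x
      show "(soft_pos' \<delta> (conv U (moll n) x) * frechet_derivative (conv U (moll n)) (at x) e) * \<psi> x
       = (soft_pos' \<delta> (conv U (moll n) x) * conv G (moll n) x) * \<psi> x"
      proof (cases "x \<in> ?K")
        case True
        have "conv U (\<lambda>z. frechet_derivative (moll n) (at z) e) x = conv G (moll n) x"
          unfolding U_def G_def by (rule weak_gradient_conv[OF wg e t _ r(4)[OF True] r(3)]) (rule z)
        then show ?thesis unfolding p by simp
      next
        case False
        show ?thesis unfolding out(1)[OF False] by simp
      qed
    qed
    finally show ?case .
  qed
  then have ev: "\<forall>\<^sub>F n in sequentially. (LINT x|lebesgue. soft_pos \<delta> (conv U (moll (s n)) x) * ?d x)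
      = - (LINT x|lebesgue. (soft_pos' \<delta> (conv U (moll (s n)) x) * conv G (moll (s n)) x) * \<psi> x)"
    by (rule eventually_subseq[OF s(1)])
  have lim1': "(\<lambda>n. LINT x|lebesgue. soft_pos \<delta> (conv U (moll (s n)) x) * ?d x) \<longlonglongrightarrow> (LINT x|lebesgue. soft_pos \<delta> (U x) * ?d x)"
    using LIMSEQ_subseq_LIMSEQ[OF lim1 s(1)] by (simp add: comp_def)
  have "(LINT x|lebesgue. soft_pos \<delta> (U x) * ?d x) = - (LINT x|lebesgue. (soft_pos' \<delta> (U x) * G x) * \<psi> x)"
    by (rule LIMSEQ_unique[OF lim1' Lim_transform_eventually[OF tendsto_minus[OF lim2]]])
      (use ev in \<open>auto elim!: eventually_mono\<close>)
  moreover have "(LINT x:\<Omega>|lebesgue. soft_pos \<delta> (u x) * ?d x) = (LINT x|lebesgue. soft_pos \<delta> (U x) * ?d x)"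
    unfolding set_lebesgue_integral_def
  proof (rule Bochner_Integration.integral_cong[OF refl])
    fix x
    show "indicator \<Omega> x *\<^sub>R (soft_pos \<delta> (u x) * ?d x) = soft_pos \<delta> (U x) * ?d x"
    proof (cases "x \<in> ?K")
      case True
      then show ?thesis using KK'[OF True] r(3) by (auto simp: U_def indicator_def)
    next
      case False
      show ?thesis unfolding out(2)[OF False] by simp
    qed
  qed
  moreover have "(LINT x:\<Omega>|lebesgue. (soft_pos' \<delta> (u x) * (g x \<bullet> e)) * \<psi> x) = (LINT x|lebesgue. (soft_pos' \<delta> (U x) * G x) * \<psi> x)"
    unfolding set_lebesgue_integral_def
  proof (rule Bochner_Integration.integral_cong[OF refl])
    fix x
    show "indicator \<Omega> x *\<^sub>R ((soft_pos' \<delta> (u x) * (g x \<bullet> e)) * \<psi> x) = (soft_pos' \<delta> (U x) * G x) * \<psi> x"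
    proof (cases "x \<in> ?K")
      case True
      then show ?thesis using KK'[OF True] r(3) by (auto simp: U_def G_def indicator_def)
    next
      case False
      show ?thesis unfolding out(1)[OF False] by simp
    qed
  qed
  ultimately show ?thesis by simp
qed

section \<open>Calculus of weak gradients\<close>

lemma compact_lebesgue [measurable (raw)]: "compact (K::'a::euclidean_space set) \<Longrightarrow> K \<in> sets lebesgue"
  by (intro fmeasurableD lmeasurable_compact)

text \<open>
  It is enough to compare integrals of integrable functions, where linearity and limit theorems are
  available.
\<close>

lemma weak_gradient_testI:
  fixes u :: "'a::euclidean_space \<Rightarrow> real"
  assumes "locally_integrable_on u \<Omega>" "locally_integrable_on g \<Omega>"
    and "\<And>\<psi> e K. \<psi> \<in> test_functions \<Omega> \<Longrightarrow> e \<in> Basis \<Longrightarrow> compact K \<Longrightarrow> K \<subseteq> \<Omega> \<Longrightarrow>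
      \<forall>x. x \<notin> K \<longrightarrow> \<psi> x = 0 \<Longrightarrow>
      (LINT x|lebesgue. (indicator K x * u x) * frechet_derivative \<psi> (at x) e)
      = - (LINT x|lebesgue. (indicator K x * (g x \<bullet> e)) * \<psi> x)"
  shows "has_weak_gradient \<Omega> u g"
  unfolding has_weak_gradient_def
proof (intro conjI ballI)
  fix \<psi> and e :: 'a assume \<psi>: "\<psi> \<in> test_functions \<Omega>" and e: "e \<in> Basis"
  have \<psi>': "\<psi> \<in> test_functions UNIV" using test_functions_mono[OF _ \<psi>] by simp
  have z: "\<forall>x. x \<notin> closure {x. \<psi> x \<noteq> 0} \<longrightarrow> \<psi> x = 0" using test_functions_outside(1)[OF \<psi>] by blast
  show "(LINT x:\<Omega>|lebesgue. u x * frechet_derivative \<psi> (at x) e) = - (LINT x:\<Omega>|lebesgue. (g x \<bullet> e) * \<psi> x)"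
    unfolding weak_gradient_localised[OF \<psi>' z closed_closure subset_refl test_functionsD(3)[OF \<psi>]]
    by (rule assms(3)[OF \<psi> e test_functionsD(2,3)[OF \<psi>] z])
qed fact+

lemma weak_gradient_testD:
  fixes u :: "'a::euclidean_space \<Rightarrow> real"
  assumes "has_weak_gradient \<Omega> u g" "\<psi> \<in> test_functions \<Omega>" "e \<in> Basis" "compact K" "K \<subseteq> \<Omega>"
    "\<forall>x. x \<notin> K \<longrightarrow> \<psi> x = 0"
  shows "(LINT x|lebesgue. (indicator K x * u x) * frechet_derivative \<psi> (at x) e)
      = - (LINT x|lebesgue. (indicator K x * (g x \<bullet> e)) * \<psi> x)"
proof -
  have \<psi>': "\<psi> \<in> test_functions UNIV" using test_functions_mono[OF _ assms(2)] by simp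
  show ?thesis
    using has_weak_gradientD(3)[OF assms(1-3)]
    unfolding weak_gradient_localised[OF \<psi>' assms(6) compact_imp_closed[OF assms(4)] subset_refl assms(5)] .
qed

lemma test_integrands:
  fixes u :: "'a::euclidean_space \<Rightarrow> real"
  assumes "locally_integrable_on u \<Omega>" "compact K" "K \<subseteq> \<Omega>" "\<psi> \<in> test_functions V"
  shows "integrable lebesgue (\<lambda>x. (indicator K x * u x) * \<psi> x)"
proof -
  obtain B where B: "\<And>x. \<bar>\<psi> x\<bar> \<le> B" using test_function_bounded[OF assms(4)] by auto
  show ?thesis
    using borel_measurable_continuous_onI[OF C_k_continuous[OF test_functionsD(1)[OF assms(4)]]]
    by (intro integrable_mult_bounded[OF locally_integrable_indicator_real[OF assms(1-3)] measurable_completion B]) simp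
qed

lemma locally_integrable_inner:
  fixes g :: "'a::euclidean_space \<Rightarrow> 'a"
  assumes "locally_integrable_on g \<Omega>"
  shows "locally_integrable_on (\<lambda>x. g x \<bullet> e) \<Omega>"
  unfolding locally_integrable_on_def set_integrable_def
  using locally_integrable_indicator_inner[OF assms] by simp

lemma locally_integrable_add:
  fixes u v :: "'a::euclidean_space \<Rightarrow> 'b::euclidean_space"
  assumes "locally_integrable_on u \<Omega>" "locally_integrable_on v \<Omega>"
  shows "locally_integrable_on (\<lambda>x. u x + v x) \<Omega>"
  using assms unfolding locally_integrable_on_def by (auto intro: set_integral_add)

lemma locally_integrable_scale:
  fixes u :: "'a::euclidean_space \<Rightarrow> 'b::euclidean_space"
  assumes "locally_integrable_on u \<Omega>"
  shows "locally_integrable_on (\<lambda>x. c *\<^sub>R u x) \<Omega>"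
  using assms unfolding locally_integrable_on_def
  by (auto intro: absolutely_integrable_scaleR_left)

lemma weak_gradient_add:
  fixes u :: "'a::euclidean_space \<Rightarrow> real"
  assumes u: "has_weak_gradient \<Omega> u g" and v: "has_weak_gradient \<Omega> v h"
  shows "has_weak_gradient \<Omega> (\<lambda>x. u x + v x) (\<lambda>x. g x + h x)"
proof (rule weak_gradient_testI)
  fix \<psi> and e :: 'a and K assume t: "\<psi> \<in> test_functions \<Omega>" "e \<in> Basis" "compact K" "K \<subseteq> \<Omega>" "\<forall>x. x \<notin> K \<longrightarrow> \<psi> x = 0"
  note te = test_functions_partial[OF t(1,2)]
  have "(LINT x|lebesgue. (indicator K x * (u x + v x)) * frechet_derivative \<psi> (at x) e)
    = (LINT x|lebesgue. (indicator K x * u x) * frechet_derivative \<psi> (at x) e)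
    + (LINT x|lebesgue. (indicator K x * v x) * frechet_derivative \<psi> (at x) e)"
    unfolding distrib_left distrib_right
    by (rule Bochner_Integration.integral_add[OF test_integrands[OF has_weak_gradientD(1)[OF u] t(3,4) te]
          test_integrands[OF has_weak_gradientD(1)[OF v] t(3,4) te]])
  also have "\<dots> = - (LINT x|lebesgue. (indicator K x * (g x \<bullet> e)) * \<psi> x)
      + - (LINT x|lebesgue. (indicator K x * (h x \<bullet> e)) * \<psi> x)"
    using weak_gradient_testD[OF u t] weak_gradient_testD[OF v t] by (simp only:)
  also have "\<dots> = - (LINT x|lebesgue. (indicator K x * ((g x + h x) \<bullet> e)) * \<psi> x)"
    unfolding inner_add_left distrib_left distrib_right
    using test_integrands[OF locally_integrable_inner[OF has_weak_gradientD(2)[OF u]] t(3,4,1)]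
          test_integrands[OF locally_integrable_inner[OF has_weak_gradientD(2)[OF v]] t(3,4,1)]
    by (subst Bochner_Integration.integral_add) auto
  finally show "(LINT x|lebesgue. (indicator K x * (u x + v x)) * frechet_derivative \<psi> (at x) e)
    = - (LINT x|lebesgue. (indicator K x * ((g x + h x) \<bullet> e)) * \<psi> x)" .
qed (intro locally_integrable_add has_weak_gradientD(1,2)[OF u] has_weak_gradientD(1,2)[OF v])+

lemma weak_gradient_scale:
  fixes u :: "'a::euclidean_space \<Rightarrow> real"
  assumes u: "has_weak_gradient \<Omega> u g"
  shows "has_weak_gradient \<Omega> (\<lambda>x. c * u x) (\<lambda>x. c *\<^sub>R g x)"
proof (rule weak_gradient_testI)
  fix \<psi> and e :: 'a and K assume t: "\<psi> \<in> test_functions \<Omega>" "e \<in> Basis" "compact K" "K \<subseteq> \<Omega>" "\<forall>x. x \<notin> K \<longrightarrow> \<psi> x = 0"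
  have "(LINT x|lebesgue. (indicator K x * (c * u x)) * frechet_derivative \<psi> (at x) e)
    = (LINT x|lebesgue. c * ((indicator K x * u x) * frechet_derivative \<psi> (at x) e))"
    by (simp add: mult.assoc mult.left_commute)
  also have "\<dots> = - (LINT x|lebesgue. c * ((indicator K x * (g x \<bullet> e)) * \<psi> x))"
    using weak_gradient_testD[OF u t] by simp
  also have "\<dots> = - (LINT x|lebesgue. (indicator K x * ((c *\<^sub>R g x) \<bullet> e)) * \<psi> x)"
    by (simp add: mult.assoc mult.left_commute)
  finally show "(LINT x|lebesgue. (indicator K x * (c * u x)) * frechet_derivative \<psi> (at x) e)
    = - (LINT x|lebesgue. (indicator K x * ((c *\<^sub>R g x) \<bullet> e)) * \<psi> x)" .
qed (use locally_integrable_scale[OF has_weak_gradientD(1)[OF u], of c]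
      locally_integrable_scale[OF has_weak_gradientD(2)[OF u], of c] in simp_all)

lemma weak_gradient_restrict:
  fixes u :: "'a::euclidean_space \<Rightarrow> real"
  assumes u: "has_weak_gradient \<Omega> u g" and "V \<subseteq> \<Omega>"
  shows "has_weak_gradient V u g"
proof (rule weak_gradient_testI)
  show "locally_integrable_on u V" "locally_integrable_on g V"
    using has_weak_gradientD(1,2)[OF u] \<open>V \<subseteq> \<Omega>\<close> by (auto simp: locally_integrable_on_def)
  fix \<psi> and e :: 'a and K assume t: "\<psi> \<in> test_functions V" "e \<in> Basis" "compact K" "K \<subseteq> V" "\<forall>x. x \<notin> K \<longrightarrow> \<psi> x = 0"
  show "(LINT x|lebesgue. (indicator K x * u x) * frechet_derivative \<psi> (at x) e)
    = - (LINT x|lebesgue. (indicator K x * (g x \<bullet> e)) * \<psi> x)"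
    by (rule weak_gradient_testD[OF u test_functions_mono[OF \<open>V \<subseteq> \<Omega>\<close> t(1)] t(2,3) order_trans[OF t(4) \<open>V \<subseteq> \<Omega>\<close>] t(5)])
qed

lemma integrable_lebesgue_cong_AE:
  fixes f :: "'a::euclidean_space \<Rightarrow> 'b::euclidean_space"
  assumes "integrable lebesgue f" "AE x in lebesgue. f x = h x"
  shows "integrable lebesgue h"
  using borel_measurable_AE[OF borel_measurable_integrable[OF assms(1)] assms(2)]
  by (intro integrable_cong_AE_imp[OF assms(1)]) (use assms(2) in auto)

lemma integral_lebesgue_cong_AE:
  fixes f h :: "'a::euclidean_space \<Rightarrow> real"
  assumes "AE x in lebesgue. f x = h x"
  shows "(LINT x|lebesgue. f x) = (LINT x|lebesgue. h x)"
proof (cases "f \<in> borel_measurable lebesgue")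
  case True
  then show ?thesis using borel_measurable_AE[OF True assms] assms by (intro integral_cong_AE) auto
next
  case False
  have "AE x in lebesgue. h x = f x" using assms by auto
  then have "h \<notin> borel_measurable lebesgue" using borel_measurable_AE False by blast
  then show ?thesis
    using False not_integrable_integral_eq[of lebesgue f] not_integrable_integral_eq[of lebesgue h]
    by (metis borel_measurable_integrable)
qed

lemma locally_integrable_cong_AE:
  fixes u :: "'a::euclidean_space \<Rightarrow> 'b::euclidean_space"
  assumes "locally_integrable_on u \<Omega>" "AE x in lebesgue. x \<in> \<Omega> \<longrightarrow> u x = v x"
  shows "locally_integrable_on v \<Omega>"
  unfolding locally_integrable_on_def set_integrable_def
proof (intro allI impI)
  fix K assume K: "compact K \<and> K \<subseteq> \<Omega>"
  show "integrable lebesgue (\<lambda>x. indicator K x *\<^sub>R v x)"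
  proof (rule integrable_lebesgue_cong_AE)
    show "integrable lebesgue (\<lambda>x. indicator K x *\<^sub>R u x)"
      using locally_integrable_indicator[OF assms(1)] K by blast
    show "AE x in lebesgue. indicator K x *\<^sub>R u x = indicator K x *\<^sub>R v x"
      using assms(2) by eventually_elim (use K in \<open>auto simp: indicator_def\<close>)
  qed
qed

lemma weak_gradient_cong_AE:
  fixes u :: "'a::euclidean_space \<Rightarrow> real"
  assumes u: "has_weak_gradient \<Omega> u g" and "AE x in lebesgue. x \<in> \<Omega> \<longrightarrow> u x = v x"
    "AE x in lebesgue. x \<in> \<Omega> \<longrightarrow> g x = h x"
  shows "has_weak_gradient \<Omega> v h"
proof (rule weak_gradient_testI)
  show "locally_integrable_on v \<Omega>" "locally_integrable_on h \<Omega>"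
    using locally_integrable_cong_AE has_weak_gradientD(1,2)[OF u] assms(2,3) by blast+
  fix \<psi> and e :: 'a and K assume t: "\<psi> \<in> test_functions \<Omega>" "e \<in> Basis" "compact K" "K \<subseteq> \<Omega>" "\<forall>x. x \<notin> K \<longrightarrow> \<psi> x = 0"
  have "(LINT x|lebesgue. (indicator K x * v x) * frechet_derivative \<psi> (at x) e)
      = (LINT x|lebesgue. (indicator K x * u x) * frechet_derivative \<psi> (at x) e)"
    using assms(2) t(4) by (intro integral_lebesgue_cong_AE) (auto simp: indicator_def elim!: eventually_mono)
  also have "\<dots> = - (LINT x|lebesgue. (indicator K x * (g x \<bullet> e)) * \<psi> x)"
    by (rule weak_gradient_testD[OF u t])
  also have "(LINT x|lebesgue. (indicator K x * (g x \<bullet> e)) * \<psi> x) = (LINT x|lebesgue. (indicator K x * (h x \<bullet> e)) * \<psi> x)"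
    using assms(3) t(4) by (intro integral_lebesgue_cong_AE) (auto simp: indicator_def elim!: eventually_mono)
  finally show "(LINT x|lebesgue. (indicator K x * v x) * frechet_derivative \<psi> (at x) e)
    = - (LINT x|lebesgue. (indicator K x * (h x \<bullet> e)) * \<psi> x)" .
qed

lemma locally_integrable_dominated:
  fixes u :: "'a::euclidean_space \<Rightarrow> 'b::euclidean_space" and v :: "'a \<Rightarrow> 'c::euclidean_space"
  assumes "locally_integrable_on u \<Omega>" "\<And>x. norm (v x) \<le> norm (u x)"
    and "\<And>K. compact K \<Longrightarrow> K \<subseteq> \<Omega> \<Longrightarrow> (\<lambda>x. indicator K x *\<^sub>R v x) \<in> borel_measurable lebesgue"
  shows "locally_integrable_on v \<Omega>"
  unfolding locally_integrable_on_def set_integrable_def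
proof (intro allI impI)
  fix K assume K: "compact K \<and> K \<subseteq> \<Omega>"
  have "integrable lebesgue (\<lambda>x. indicator K x *\<^sub>R u x)"
    using locally_integrable_indicator[OF assms(1)] K by blast
  then show "integrable lebesgue (\<lambda>x. indicator K x *\<^sub>R v x)"
    by (rule Bochner_Integration.integrable_bound) (use assms(2,3) K in \<open>auto simp: indicator_def\<close>)
qed

text \<open>
  As \<open>\<delta>\<close> tends to \<open>0\<close>, the derivatives \<open>soft_pos' \<delta>\<close> tend boundedly to the indicator function of
  the positive numbers.
\<close>

lemma weak_gradient_pos_part:
  fixes u :: "'a::euclidean_space \<Rightarrow> real"
  assumes "open \<Omega>" and u: "has_weak_gradient \<Omega> u g"
  shows "has_weak_gradient \<Omega> (\<lambda>x. max 0 (u x)) (\<lambda>x. if u x > 0 then g x else 0)"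
proof (rule weak_gradient_testI)
  note lu = has_weak_gradientD(1)[OF u] and lg = has_weak_gradientD(2)[OF u]
  have mu: "(\<lambda>x. indicator K x * u x) \<in> borel_measurable lebesgue"
    and mg: "(\<lambda>x. indicator K x *\<^sub>R g x) \<in> borel_measurable lebesgue"
    if "compact K" "K \<subseteq> \<Omega>" for K
    using locally_integrable_indicator_real[OF lu that] locally_integrable_indicator[OF lg that] by auto
  show "locally_integrable_on (\<lambda>x. max 0 (u x)) \<Omega>"
  proof (rule locally_integrable_dominated[OF lu])
    fix K assume K: "compact K" "K \<subseteq> \<Omega>"
    note [measurable] = mu[OF K]
    have "(\<lambda>x. max 0 (indicator K x * u x)) \<in> borel_measurable lebesgue" by measurable
    also have "(\<lambda>x. max 0 (indicator K x * u x)) = (\<lambda>x. indicator K x *\<^sub>R max 0 (u x))"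
      by (auto simp: indicator_def)
    finally show "(\<lambda>x. indicator K x *\<^sub>R max 0 (u x)) \<in> borel_measurable lebesgue" .
  qed auto
  show "locally_integrable_on (\<lambda>x. if u x > 0 then g x else 0) \<Omega>"
  proof (rule locally_integrable_dominated[OF lg])
    fix K assume K: "compact K" "K \<subseteq> \<Omega>"
    note [measurable] = mu[OF K] mg[OF K]
    have "(\<lambda>x. if indicator K x * u x > 0 then indicator K x *\<^sub>R g x else 0) \<in> borel_measurable lebesgue" by measurable
    also have "(\<lambda>x. if indicator K x * u x > 0 then indicator K x *\<^sub>R g x else 0) = (\<lambda>x. indicator K x *\<^sub>R (if u x > 0 then g x else 0))"
      by (auto simp: indicator_def)
    finally show "(\<lambda>x. indicator K x *\<^sub>R (if u x > 0 then g x else 0)) \<in> borel_measurable lebesgue" .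
  qed auto
  fix \<psi> and e :: 'a and K assume t: "\<psi> \<in> test_functions \<Omega>" "e \<in> Basis" "compact K" "K \<subseteq> \<Omega>" "\<forall>x. x \<notin> K \<longrightarrow> \<psi> x = 0"
  let ?d = "\<lambda>x. frechet_derivative \<psi> (at x) e"
  let ?\<delta> = "\<lambda>n. inverse (real (Suc n))"
  have \<psi>': "\<psi> \<in> test_functions UNIV" using test_functions_mono[OF _ t(1)] by simp
  note [measurable] = mu[OF t(3,4)]
  note i1 = test_integrands[OF lu t(3,4) test_functions_partial[OF t(1,2)]]
  note i2 = test_integrands[OF locally_integrable_inner[OF lg] t(3,4,1)]
  have [measurable]: "(\<lambda>x. indicator K x * (g x \<bullet> e)) \<in> borel_measurable lebesgue"
    using locally_integrable_indicator_inner[OF lg t(3,4)] by auto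
  have [measurable]: "\<psi> \<in> borel_measurable lebesgue" "?d \<in> borel_measurable lebesgue"
    using borel_measurable_continuous_onI[OF C_k_continuous[OF test_functionsD(1)[OF t(1)]]]
      borel_measurable_continuous_onI[OF C_k_continuous[OF test_functionsD(1)[OF test_functions_partial[OF t(1,2)]]]]
    by (auto intro: measurable_completion)
  have [measurable]: "soft_pos (?\<delta> n) \<in> borel_measurable borel" "soft_pos' (?\<delta> n) \<in> borel_measurable borel" for n
    by (intro borel_measurable_continuous_onI soft_pos_continuous soft_pos'_continuous; simp)+
  define A where "A n x = soft_pos (?\<delta> n) (indicator K x * u x) * ?d x" for n x
  define R where "R n x = soft_pos' (?\<delta> n) (indicator K x * u x) * ((indicator K x * (g x \<bullet> e)) * \<psi> x)" for n x
  \<comment> \<open>Cutting off inside \<open>soft_pos\<close> is the same as cutting off outside, since \<open>soft_pos\<close> vanishes at \<open>0\<close>.\<close>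
  have AR: "(LINT x|lebesgue. A n x) = - (LINT x|lebesgue. R n x)" for n
  proof -
    have "(LINT x:\<Omega>|lebesgue. soft_pos (?\<delta> n) (u x) * ?d x)
        = - (LINT x:\<Omega>|lebesgue. ((soft_pos' (?\<delta> n) (u x) *\<^sub>R g x) \<bullet> e) * \<psi> x)"
      using weak_gradient_soft_pos[OF assms(1) u _ t(1,2), of "?\<delta> n"] by simp
    then have "(LINT x|lebesgue. (indicator K x * soft_pos (?\<delta> n) (u x)) * ?d x)
        = - (LINT x|lebesgue. (indicator K x * ((soft_pos' (?\<delta> n) (u x) *\<^sub>R g x) \<bullet> e)) * \<psi> x)"
      unfolding weak_gradient_localised[OF \<psi>' t(5) compact_imp_closed[OF t(3)] subset_refl t(4)] .
    moreover have "(\<lambda>x. (indicator K x * soft_pos (?\<delta> n) (u x)) * ?d x) = A n"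
      by (auto simp: A_def fun_eq_iff indicator_def soft_pos_def)
    moreover have "(\<lambda>x. (indicator K x * ((soft_pos' (?\<delta> n) (u x) *\<^sub>R g x) \<bullet> e)) * \<psi> x) = R n"
      by (auto simp: R_def fun_eq_iff indicator_def)
    ultimately show ?thesis by simp
  qed
  have limA: "(\<lambda>n. LINT x|lebesgue. A n x) \<longlonglongrightarrow> (LINT x|lebesgue. (indicator K x * max 0 (u x)) * ?d x)"
  proof (rule integral_dominated_convergence[where w="\<lambda>x. \<bar>(indicator K x * u x) * ?d x\<bar>"])
    have "(\<lambda>x. max 0 (indicator K x * u x) * ?d x) \<in> borel_measurable lebesgue" by measurable
    also have "(\<lambda>x. max 0 (indicator K x * u x) * ?d x) = (\<lambda>x. (indicator K x * max 0 (u x)) * ?d x)"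
      by (auto simp: indicator_def)
    finally show "(\<lambda>x. (indicator K x * max 0 (u x)) * ?d x) \<in> borel_measurable lebesgue" .
    show "A n \<in> borel_measurable lebesgue" for n unfolding A_def by measurable
    show "integrable lebesgue (\<lambda>x. \<bar>(indicator K x * u x) * ?d x\<bar>)" using i1 by simp
    show "AE x in lebesgue. norm (A n x) \<le> \<bar>(indicator K x * u x) * ?d x\<bar>" for n
      unfolding A_def real_norm_def abs_mult[of _ "?d _"]
      by (intro AE_I2 mult_right_mono soft_pos_bound) auto
    show "AE x in lebesgue. (\<lambda>n. A n x) \<longlonglongrightarrow> (indicator K x * max 0 (u x)) * ?d x"
    proof (rule AE_I2)
      fix x
      have "(\<lambda>n. A n x) \<longlonglongrightarrow> max 0 (indicator K x * u x) * ?d x"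
        unfolding A_def by (intro tendsto_mult soft_pos_limit tendsto_const)
      then show "(\<lambda>n. A n x) \<longlonglongrightarrow> (indicator K x * max 0 (u x)) * ?d x" by (cases "x \<in> K") simp_all
    qed
  qed
  have limR: "(\<lambda>n. LINT x|lebesgue. R n x) \<longlonglongrightarrow> (LINT x|lebesgue. (indicator K x * ((if u x > 0 then g x else 0) \<bullet> e)) * \<psi> x)"
  proof (rule integral_dominated_convergence[where w="\<lambda>x. \<bar>(indicator K x * (g x \<bullet> e)) * \<psi> x\<bar>"])
    have "(\<lambda>x. (if indicator K x * u x > 0 then indicator K x * (g x \<bullet> e) else 0) * \<psi> x) \<in> borel_measurable lebesgue" by measurable
    also have "(\<lambda>x. (if indicator K x * u x > 0 then indicator K x * (g x \<bullet> e) else 0) * \<psi> x)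
       = (\<lambda>x. (indicator K x * ((if u x > 0 then g x else 0) \<bullet> e)) * \<psi> x)"
      by (auto simp: indicator_def)
    finally show "(\<lambda>x. (indicator K x * ((if u x > 0 then g x else 0) \<bullet> e)) * \<psi> x) \<in> borel_measurable lebesgue" .
    show "R n \<in> borel_measurable lebesgue" for n unfolding R_def by measurable
    show "integrable lebesgue (\<lambda>x. \<bar>(indicator K x * (g x \<bullet> e)) * \<psi> x\<bar>)" using i2 by simp
    show "AE x in lebesgue. norm (R n x) \<le> \<bar>(indicator K x * (g x \<bullet> e)) * \<psi> x\<bar>" for n
      unfolding R_def real_norm_def abs_mult[of "soft_pos' _ _"]
      using soft_pos'_bounds[of "?\<delta> n"] by (intro AE_I2 mult_left_le_one_le) auto
    show "AE x in lebesgue. (\<lambda>n. R n x) \<longlonglongrightarrow> (indicator K x * ((if u x > 0 then g x else 0) \<bullet> e)) * \<psi> x"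
    proof (rule AE_I2)
      fix x
      have "(\<lambda>n. R n x) \<longlonglongrightarrow> (if indicator K x * u x > 0 then 1 else 0) * ((indicator K x * (g x \<bullet> e)) * \<psi> x)"
        unfolding R_def by (intro tendsto_mult soft_pos_limit tendsto_const)
      then show "(\<lambda>n. R n x) \<longlonglongrightarrow> (indicator K x * ((if u x > 0 then g x else 0) \<bullet> e)) * \<psi> x"
        by (cases "x \<in> K"; cases "u x > 0") simp_all
    qed
  qed
  show "(LINT x|lebesgue. (indicator K x * max 0 (u x)) * ?d x)
      = - (LINT x|lebesgue. (indicator K x * ((if u x > 0 then g x else 0) \<bullet> e)) * \<psi> x)"
    by (rule LIMSEQ_unique[OF limA]) (unfold AR, rule tendsto_minus[OF limR])
qed

text \<open>
  The decomposition \<open>u = max 0 u - max 0 (- u)\<close> yields a weak gradient of \<open>u\<close> that vanishes wherever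
  \<open>u\<close> does, and weak gradients are unique.
\<close>

lemma weak_gradient_zero_set:
  fixes u :: "'a::euclidean_space \<Rightarrow> real"
  assumes "open \<Omega>" and u: "has_weak_gradient \<Omega> u g"
  shows "AE x in lebesgue. x \<in> \<Omega> \<longrightarrow> u x = 0 \<longrightarrow> g x = 0"
proof -
  have "has_weak_gradient \<Omega> (\<lambda>x. max 0 (u x) + (-1) * max 0 ((-1) * u x))
     (\<lambda>x. (if u x > 0 then g x else 0) + (-1) *\<^sub>R (if (-1) * u x > 0 then (-1) *\<^sub>R g x else 0))"
    by (intro weak_gradient_add weak_gradient_scale weak_gradient_pos_part assms)
  also have "(\<lambda>x. max 0 (u x) + (-1) * max 0 ((-1) * u x)) = u" by (auto simp: fun_eq_iff)
  finally have "AE x in lebesgue. x \<in> \<Omega> \<longrightarrow> (if u x > 0 then g x else 0) + (-1) *\<^sub>R (if (-1) * u x > 0 then (-1) *\<^sub>R g x else 0) = g x"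
    by (rule weak_gradient_unique[OF assms(1) _ u])
  then show ?thesis by eventually_elim auto
qed

section \<open>Local Sobolev functions\<close>

text \<open>
  Membership in \<open>L\<^sup>p\<close> over different sets becomes comparable once it is expressed by integrals over
  the whole space.
\<close>

lemma in_Lp_iff:
  fixes f :: "'a::euclidean_space \<Rightarrow> 'b::euclidean_space"
  assumes S: "S \<in> sets lebesgue"
  shows "in_Lp p S f \<longleftrightarrow> (\<lambda>x. indicator S x *\<^sub>R f x) \<in> borel_measurable lebesgue \<and>
    (\<integral>\<^sup>+x. ennreal (norm (indicator S x *\<^sub>R f x) powr p) \<partial>lebesgue) < \<infinity>"
proof -
  have S': "S \<inter> space lebesgue \<in> sets lebesgue" using S by simp
  have m: "f \<in> borel_measurable (lebesgue_on S) \<longleftrightarrow> (\<lambda>x. indicator S x *\<^sub>R f x) \<in> borel_measurable lebesgue"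
    by (rule borel_measurable_restrict_space_iff[OF S'])
  have eq: "(\<lambda>x. indicator S x *\<^sub>R (norm (f x) powr p)) = (\<lambda>x. norm (indicator S x *\<^sub>R f x) powr p)"
    by (auto simp: indicator_def fun_eq_iff)
  have "integrable (lebesgue_on S) (\<lambda>x. norm (f x) powr p) \<longleftrightarrow>
      integrable lebesgue (\<lambda>x. norm (indicator S x *\<^sub>R f x) powr p)"
    unfolding integrable_restrict_space[OF S'] eq ..
  moreover have "integrable lebesgue (\<lambda>x. norm (indicator S x *\<^sub>R f x) powr p) \<longleftrightarrow>
     (\<integral>\<^sup>+x. ennreal (norm (indicator S x *\<^sub>R f x) powr p) \<partial>lebesgue) < \<infinity>"
    if "(\<lambda>x. indicator S x *\<^sub>R f x) \<in> borel_measurable lebesgue"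
  proof -
    note [measurable] = that
    have [measurable]: "(\<lambda>x. norm (indicator S x *\<^sub>R f x) powr p) \<in> borel_measurable lebesgue" by measurable
    show ?thesis by (simp add: integrable_iff_bounded del: norm_scaleR)
  qed
  ultimately show ?thesis unfolding in_Lp_def m by blast
qed

lemma in_Lp_subset:
  fixes f :: "'a::euclidean_space \<Rightarrow> 'b::euclidean_space"
  assumes f: "in_Lp p S f" and S: "S \<in> sets lebesgue" and T: "T \<in> sets lebesgue" "T \<subseteq> S"
  shows "in_Lp p T f"
proof -
  note f' = f[unfolded in_Lp_iff[OF S]]
  note [measurable] = conjunct1[OF f'] T(1)
  have eq: "indicator T x *\<^sub>R (indicator S x *\<^sub>R f x) = indicator T x *\<^sub>R f x" for x
    using T(2) by (auto simp: indicator_def)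
  have "(\<lambda>x. indicator T x *\<^sub>R (indicator S x *\<^sub>R f x)) \<in> borel_measurable lebesgue"
    by measurable
  then have "(\<lambda>x. indicator T x *\<^sub>R f x) \<in> borel_measurable lebesgue"
    unfolding eq .
  moreover have "(\<integral>\<^sup>+x. ennreal (norm (indicator T x *\<^sub>R f x) powr p) \<partial>lebesgue)
     \<le> (\<integral>\<^sup>+x. ennreal (norm (indicator S x *\<^sub>R f x) powr p) \<partial>lebesgue)"
    using T(2) by (intro nn_integral_mono ennreal_leI) (auto simp: indicator_def)
  ultimately show ?thesis
    unfolding in_Lp_iff[OF T(1)] using conjunct2[OF f'] by (auto intro: le_less_trans)
qed

lemma nn_integral_powr_add_finite:
  fixes f g :: "'a \<Rightarrow> 'b::euclidean_space"
  assumes "p \<ge> 0" "f \<in> borel_measurable M" "g \<in> borel_measurable M"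
    "(\<integral>\<^sup>+x. ennreal (norm (f x) powr p) \<partial>M) < \<infinity>" "(\<integral>\<^sup>+x. ennreal (norm (g x) powr p) \<partial>M) < \<infinity>"
  shows "(\<integral>\<^sup>+x. ennreal (norm (f x + g x) powr p) \<partial>M) < \<infinity>"
proof -
  note [measurable] = assms(2,3)
  have "(\<integral>\<^sup>+x. ennreal (norm (f x + g x) powr p) \<partial>M)
    \<le> (\<integral>\<^sup>+x. ennreal (2 powr p) * ennreal (norm (f x) powr p) + ennreal (2 powr p) * ennreal (norm (g x) powr p) \<partial>M)"
  proof (rule nn_integral_mono)
    fix x
    have "norm (f x + g x) powr p \<le> (norm (f x) + norm (g x)) powr p"
      using assms(1) by (intro powr_mono2 norm_triangle_ineq) auto
    also have "\<dots> \<le> 2 powr p * norm (f x) powr p + 2 powr p * norm (g x) powr p"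
      using powr_add_le[of "norm (f x)" "norm (g x)" 1 p] assms(1) by simp
    finally have "ennreal (norm (f x + g x) powr p) \<le> ennreal (2 powr p * norm (f x) powr p + 2 powr p * norm (g x) powr p)"
      by (rule ennreal_leI)
    then show "ennreal (norm (f x + g x) powr p) \<le>
        ennreal (2 powr p) * ennreal (norm (f x) powr p) + ennreal (2 powr p) * ennreal (norm (g x) powr p)"
      by (simp add: ennreal_mult' ennreal_plus)
  qed
  also have "\<dots> = ennreal (2 powr p) * (\<integral>\<^sup>+x. ennreal (norm (f x) powr p) \<partial>M)
      + ennreal (2 powr p) * (\<integral>\<^sup>+x. ennreal (norm (g x) powr p) \<partial>M)"
    by (simp add: nn_integral_add nn_integral_cmult)
  also have "\<dots> < \<infinity>" using assms(4,5) by (simp add: ennreal_mult_less_top)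
  finally show ?thesis .
qed

lemma in_Lp_add:
  fixes f g :: "'a::euclidean_space \<Rightarrow> 'b::euclidean_space"
  assumes S: "S \<in> sets lebesgue" and "p \<ge> 0" and f: "in_Lp p S f" and g: "in_Lp p S g"
  shows "in_Lp p S (\<lambda>x. f x + g x)"
  using f g nn_integral_powr_add_finite[OF \<open>p \<ge> 0\<close>, of "\<lambda>x. indicator S x *\<^sub>R f x" lebesgue "\<lambda>x. indicator S x *\<^sub>R g x"]
  unfolding in_Lp_iff[OF S] scaleR_add_right by auto

lemma in_Lp_scale:
  fixes f :: "'a::euclidean_space \<Rightarrow> 'b::euclidean_space"
  assumes S: "S \<in> sets lebesgue" and f: "in_Lp p S f"
  shows "in_Lp p S (\<lambda>x. c *\<^sub>R f x)"
proof -
  note f' = f[unfolded in_Lp_iff[OF S]]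
  note [measurable] = conjunct1[OF f']
  have eq: "indicator S x *\<^sub>R (c *\<^sub>R f x) = c *\<^sub>R (indicator S x *\<^sub>R f x)" for x
    by simp
  have "(\<integral>\<^sup>+x. ennreal (norm (c *\<^sub>R (indicator S x *\<^sub>R f x)) powr p) \<partial>lebesgue)
    = (\<integral>\<^sup>+x. ennreal (\<bar>c\<bar> powr p) * ennreal (norm (indicator S x *\<^sub>R f x) powr p) \<partial>lebesgue)"
    unfolding norm_scaleR[of c] by (simp add: powr_mult ennreal_mult)
  also have "\<dots> = ennreal (\<bar>c\<bar> powr p) * (\<integral>\<^sup>+x. ennreal (norm (indicator S x *\<^sub>R f x) powr p) \<partial>lebesgue)"
    by (rule nn_integral_cmult) measurable
  also have "\<dots> < \<infinity>" using conjunct2[OF f'] by (simp add: ennreal_mult_less_top)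
  finally have fin: "(\<integral>\<^sup>+x. ennreal (norm (c *\<^sub>R (indicator S x *\<^sub>R f x)) powr p) \<partial>lebesgue) < \<infinity>" .
  have "(\<lambda>x. c *\<^sub>R (indicator S x *\<^sub>R f x)) \<in> borel_measurable lebesgue" by measurable
  then show ?thesis unfolding in_Lp_iff[OF S] eq using fin by (rule conjI)
qed

lemma in_Lp_cong_AE:
  fixes f :: "'a::euclidean_space \<Rightarrow> 'b::euclidean_space"
  assumes S: "S \<in> sets lebesgue" and f: "in_Lp p S f" and ae: "AE x in lebesgue. x \<in> S \<longrightarrow> f x = g x"
  shows "in_Lp p S g"
proof -
  note f' = f[unfolded in_Lp_iff[OF S]]
  have ae': "AE x in lebesgue. indicator S x *\<^sub>R f x = indicator S x *\<^sub>R g x"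
    using ae by eventually_elim (auto simp: indicator_def)
  have "(\<integral>\<^sup>+x. ennreal (norm (indicator S x *\<^sub>R g x) powr p) \<partial>lebesgue)
     = (\<integral>\<^sup>+x. ennreal (norm (indicator S x *\<^sub>R f x) powr p) \<partial>lebesgue)"
    by (rule nn_integral_cong_AE) (use ae' in eventually_elim, simp only:)
  then show ?thesis unfolding in_Lp_iff[OF S] using f' borel_measurable_AE[OF conjunct1[OF f'] ae'] by simp
qed

lemma in_Lp_dominated:
  fixes f :: "'a::euclidean_space \<Rightarrow> 'b::euclidean_space" and g :: "'a \<Rightarrow> 'c::euclidean_space"
  assumes S: "S \<in> sets lebesgue" and "p \<ge> 0" and f: "in_Lp p S f"
    and g: "(\<lambda>x. indicator S x *\<^sub>R g x) \<in> borel_measurable lebesgue" "\<And>x. norm (g x) \<le> norm (f x)"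
  shows "in_Lp p S g"
proof -
  have "(\<integral>\<^sup>+x. ennreal (norm (indicator S x *\<^sub>R g x) powr p) \<partial>lebesgue)
     \<le> (\<integral>\<^sup>+x. ennreal (norm (indicator S x *\<^sub>R f x) powr p) \<partial>lebesgue)"
    using g(2) \<open>p \<ge> 0\<close> by (intro nn_integral_mono ennreal_leI powr_mono2) (auto simp: indicator_def)
  then show ?thesis using f g(1) unfolding in_Lp_iff[OF S] by (auto intro: le_less_trans)
qed

lemma in_Lp_continuous:
  fixes f :: "'a::euclidean_space \<Rightarrow> 'b::euclidean_space"
  assumes "continuous_on UNIV f" "compact K" "p \<ge> 0"
  shows "in_Lp p K f"
  unfolding in_Lp_def
proof
  have K: "K \<in> sets lebesgue" using assms(2) by (rule compact_lebesgue)
  have [measurable]: "f \<in> borel_measurable borel" by (rule borel_measurable_continuous_onI[OF assms(1)])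
  then have "f \<in> borel_measurable lebesgue" by (intro measurable_completion) simp
  then show "f \<in> borel_measurable (lebesgue_on K)" by (rule measurable_restrict_space1)
  have m: "(\<lambda>x. norm (f x) powr p) \<in> borel_measurable (lebesgue_on K)"
    using \<open>f \<in> borel_measurable (lebesgue_on K)\<close> by measurable
  have fin: "finite_measure (lebesgue_on K)"
    using assms(2) by (intro finite_measure_lebesgue_on) (rule lmeasurable_compact)
  have "bounded (f ` K)"
    by (intro compact_imp_bounded compact_continuous_image assms(2) continuous_on_subset[OF assms(1)]) auto
  then obtain B where B: "B > 0" "\<And>x. x \<in> K \<Longrightarrow> norm (f x) \<le> B"
    unfolding bounded_pos by auto
  show "integrable (lebesgue_on K) (\<lambda>x. norm (f x) powr p)"
  proof -
    have "norm (norm (f x) powr p) \<le> B powr p" if "x \<in> K" for x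
      using powr_mono2[OF assms(3) _ B(2)[OF that]] by simp
    then show ?thesis
      by (intro finite_measure.integrable_const_bound[OF fin _ m, of "B powr p"] AE_I2) auto
  qed
qed

text \<open>
  Carrying the gradient as an argument allows explicit formulas for it, for instance for the minimum
  of two functions, where \<open>weak_gradient\<close> only provides some representative.
\<close>

definition sobolev_loc :: "real \<Rightarrow> 'a::euclidean_space set \<Rightarrow> ('a \<Rightarrow> real) \<Rightarrow> ('a \<Rightarrow> 'a) \<Rightarrow> bool" where
  "sobolev_loc p \<Omega> u g \<longleftrightarrow> has_weak_gradient \<Omega> u g \<and>
     (\<forall>K. compact K \<and> K \<subseteq> \<Omega> \<longrightarrow> in_Lp p K u \<and> in_Lp p K g)"

lemma sobolev_locD:
  assumes "sobolev_loc p \<Omega> u g"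
  shows "has_weak_gradient \<Omega> u g" "\<And>K. compact K \<Longrightarrow> K \<subseteq> \<Omega> \<Longrightarrow> in_Lp p K u"
    "\<And>K. compact K \<Longrightarrow> K \<subseteq> \<Omega> \<Longrightarrow> in_Lp p K g"
  using assms by (auto simp: sobolev_loc_def)

lemma sobolev_locI:
  assumes "has_weak_gradient \<Omega> u g" "\<And>K. compact K \<Longrightarrow> K \<subseteq> \<Omega> \<Longrightarrow> in_Lp p K u"
    "\<And>K. compact K \<Longrightarrow> K \<subseteq> \<Omega> \<Longrightarrow> in_Lp p K g"
  shows "sobolev_loc p \<Omega> u g"
  using assms by (auto simp: sobolev_loc_def)

lemma weak_gradient_eq:
  fixes u :: "'a::euclidean_space \<Rightarrow> real"
  assumes "open \<Omega>" "has_weak_gradient \<Omega> u g"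
  shows "has_weak_gradient \<Omega> u (weak_gradient \<Omega> u)"
    and "AE x in lebesgue. x \<in> \<Omega> \<longrightarrow> weak_gradient \<Omega> u x = g x"
proof -
  show 1: "has_weak_gradient \<Omega> u (weak_gradient \<Omega> u)"
    unfolding weak_gradient_def by (rule someI[of "has_weak_gradient \<Omega> u", OF assms(2)])
  show "AE x in lebesgue. x \<in> \<Omega> \<longrightarrow> weak_gradient \<Omega> u x = g x"
    by (rule weak_gradient_unique[OF assms(1) 1 assms(2)])
qed

lemma open_lebesgue: "open (V::'a::euclidean_space set) \<Longrightarrow> V \<in> sets lebesgue"
  by (simp add: lborelD)

lemma sobolev_loc_imp_W1p_loc:
  fixes u :: "'a::euclidean_space \<Rightarrow> real"
  assumes "sobolev_loc p \<Omega> u g"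
  shows "u \<in> W1p_loc p \<Omega>"
  unfolding W1p_loc_def
proof (intro CollectI allI impI)
  fix V assume V: "open V \<and> compact (closure V) \<and> closure V \<subseteq> \<Omega>"
  then have "V \<subseteq> \<Omega>" "compact (closure V)" "closure V \<subseteq> \<Omega>" "open V" using closure_subset by auto
  note sets = compact_lebesgue[OF this(2)] open_lebesgue[OF this(4)]
  have hw: "has_weak_gradient V u g" by (rule weak_gradient_restrict[OF sobolev_locD(1)[OF assms] \<open>V \<subseteq> \<Omega>\<close>])
  have Lu: "in_Lp p V u"
    using in_Lp_subset[OF sobolev_locD(2)[OF assms \<open>compact (closure V)\<close> \<open>closure V \<subseteq> \<Omega>\<close>] sets closure_subset] .
  have Lg: "in_Lp p V g"
    using in_Lp_subset[OF sobolev_locD(3)[OF assms \<open>compact (closure V)\<close> \<open>closure V \<subseteq> \<Omega>\<close>] sets closure_subset] .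
  have "in_Lp p V (weak_gradient V u)"
    by (rule in_Lp_cong_AE[OF sets(2) Lg]) (use weak_gradient_eq(2)[OF \<open>open V\<close> hw] in eventually_elim, simp)
  then show "u \<in> W1p p V" using Lu hw by (auto simp: W1p_def)
qed

text \<open>
  Along an exhaustion of \<open>\<Omega>\<close> by relatively compact open sets \<open>V n\<close>, the weak gradients over the \<open>V n\<close>
  agree almost everywhere on overlaps. They are glued by using, at each point, the first \<open>V n\<close> that
  contains it.
\<close>

lemma W1p_loc_imp_sobolev_loc:
  fixes u :: "'a::euclidean_space \<Rightarrow> real"
  assumes "open \<Omega>" "u \<in> W1p_loc p \<Omega>"
  shows "\<exists>g. sobolev_loc p \<Omega> u g"
proof -
  obtain C :: "nat \<Rightarrow> 'a set" where "\<forall>n. compact (C n) \<and> C n \<subseteq> \<Omega> \<and> C n \<subseteq> interior (C (Suc n))"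
    and CK: "\<forall>K. compact K \<longrightarrow> K \<subseteq> \<Omega> \<longrightarrow> (\<exists>N. \<forall>n\<ge>N. K \<subseteq> C n)"
    using compact_exhaustion[OF assms(1)] by (elim exE conjE)
  then have C: "\<And>n. compact (C n)" "\<And>n. C n \<subseteq> \<Omega>" "\<And>n. C n \<subseteq> interior (C (Suc n))" by simp_all
  define V where "V n = interior (C (Suc n))" for n
  have V: "open (V n)" "V n \<subseteq> \<Omega>" "C n \<subseteq> V n" "V n \<subseteq> C (Suc n)" for n
    using C(2)[of "Suc n"] C(3)[of n] interior_subset[of "C (Suc n)"] by (auto simp: V_def)
  have clV: "closure (V n) \<subseteq> C (Suc n)" for n
    using V(4)[of n] C(1)[of "Suc n"] by (intro closure_minimal) (auto intro: compact_imp_closed)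
  have cptV: "compact (closure (V n))" for n
    using compact_Int_closed[OF C(1)[of "Suc n"] closed_closure[of "V n"]] clV[of n] by (simp add: Int_absorb1)
  have incV: "V n \<subseteq> V (Suc n)" for n
    using V(4)[of n] V(3)[of "Suc n"] by blast
  have monoV: "V m \<subseteq> V n" if "m \<le> n" for m n
    using lift_Suc_mono_le[of V, OF incV that] .
  have KV: "\<exists>n. K \<subseteq> V n" if "compact K" "K \<subseteq> \<Omega>" for K
    using CK[rule_format, OF that] V(3) by blast
  have W: "u \<in> W1p p (V n)" for n
    using assms(2) V(1)[of n] cptV[of n] clV[of n] C(2)[of "Suc n"] unfolding W1p_loc_def by blast
  define G where "G n = weak_gradient (V n) u" for n
  have G: "has_weak_gradient (V n) u (G n)" "in_Lp p (V n) (G n)" "in_Lp p (V n) u" for n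
    using W[of n] weak_gradient_eq(1)[OF V(1)[of n], of u] by (auto simp: W1p_def G_def)
  define N where "N x = (LEAST n. x \<in> V n)" for x
  define g where "g x = G (N x) x" for x
  have gG: "AE x in lebesgue. x \<in> V n \<longrightarrow> g x = G n x" for n
  proof -
    have "AE x in lebesgue. \<forall>m. m \<le> n \<longrightarrow> x \<in> V m \<longrightarrow> G m x = G n x"
      unfolding AE_all_countable
    proof
      fix m
      show "AE x in lebesgue. m \<le> n \<longrightarrow> x \<in> V m \<longrightarrow> G m x = G n x"
      proof (cases "m \<le> n")
        case True
        show ?thesis
          using weak_gradient_unique[OF V(1) G(1) weak_gradient_restrict[OF G(1) monoV[OF True]]]
          by eventually_elim simp
      qed simp
    qed
    then show ?thesis
    proof eventually_elim
      case (elim x)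
      show ?case
      proof
        assume x: "x \<in> V n"
        have "N x \<le> n" unfolding N_def by (rule Least_le[of "\<lambda>n. x \<in> V n", OF x])
        moreover have "x \<in> V (N x)" unfolding N_def by (rule LeastI[of "\<lambda>n. x \<in> V n", OF x])
        ultimately show "g x = G n x" using elim by (simp add: g_def)
      qed
    qed
  qed
  have hw: "has_weak_gradient (V n) u g" for n
    by (rule weak_gradient_cong_AE[OF G(1)[of n]]) (simp, use gG[of n] in eventually_elim, simp)
  have Lg: "in_Lp p (V n) g" for n
    by (rule in_Lp_cong_AE[OF open_lebesgue[OF V(1)] G(2)[of n]]) (use gG[of n] in eventually_elim, simp)
  have "has_weak_gradient \<Omega> u g"
  proof (rule weak_gradient_testI)
    show "locally_integrable_on u \<Omega>" "locally_integrable_on g \<Omega>"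
      using KV has_weak_gradientD(1,2)[OF hw] unfolding locally_integrable_on_def by blast+
    fix \<psi> and e :: 'a and K
    assume t: "\<psi> \<in> test_functions \<Omega>" "e \<in> Basis" "compact K" "K \<subseteq> \<Omega>" "\<forall>x. x \<notin> K \<longrightarrow> \<psi> x = 0"
    obtain n where n: "K \<subseteq> V n" using KV[OF t(3,4)] by blast
    have "\<psi> \<in> test_functions (V n)"
      by (rule test_functionsI[OF test_functionsD(1)[OF t(1)] t(3) n]) (use t(5) in blast)
    from weak_gradient_testD[OF hw this t(2,3) n t(5)]
    show "(LINT x|lebesgue. (indicator K x * u x) * frechet_derivative \<psi> (at x) e)
      = - (LINT x|lebesgue. (indicator K x * (g x \<bullet> e)) * \<psi> x)" .
  qed
  moreover have "in_Lp p K u \<and> in_Lp p K g" if K: "compact K" "K \<subseteq> \<Omega>" for K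
  proof -
    obtain n where n: "K \<subseteq> V n" using KV[OF K] by blast
    show ?thesis
      using in_Lp_subset[OF G(3) open_lebesgue[OF V(1)] compact_lebesgue[OF K(1)] n]
        in_Lp_subset[OF Lg open_lebesgue[OF V(1)] compact_lebesgue[OF K(1)] n] by simp
  qed
  ultimately show ?thesis by (auto intro!: exI[of _ g] sobolev_locI)
qed

section \<open>Sobolev functions with compact support\<close>

lemma norm_powr_le_components:
  fixes v :: "'a::euclidean_space"
  assumes "p \<ge> 0"
  shows "norm v powr p \<le> real DIM('a) powr p * (\<Sum>e\<in>Basis. \<bar>v \<bullet> e\<bar> powr p)"
proof -
  define M where "M = Max ((\<lambda>e. \<bar>v \<bullet> e\<bar>) ` Basis)"
  have "M \<in> (\<lambda>e. \<bar>v \<bullet> e\<bar>) ` Basis" unfolding M_def by (rule Max_in) auto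
  then obtain e0 where e0: "e0 \<in> Basis" "M = \<bar>v \<bullet> e0\<bar>" by blast
  have M: "\<bar>v \<bullet> e\<bar> \<le> M" if "e \<in> Basis" for e
    unfolding M_def using that by (intro Max_ge) auto
  have "norm v \<le> (\<Sum>e\<in>Basis. \<bar>v \<bullet> e\<bar>)" by (rule norm_le_l1)
  also have "\<dots> \<le> (\<Sum>e\<in>(Basis::'a set). M)" by (intro sum_mono M)
  also have "\<dots> = real DIM('a) * M" by simp
  finally have "norm v powr p \<le> (real DIM('a) * M) powr p"
    using assms by (intro powr_mono2) auto
  also have "\<dots> = real DIM('a) powr p * M powr p" by (rule powr_mult)
  also have "M powr p \<le> (\<Sum>e\<in>Basis. \<bar>v \<bullet> e\<bar> powr p)"
    unfolding e0(2) by (rule member_le_sum[OF e0(1)]) auto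
  finally show ?thesis by (simp add: mult_left_mono)
qed

text \<open>
  For small radii the mollifications of \<open>w\<close> are test functions in \<open>\<Omega>\<close>. Their gradients are the
  mollifications of \<open>g\<close>, because \<open>g\<close> vanishes almost everywhere outside \<open>K\<close>, where \<open>w = 0\<close>.
\<close>

lemma compact_support_W1p_0:
  fixes w :: "'a::euclidean_space \<Rightarrow> real"
  assumes "open \<Omega>" and p: "p \<ge> 1" and S: "sobolev_loc p \<Omega> w g"
    and K: "compact K" "K \<subseteq> \<Omega>" and wz: "\<And>x. x \<in> \<Omega> \<Longrightarrow> x \<notin> K \<Longrightarrow> w x = 0"
  shows "w \<in> W1p_0 p \<Omega>"
proof -
  note hw = sobolev_locD(1)[OF S]
  note K_sets = compact_lebesgue[OF K(1)] and \<Omega>_sets = open_lebesgue[OF assms(1)]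
  note [measurable] = K_sets \<Omega>_sets
  define W where "W x = indicator K x * w x" for x
  define G where "G e x = indicator K x * (g x \<bullet> e)" for e x
  have WW: "w x = W x" if "x \<in> \<Omega>" for x using wz[OF that] by (auto simp: W_def indicator_def)
  have gz: "AE x in lebesgue. x \<in> \<Omega> \<longrightarrow> x \<notin> K \<longrightarrow> g x = 0"
    using weak_gradient_zero_set[OF assms(1) hw] by eventually_elim (use wz in auto)
  have iW: "integrable lebesgue W" unfolding W_def
    by (rule locally_integrable_indicator_real[OF has_weak_gradientD(1)[OF hw] K])
  have iG: "integrable lebesgue (G e)" for e unfolding G_def
    by (rule locally_integrable_indicator_inner[OF has_weak_gradientD(2)[OF hw] K])
  have [measurable]: "W \<in> borel_measurable lebesgue" "G e \<in> borel_measurable lebesgue" for e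
    using iW iG by auto
  note [measurable] = conv_moll_measurable[OF iW] conv_moll_measurable[OF iG]
  have LK: "in_Lp p K w" "in_Lp p K g" using sobolev_locD(2,3)[OF S K] .
  have fW: "(\<integral>\<^sup>+x. ennreal (\<bar>W x\<bar> powr p) \<partial>lebesgue) < \<infinity>"
    using LK(1) unfolding in_Lp_iff[OF K_sets] by (simp add: W_def abs_mult)
  have fG: "(\<integral>\<^sup>+x. ennreal (\<bar>G e x\<bar> powr p) \<partial>lebesgue) < \<infinity>" if e: "e \<in> Basis" for e
  proof -
    have "(\<integral>\<^sup>+x. ennreal (\<bar>G e x\<bar> powr p) \<partial>lebesgue) \<le> (\<integral>\<^sup>+x. ennreal (norm (indicator K x *\<^sub>R g x) powr p) \<partial>lebesgue)"
      using p Basis_le_norm[OF e] by (intro nn_integral_mono ennreal_leI powr_mono2) (auto simp: G_def indicator_def)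
    also have "\<dots> < \<infinity>" using LK(2) unfolding in_Lp_iff[OF K_sets] by blast
    finally show ?thesis .
  qed
  obtain r K' where r: "r > 0" "compact K'" "K' \<subseteq> \<Omega>" "\<And>x. x \<in> K \<Longrightarrow> cball x r \<subseteq> K'"
    using compact_neighbourhood[OF K(1) assms(1) K(2)] by blast
  obtain r' K'' where r': "r' > 0" "compact K''" "K'' \<subseteq> \<Omega>" "\<And>x. x \<in> K' \<Longrightarrow> cball x r' \<subseteq> K''"
    using compact_neighbourhood[OF r(2) assms(1) r(3)] by blast
  define C where "C = real DIM('a) powr p"
  define T where "T n = (\<integral>\<^sup>+x. ennreal (\<bar>conv W (moll n) x - W x\<bar> powr p) \<partial>lebesgue)
     + ennreal C * (\<Sum>e\<in>(Basis::'a set). \<integral>\<^sup>+x. ennreal (\<bar>conv (G e) (moll n) x - G e x\<bar> powr p) \<partial>lebesgue)" for n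
  have "T \<longlonglongrightarrow> 0 + ennreal C * (\<Sum>e\<in>(Basis::'a set). 0)"
    unfolding T_def
  proof (intro tendsto_add ennreal_tendsto_cmult tendsto_sum)
    show "(\<lambda>n. \<integral>\<^sup>+x. ennreal (\<bar>conv W (moll n) x - W x\<bar> powr p) \<partial>lebesgue) \<longlonglongrightarrow> 0"
      by (rule mollify_compact_support[OF iW p fW K(1)]) (simp add: W_def)
    show "(\<lambda>n. \<integral>\<^sup>+x. ennreal (\<bar>conv (G e) (moll n) x - G e x\<bar> powr p) \<partial>lebesgue) \<longlonglongrightarrow> 0" if "e \<in> Basis" for e
      by (rule mollify_compact_support[OF iG p fG[OF that] K(1)]) (simp add: G_def)
  qed simp
  then have T0: "T \<longlonglongrightarrow> 0" by simp
  have main: "\<forall>\<^sub>F n in sequentially. conv W (moll n) \<in> test_functions \<Omega> \<and>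
      (\<integral>\<^sup>+x. ennreal (\<bar>w x - conv W (moll n) x\<bar> powr p
         + norm (weak_gradient \<Omega> (\<lambda>x. w x - conv W (moll n) x) x) powr p) \<partial>lebesgue_on \<Omega>) \<le> T n"
    using eventually_moll_radius[OF r(1)] eventually_moll_radius[OF r'(1)]
  proof eventually_elim
    case (elim n)
    define \<psi> where "\<psi> = conv W (moll n)"
    have t: "moll n \<in> test_functions (UNIV :: 'a set)" by (rule mollifier_test) simp
    have z: "moll n z = 0" if "z \<notin> cball 0 r" for z :: 'a
      using that elim by (intro mollifier_outside) auto
    have z': "moll n z = 0" if "z \<notin> cball 0 r'" for z :: 'a
      using that elim by (intro mollifier_outside) auto
    have disj: "cball x r \<inter> K = {}" if "x \<notin> K'" for x
    proof (rule ccontr)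
      assume "cball x r \<inter> K \<noteq> {}"
      then obtain y where "y \<in> K" "x \<in> cball y r" by (auto simp: dist_commute)
      then show False using r(4)[of y] that by blast
    qed
    have out: "conv v (\<lambda>z. frechet_derivative (moll n) (at z) e) x = 0"
      "conv v (moll n) x = 0" if "\<And>y. y \<notin> K \<Longrightarrow> v y = 0" "x \<notin> K'" for v e x
    proof -
      have fz: "frechet_derivative (moll n) (at z) e = 0" if "z \<notin> cball 0 r" for z :: 'a
        using frechet_derivative_zero_outside[OF closed_cball z that] by simp
      show "conv v (\<lambda>z. frechet_derivative (moll n) (at z) e) x = 0"
        by (rule conv_outside[where K=K and r=r]) (use that(1) fz disj[OF that(2)] in auto)
      show "conv v (moll n) x = 0"
        by (rule conv_outside[where K=K and r=r]) (use that(1) z disj[OF that(2)] in auto)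
    qed
    have Wz: "W y = 0" "G e y = 0" if "y \<notin> K" for e y using that by (auto simp: W_def G_def)
    have C_\<psi>: "\<forall>k. C_k k \<psi>" unfolding \<psi>_def using C_k_conv[OF iW t] by blast
    have \<psi>: "\<psi> \<in> test_functions \<Omega>"
      by (rule test_functionsI[OF C_\<psi> r(2,3)]) (unfold \<psi>_def, rule out(2)[OF Wz(1)])
    \<comment> \<open>Points outside \<open>K'\<close> are treated separately, since the kernel centred there may leave \<open>\<Omega>\<close>; but then it does not meet \<open>K\<close>.\<close>
    have d\<psi>: "frechet_derivative \<psi> (at x) e = conv (G e) (moll n) x" if e: "e \<in> Basis" for x e
    proof -
      have "frechet_derivative \<psi> (at x) e = conv W (\<lambda>z. frechet_derivative (moll n) (at z) e) x"
        unfolding \<psi>_def by (rule conv_partial[OF iW t e])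
      also have "\<dots> = conv (G e) (moll n) x"
      proof (cases "x \<in> K'")
        case True
        have KK': "K \<subseteq> K''"
        proof
          fix y assume "y \<in> K"
          then have "y \<in> K'" using r(4)[of y] r(1) centre_in_cball[of y r] by auto
          then show "y \<in> K''" using r'(4)[of y] r'(1) centre_in_cball[of y r'] by auto
        qed
        have "W = (\<lambda>y. indicator K'' y * w y)"
          using KK' wz r'(3) by (auto simp: W_def fun_eq_iff indicator_def)
        then have "conv W (\<lambda>z. frechet_derivative (moll n) (at z) e) x
            = conv (\<lambda>y. indicator K'' y * w y) (\<lambda>z. frechet_derivative (moll n) (at z) e) x" by simp
        also have "\<dots> = conv (\<lambda>y. indicator K'' y * (g y \<bullet> e)) (moll n) x"
          by (rule weak_gradient_conv[OF hw e t _ r'(4)[OF True] r'(3)]) (rule z')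
        also have "\<dots> = conv (G e) (moll n) x"
        proof (rule conv_cong_AE)
          show "AE y in lebesgue. indicator K'' y * (g y \<bullet> e) = G e y"
            using gz by eventually_elim (use KK' r'(3) in \<open>auto simp: G_def indicator_def\<close>)
          show "(\<lambda>y. indicator K'' y * (g y \<bullet> e)) \<in> borel_measurable lebesgue"
            using locally_integrable_indicator_inner[OF has_weak_gradientD(2)[OF hw] r'(2,3)] by auto
          show "continuous_on UNIV (moll n :: 'a \<Rightarrow> real)" by (rule C_k_continuous[OF test_functionsD(1)[OF t]])
        qed measurable
        finally show ?thesis .
      next
        case False
        show ?thesis using out(1)[OF Wz(1) False] out(2)[OF Wz(2) False] by simp
      qed
      finally show ?thesis .
    qed
    have wg: "has_weak_gradient \<Omega> (\<lambda>x. w x - \<psi> x) (\<lambda>x. g x - grad \<psi> x)"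
      using weak_gradient_add[OF hw weak_gradient_scale[OF test_function_weak_gradient[OF \<psi>], where c="- 1"]] by simp
    have bound: "norm (g x - grad \<psi> x) powr p \<le> C * (\<Sum>e\<in>Basis. \<bar>conv (G e) (moll n) x - G e x\<bar> powr p)"
      if "x \<notin> K \<longrightarrow> g x = 0" for x
    proof -
      have "\<bar>(g x - grad \<psi> x) \<bullet> e\<bar> = \<bar>conv (G e) (moll n) x - G e x\<bar>" if "e \<in> Basis" for e
        using \<open>x \<notin> K \<longrightarrow> g x = 0\<close> that
        by (auto simp: inner_diff_left grad_inner d\<psi> G_def indicator_def abs_minus_commute)
      then show ?thesis
        using norm_powr_le_components[of p "g x - grad \<psi> x"] p by (simp add: C_def)
    qed
    have "(\<integral>\<^sup>+x. ennreal (\<bar>w x - \<psi> x\<bar> powr p + norm (weak_gradient \<Omega> (\<lambda>x. w x - \<psi> x) x) powr p) \<partial>lebesgue_on \<Omega>)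
      = (\<integral>\<^sup>+x. ennreal (\<bar>w x - \<psi> x\<bar> powr p + norm (weak_gradient \<Omega> (\<lambda>x. w x - \<psi> x) x) powr p) * indicator \<Omega> x \<partial>lebesgue)"
      by (rule nn_integral_restrict_space) simp
    also have "\<dots> \<le> (\<integral>\<^sup>+x. ennreal (\<bar>conv W (moll n) x - W x\<bar> powr p)
       + ennreal C * (\<Sum>e\<in>Basis. ennreal (\<bar>conv (G e) (moll n) x - G e x\<bar> powr p)) \<partial>lebesgue)"
    proof (rule nn_integral_mono_AE)
      show "AE x in lebesgue. ennreal (\<bar>w x - \<psi> x\<bar> powr p + norm (weak_gradient \<Omega> (\<lambda>x. w x - \<psi> x) x) powr p) * indicator \<Omega> x
        \<le> ennreal (\<bar>conv W (moll n) x - W x\<bar> powr p)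
       + ennreal C * (\<Sum>e\<in>Basis. ennreal (\<bar>conv (G e) (moll n) x - G e x\<bar> powr p))"
        using weak_gradient_eq(2)[OF assms(1) wg] gz
      proof eventually_elim
        case (elim x)
        show ?case
        proof (cases "x \<in> \<Omega>")
          case True
          then have e1: "weak_gradient \<Omega> (\<lambda>x. w x - \<psi> x) x = g x - grad \<psi> x" and e2: "x \<notin> K \<longrightarrow> g x = 0"
            using elim by auto
          have e3: "\<bar>w x - \<psi> x\<bar> = \<bar>conv W (moll n) x - W x\<bar>"
            unfolding \<psi>_def WW[OF True] by (rule abs_minus_commute)
          have "\<bar>w x - \<psi> x\<bar> powr p + norm (weak_gradient \<Omega> (\<lambda>x. w x - \<psi> x) x) powr p
            \<le> \<bar>conv W (moll n) x - W x\<bar> powr p + C * (\<Sum>e\<in>Basis. \<bar>conv (G e) (moll n) x - G e x\<bar> powr p)"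
            unfolding e1 e3 using bound[OF e2] by simp
          then have "ennreal (\<bar>w x - \<psi> x\<bar> powr p + norm (weak_gradient \<Omega> (\<lambda>x. w x - \<psi> x) x) powr p)
            \<le> ennreal (\<bar>conv W (moll n) x - W x\<bar> powr p + C * (\<Sum>e\<in>Basis. \<bar>conv (G e) (moll n) x - G e x\<bar> powr p))"
            by (rule ennreal_leI)
          also have "\<dots> = ennreal (\<bar>conv W (moll n) x - W x\<bar> powr p)
             + ennreal C * (\<Sum>e\<in>Basis. ennreal (\<bar>conv (G e) (moll n) x - G e x\<bar> powr p))"
            by (subst ennreal_plus) (auto simp: C_def sum_nonneg ennreal_mult sum_ennreal)
          finally show ?thesis using True by simp
        qed simp
      qed
    qed
    also have "\<dots> = T n"
    proof -
      have [measurable]: "(\<lambda>x. ennreal (\<bar>conv (G e) (moll n) x - G e x\<bar> powr p)) \<in> borel_measurable lebesgue" for e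
        by measurable
      have "(\<lambda>x. ennreal (\<bar>conv W (moll n) x - W x\<bar> powr p)) \<in> borel_measurable lebesgue" by measurable
      then show ?thesis
        unfolding T_def
        by (subst nn_integral_add) (simp_all add: nn_integral_cmult nn_integral_sum del: of_nat_Suc sum_ennreal)
    qed
    finally show ?case using \<psi> unfolding \<psi>_def by blast
  qed
  have "\<exists>\<psi>\<in>test_functions \<Omega>. W1p_norm p \<Omega> (\<lambda>x. w x - \<psi> x) < \<epsilon>" if "\<epsilon> > 0" for \<epsilon>
  proof -
    define \<rho> where "\<rho> = (\<epsilon> / 2) powr p"
    have "\<rho> > 0" using that by (simp add: \<rho>_def)
    have "\<forall>\<^sub>F n in sequentially. T n < ennreal \<rho>"
      using order_tendstoD(2)[OF T0, of "ennreal \<rho>"] \<open>\<rho> > 0\<close> by simp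
    then have "\<forall>\<^sub>F n in sequentially. T n < ennreal \<rho> \<and> conv W (moll n) \<in> test_functions \<Omega> \<and>
      (\<integral>\<^sup>+x. ennreal (\<bar>w x - conv W (moll n) x\<bar> powr p
         + norm (weak_gradient \<Omega> (\<lambda>x. w x - conv W (moll n) x) x) powr p) \<partial>lebesgue_on \<Omega>) \<le> T n"
      using main by eventually_elim simp
    then obtain n where n: "T n < ennreal \<rho>" "conv W (moll n) \<in> test_functions \<Omega>"
      "(\<integral>\<^sup>+x. ennreal (\<bar>w x - conv W (moll n) x\<bar> powr p
         + norm (weak_gradient \<Omega> (\<lambda>x. w x - conv W (moll n) x) x) powr p) \<partial>lebesgue_on \<Omega>) \<le> T n"
      using eventually_happens' sequentially_bot by blast
    have "(LINT x|lebesgue_on \<Omega>. \<bar>w x - conv W (moll n) x\<bar> powr p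
         + norm (weak_gradient \<Omega> (\<lambda>x. w x - conv W (moll n) x) x) powr p) \<le> \<rho>"
      by (rule integral_real_bounded) (use n(1,3) \<open>\<rho> > 0\<close> in auto)
    then have "W1p_norm p \<Omega> (\<lambda>x. w x - conv W (moll n) x) \<le> \<rho> powr (1 / p)"
      unfolding W1p_norm_def using p by (intro powr_mono2 integral_nonneg_AE AE_I2 add_nonneg_nonneg) auto
    also have "\<dots> = \<epsilon> / 2" using p that by (simp add: \<rho>_def powr_powr)
    also have "\<dots> < \<epsilon>" using that by simp
    finally show ?thesis using n(2) by blast
  qed
  moreover have "w \<in> W1p p \<Omega>"
  proof -
    have e1: "indicator \<Omega> x *\<^sub>R w x = indicator K x *\<^sub>R w x" for x
      using wz[of x] K(2) by (auto simp: indicator_def)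
    have "in_Lp p \<Omega> w"
      using LK(1) unfolding in_Lp_iff[OF K_sets] in_Lp_iff[OF \<Omega>_sets] e1 .
    moreover have "in_Lp p \<Omega> (\<lambda>x. indicator K x *\<^sub>R g x)"
    proof -
      have e2: "indicator \<Omega> x *\<^sub>R indicator K x *\<^sub>R g x = indicator K x *\<^sub>R g x" for x
        using K(2) by (auto simp: indicator_def)
      show ?thesis using LK(2) unfolding in_Lp_iff[OF K_sets] in_Lp_iff[OF \<Omega>_sets] e2 .
    qed
    then have "in_Lp p \<Omega> (weak_gradient \<Omega> w)"
    proof (rule in_Lp_cong_AE[OF \<Omega>_sets])
      show "AE x in lebesgue. x \<in> \<Omega> \<longrightarrow> indicator K x *\<^sub>R g x = weak_gradient \<Omega> w x"
        using weak_gradient_eq(2)[OF assms(1) hw] gz by eventually_elim (auto simp: indicator_def)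
    qed
    ultimately show ?thesis using hw by (auto simp: W1p_def)
  qed
  ultimately show ?thesis by (simp add: W1p_0_def)
qed

section \<open>Lattice operations on local Sobolev functions\<close>

lemma sobolev_loc_add:
  fixes u v :: "'a::euclidean_space \<Rightarrow> real"
  assumes "p \<ge> 0" and u: "sobolev_loc p \<Omega> u g" and v: "sobolev_loc p \<Omega> v h"
  shows "sobolev_loc p \<Omega> (\<lambda>x. u x + v x) (\<lambda>x. g x + h x)"
  using sobolev_locD[OF u] sobolev_locD[OF v] assms(1)
  by (intro sobolev_locI weak_gradient_add in_Lp_add compact_lebesgue) auto

lemma sobolev_loc_scale:
  fixes u :: "'a::euclidean_space \<Rightarrow> real"
  assumes u: "sobolev_loc p \<Omega> u g"
  shows "sobolev_loc p \<Omega> (\<lambda>x. c * u x) (\<lambda>x. c *\<^sub>R g x)"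
proof (rule sobolev_locI)
  show "has_weak_gradient \<Omega> (\<lambda>x. c * u x) (\<lambda>x. c *\<^sub>R g x)"
    by (rule weak_gradient_scale[OF sobolev_locD(1)[OF u]])
  fix K assume K: "compact K" "K \<subseteq> \<Omega>"
  show "in_Lp p K (\<lambda>x. c * u x)"
    using in_Lp_scale[OF compact_lebesgue[OF K(1)] sobolev_locD(2)[OF u K], of c] by simp
  show "in_Lp p K (\<lambda>x. c *\<^sub>R g x)"
    by (rule in_Lp_scale[OF compact_lebesgue[OF K(1)] sobolev_locD(3)[OF u K]])
qed

lemma sobolev_loc_pos_part:
  fixes u :: "'a::euclidean_space \<Rightarrow> real"
  assumes "open \<Omega>" "p \<ge> 0" and u: "sobolev_loc p \<Omega> u g"
  shows "sobolev_loc p \<Omega> (\<lambda>x. max 0 (u x)) (\<lambda>x. if u x > 0 then g x else 0)"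
proof (rule sobolev_locI)
  show hw: "has_weak_gradient \<Omega> (\<lambda>x. max 0 (u x)) (\<lambda>x. if u x > 0 then g x else 0)"
    by (rule weak_gradient_pos_part[OF assms(1) sobolev_locD(1)[OF u]])
  fix K assume K: "compact K" "K \<subseteq> \<Omega>"
  show "in_Lp p K (\<lambda>x. max 0 (u x))"
    using locally_integrable_indicator[OF has_weak_gradientD(1)[OF hw] K]
    by (intro in_Lp_dominated[OF compact_lebesgue[OF K(1)] assms(2) sobolev_locD(2)[OF u K]]) auto
  show "in_Lp p K (\<lambda>x. if u x > 0 then g x else 0)"
    using borel_measurable_integrable[OF locally_integrable_indicator[OF has_weak_gradientD(2)[OF hw] K]]
    by (intro in_Lp_dominated[OF compact_lebesgue[OF K(1)] assms(2) sobolev_locD(3)[OF u K]]) auto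
qed

text \<open>
  The maximum is \<open>u + max 0 (v - u)\<close>.
\<close>

lemma sobolev_loc_max:
  fixes u v :: "'a::euclidean_space \<Rightarrow> real"
  assumes "open \<Omega>" "p \<ge> 0" and u: "sobolev_loc p \<Omega> u g" and v: "sobolev_loc p \<Omega> v h"
  shows "sobolev_loc p \<Omega> (\<lambda>x. max (u x) (v x)) (\<lambda>x. if u x < v x then h x else g x)"
proof -
  have "sobolev_loc p \<Omega> (\<lambda>x. u x + max 0 (v x + (-1) * u x))
     (\<lambda>x. g x + (if v x + (-1) * u x > 0 then h x + (-1) *\<^sub>R g x else 0))"
    by (intro sobolev_loc_add sobolev_loc_pos_part sobolev_loc_scale assms)
  moreover have "(\<lambda>x. u x + max 0 (v x + (-1) * u x)) = (\<lambda>x. max (u x) (v x))" by (auto simp: fun_eq_iff)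
  moreover have "(\<lambda>x. g x + (if v x + (-1) * u x > 0 then h x + (-1) *\<^sub>R g x else 0)) = (\<lambda>x. if u x < v x then h x else g x)"
    by (auto simp: fun_eq_iff)
  ultimately show ?thesis by simp
qed

lemma sobolev_loc_min:
  fixes u v :: "'a::euclidean_space \<Rightarrow> real"
  assumes "open \<Omega>" "p \<ge> 0" and u: "sobolev_loc p \<Omega> u g" and v: "sobolev_loc p \<Omega> v h"
  shows "sobolev_loc p \<Omega> (\<lambda>x. min (u x) (v x)) (\<lambda>x. if v x < u x then h x else g x)"
proof -
  have "sobolev_loc p \<Omega> (\<lambda>x. u x + (-1) * max 0 (u x + (-1) * v x))
     (\<lambda>x. g x + (-1) *\<^sub>R (if u x + (-1) * v x > 0 then g x + (-1) *\<^sub>R h x else 0))"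
    by (intro sobolev_loc_add sobolev_loc_pos_part sobolev_loc_scale assms)
  moreover have "(\<lambda>x. u x + (-1) * max 0 (u x + (-1) * v x)) = (\<lambda>x. min (u x) (v x))" by (auto simp: fun_eq_iff)
  moreover have "(\<lambda>x. g x + (-1) *\<^sub>R (if u x + (-1) * v x > 0 then g x + (-1) *\<^sub>R h x else 0)) = (\<lambda>x. if v x < u x then h x else g x)"
    by (auto simp: fun_eq_iff)
  ultimately show ?thesis by simp
qed

text \<open>
  Ties between functions are harmless: on the set where they coincide, either gradient may be used
  in an energy.
\<close>

lemma weak_gradient_agree:
  fixes u v :: "'a::euclidean_space \<Rightarrow> real"
  assumes "open \<Omega>" and u: "has_weak_gradient \<Omega> u g" and v: "has_weak_gradient \<Omega> v h"
  shows "AE x in lebesgue. x \<in> \<Omega> \<longrightarrow> u x = v x \<longrightarrow> g x = h x"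
  using weak_gradient_zero_set[OF assms(1) weak_gradient_add[OF u weak_gradient_scale[OF v, where c="- 1"]]]
  by eventually_elim auto

section \<open>Competitors for the minimum of two functions\<close>

text \<open>
  Integrals of the \<open>p\<close>-th power of the gradient over parts of a compact set are finite, so energies
  can be added and subtracted as real numbers.
\<close>

definition energy :: "real \<Rightarrow> 'a::euclidean_space set \<Rightarrow> ('a \<Rightarrow> 'a) \<Rightarrow> ('a \<Rightarrow> bool) \<Rightarrow> real" where
  "energy p K g A = (LINT x|lebesgue. (if x \<in> K \<and> A x then norm (g x) powr p else 0))"

lemma energy_integrable:
  fixes K :: "'a::euclidean_space set"
  assumes "compact K" "in_Lp p K g" "{x \<in> K. A x} \<in> sets lebesgue"
  shows "integrable lebesgue (\<lambda>x. if x \<in> K \<and> A x then norm (g x) powr p else 0)"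
proof -
  have K: "K \<inter> space lebesgue \<in> sets lebesgue" using compact_lebesgue[OF assms(1)] by simp
  have "integrable lebesgue (\<lambda>x. indicator K x *\<^sub>R (norm (g x) powr p))"
    using assms(2) unfolding in_Lp_def integrable_restrict_space[OF K] by blast
  then have "integrable lebesgue (\<lambda>x. indicator {x \<in> K. A x} x *\<^sub>R (indicator K x *\<^sub>R (norm (g x) powr p)))"
    by (rule integrable_mult_indicator[OF assms(3)])
  also have "(\<lambda>x. indicator {x \<in> K. A x} x *\<^sub>R (indicator K x *\<^sub>R (norm (g x) powr p)))
      = (\<lambda>x. if x \<in> K \<and> A x then norm (g x) powr p else 0)"
    by (auto simp: fun_eq_iff indicator_def)
  finally show ?thesis .
qed

lemma energy_nonneg: "0 \<le> energy p K g A"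
  unfolding energy_def by (intro integral_nonneg_AE) auto

lemma energy_nn_integral:
  fixes K :: "'a::euclidean_space set"
  assumes "compact K" "in_Lp p K g" "{x \<in> K. A x} \<in> sets lebesgue"
  shows "(\<integral>\<^sup>+x\<in>{x \<in> K. A x}. ennreal (norm (g x) powr p) \<partial>lebesgue) = ennreal (energy p K g A)"
proof -
  have "(\<integral>\<^sup>+x\<in>{x \<in> K. A x}. ennreal (norm (g x) powr p) \<partial>lebesgue)
     = (\<integral>\<^sup>+x. ennreal (if x \<in> K \<and> A x then norm (g x) powr p else 0) \<partial>lebesgue)"
    by (intro nn_integral_cong) (auto simp: indicator_def)
  also have "\<dots> = ennreal (energy p K g A)"
    unfolding energy_def by (rule nn_integral_eq_integral[OF energy_integrable[OF assms]]) auto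
  finally show ?thesis .
qed

lemma energy_split:
  fixes K :: "'a::euclidean_space set"
  assumes "compact K" "in_Lp p K g" "{x \<in> K. B x} \<in> sets lebesgue" "{x \<in> K. C x} \<in> sets lebesgue"
    and "\<And>x. x \<in> K \<Longrightarrow> A x \<longleftrightarrow> B x \<or> C x" "\<And>x. x \<in> K \<Longrightarrow> B x \<Longrightarrow> C x \<Longrightarrow> False"
  shows "energy p K g A = energy p K g B + energy p K g C"
proof -
  have "energy p K g A = (LINT x|lebesgue. (if x \<in> K \<and> B x then norm (g x) powr p else 0)
      + (if x \<in> K \<and> C x then norm (g x) powr p else 0))"
    unfolding energy_def using assms(5,6) by (intro Bochner_Integration.integral_cong) auto
  also have "\<dots> = energy p K g B + energy p K g C"
    unfolding energy_def
    by (rule Bochner_Integration.integral_add[OF energy_integrable[OF assms(1-3)] energy_integrable[OF assms(1,2,4)]])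
  finally show ?thesis .
qed

lemma energy_cong_AE:
  fixes K :: "'a::euclidean_space set"
  assumes "\<And>x. x \<in> K \<Longrightarrow> A x \<longleftrightarrow> B x" "AE x in lebesgue. x \<in> K \<longrightarrow> B x \<longrightarrow> g x = h x"
  shows "energy p K g A = energy p K h B"
  unfolding energy_def
  by (rule integral_lebesgue_cong_AE) (use assms(2) in eventually_elim, use assms(1) in auto)

lemma sublevel_measurable:
  fixes u v :: "'a::euclidean_space \<Rightarrow> real"
  assumes K: "compact K" and u: "in_Lp p K u" and v: "in_Lp p K v"
  shows "{x \<in> K. u x < v x} \<in> sets lebesgue" "{x \<in> K. u x \<le> v x} \<in> sets lebesgue"
proof -
  note [measurable] = compact_lebesgue[OF K]
  have [measurable]: "(\<lambda>x. indicator K x * u x) \<in> borel_measurable lebesgue"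
    "(\<lambda>x. indicator K x * v x) \<in> borel_measurable lebesgue"
    using u v unfolding in_Lp_iff[OF compact_lebesgue[OF K]] by simp_all
  have e: "{x \<in> K. u x < v x} = {x \<in> space lebesgue. x \<in> K \<and> indicator K x * u x < indicator K x * v x}"
    "{x \<in> K. u x \<le> v x} = {x \<in> space lebesgue. x \<in> K \<and> indicator K x * u x \<le> indicator K x * v x}"
    by auto
  show "{x \<in> K. u x < v x} \<in> sets lebesgue" "{x \<in> K. u x \<le> v x} \<in> sets lebesgue"
    unfolding e by measurable
qed

lemma sets_Collect_conj_on:
  assumes "{x \<in> K. A x} \<in> sets M" "{x \<in> K. B x} \<in> sets M"
  shows "{x \<in> K. A x \<and> B x} \<in> sets M"
proof -
  have "{x \<in> K. A x \<and> B x} = {x \<in> K. A x} \<inter> {x \<in> K. B x}" by auto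
  then show ?thesis using sets.Int[OF assms] by simp
qed

text \<open>
  Quasisuperminimality tested only with competitors \<open>v = u + \<phi>\<close> that differ from \<open>u\<close> in a compact
  subset of \<open>\<Omega>\<close>. Stating it for \<open>v\<close> instead of \<open>\<phi>\<close> makes it convenient to insert maxima and minima
  as competitors.
\<close>

definition local_qsm :: "real \<Rightarrow> real \<Rightarrow> 'a::euclidean_space set \<Rightarrow> ('a \<Rightarrow> real) \<Rightarrow> bool" where
  "local_qsm p Q \<Omega> u \<longleftrightarrow> 1 \<le> Q \<and> (\<exists>g. sobolev_loc p \<Omega> u g) \<and>
    (\<forall>g v h K. sobolev_loc p \<Omega> u g \<and> sobolev_loc p \<Omega> v h \<and> compact K \<and> K \<subseteq> \<Omega> \<and>
       (\<forall>x. u x \<le> v x) \<and> (\<forall>x. x \<notin> K \<longrightarrow> v x = u x) \<longrightarrow>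
       energy p K g (\<lambda>x. u x < v x) \<le> Q * energy p K h (\<lambda>x. u x < v x))"

lemma local_qsmD:
  assumes "local_qsm p Q \<Omega> u"
  shows "1 \<le> Q" "\<exists>g. sobolev_loc p \<Omega> u g"
    "\<And>g v h K. sobolev_loc p \<Omega> u g \<Longrightarrow> sobolev_loc p \<Omega> v h \<Longrightarrow> compact K \<Longrightarrow> K \<subseteq> \<Omega> \<Longrightarrow>
       \<forall>x. u x \<le> v x \<Longrightarrow> \<forall>x. x \<notin> K \<longrightarrow> v x = u x \<Longrightarrow>
       energy p K g (\<lambda>x. u x < v x) \<le> Q * energy p K h (\<lambda>x. u x < v x)"
  using assms by (auto simp: local_qsm_def)

text \<open>
  Test \<open>w\<close> with the competitor \<open>max w (min v w')\<close>, which exceeds \<open>w\<close> on \<open>{w < w', w < v}\<close>, and \<open>w'\<close>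
  with \<open>max w' v\<close>, which exceeds \<open>w'\<close> on \<open>{w' < v}\<close>. The energy of \<open>w'\<close> on \<open>{w < w' < v}\<close> is part of
  the upper bound in the first inequality and of the lower bound in the second. Adding \<open>Q\<close> times
  the second inequality to the first one eliminates it. What remains are energies of \<open>u\<close> and of \<open>v\<close>.
\<close>

lemma min_competitor:
  fixes w w' u v :: "'a::euclidean_space \<Rightarrow> real"
  assumes "open \<Omega>" "p \<ge> 0" and w: "local_qsm p Q \<Omega> w" and w': "local_qsm p Q' \<Omega> w'"
    and u: "\<And>x. u x = min (w x) (w' x)"
    and g: "sobolev_loc p \<Omega> u g" and h: "sobolev_loc p \<Omega> v h"
    and K: "compact K" "K \<subseteq> \<Omega>" and v: "\<forall>x. u x \<le> v x" "\<forall>x. x \<notin> K \<longrightarrow> v x = u x"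
  shows "Q * energy p K g (\<lambda>x. u x < v x) - (Q - 1) * energy p K g (\<lambda>x. u x < v x \<and> w x < w' x)
    \<le> Q * Q' * energy p K h (\<lambda>x. u x < v x)"
proof -
  note Q = local_qsmD(1)[OF w] and Q' = local_qsmD(1)[OF w']
  obtain gw where gw: "sobolev_loc p \<Omega> w gw" using local_qsmD(2)[OF w] by blast
  obtain gw' where gw': "sobolev_loc p \<Omega> w' gw'" using local_qsmD(2)[OF w'] by blast
  note Lu = sobolev_locD(2)[OF g K] and Lv = sobolev_locD(2)[OF h K]
    and Lw = sobolev_locD(2)[OF gw K] and Lw' = sobolev_locD(2)[OF gw' K]
  note Lg = sobolev_locD(3)[OF g K] and Lh = sobolev_locD(3)[OF h K]
    and Lgw = sobolev_locD(3)[OF gw K] and Lgw' = sobolev_locD(3)[OF gw' K]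
  note m = sublevel_measurable[OF K(1)] and mc = sets_Collect_conj_on
  define gm where "gm x = (if w' x < v x then gw' x else h x)" for x
  have sm: "sobolev_loc p \<Omega> (\<lambda>x. min (v x) (w' x)) gm"
    unfolding gm_def by (rule sobolev_loc_min[OF assms(1,2) h gw'])
  define ga where "ga x = (if w x < min (v x) (w' x) then gm x else gw x)" for x
  have sa: "sobolev_loc p \<Omega> (\<lambda>x. max (w x) (min (v x) (w' x))) ga"
    unfolding ga_def by (rule sobolev_loc_max[OF assms(1,2) gw sm])
  \<comment> \<open>Outside \<open>K\<close> the competitor equals \<open>w\<close>, because there \<open>v = u \<le> w\<close>.\<close>
  have "energy p K gw (\<lambda>x. w x < max (w x) (min (v x) (w' x)))
      \<le> Q * energy p K ga (\<lambda>x. w x < max (w x) (min (v x) (w' x)))"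
  proof (rule local_qsmD(3)[OF w gw sa K])
    show "\<forall>x. x \<notin> K \<longrightarrow> max (w x) (min (v x) (w' x)) = w x" using v(2) u by auto
  qed auto
  moreover have "energy p K gw (\<lambda>x. w x < max (w x) (min (v x) (w' x))) = energy p K g (\<lambda>x. u x < v x \<and> w x < w' x)"
  proof (rule energy_cong_AE)
    show "AE x in lebesgue. x \<in> K \<longrightarrow> u x < v x \<and> w x < w' x \<longrightarrow> gw x = g x"
      using weak_gradient_agree[OF assms(1) sobolev_locD(1)[OF gw] sobolev_locD(1)[OF g]]
      by eventually_elim (use K(2) u in auto)
  qed (auto simp: u)
  moreover have "energy p K ga (\<lambda>x. w x < max (w x) (min (v x) (w' x)))
     = energy p K ga (\<lambda>x. w x < w' x \<and> w' x < v x) + energy p K ga (\<lambda>x. w x < v x \<and> v x \<le> w' x)"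
    by (rule energy_split[OF K(1) sobolev_locD(3)[OF sa K]])
      (auto intro!: mc m Lv Lw Lw')
  moreover have "energy p K ga (\<lambda>x. w x < w' x \<and> w' x < v x) = energy p K gw' (\<lambda>x. w x < w' x \<and> w' x < v x)"
    by (rule energy_cong_AE) (auto simp: ga_def gm_def)
  moreover have "energy p K ga (\<lambda>x. w x < v x \<and> v x \<le> w' x) = energy p K h (\<lambda>x. w x < v x \<and> v x \<le> w' x)"
    by (rule energy_cong_AE) (auto simp: ga_def gm_def)
  ultimately have I1: "energy p K g (\<lambda>x. u x < v x \<and> w x < w' x)
     \<le> Q * (energy p K gw' (\<lambda>x. w x < w' x \<and> w' x < v x) + energy p K h (\<lambda>x. w x < v x \<and> v x \<le> w' x))"
    by simp
  define gb where "gb x = (if w' x < v x then h x else gw' x)" for x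
  have sb: "sobolev_loc p \<Omega> (\<lambda>x. max (w' x) (v x)) gb"
    unfolding gb_def by (rule sobolev_loc_max[OF assms(1,2) gw' h])
  have "energy p K gw' (\<lambda>x. w' x < max (w' x) (v x)) \<le> Q' * energy p K gb (\<lambda>x. w' x < max (w' x) (v x))"
  proof (rule local_qsmD(3)[OF w' gw' sb K])
    show "\<forall>x. x \<notin> K \<longrightarrow> max (w' x) (v x) = w' x" using v(2) u by auto
  qed auto
  moreover have "energy p K gw' (\<lambda>x. w' x < max (w' x) (v x))
     = energy p K gw' (\<lambda>x. w x < w' x \<and> w' x < v x) + energy p K gw' (\<lambda>x. w' x < v x \<and> w' x \<le> w x)"
    by (rule energy_split[OF K(1) Lgw']) (auto intro!: mc m Lv Lw Lw')
  moreover have "energy p K gw' (\<lambda>x. w' x < v x \<and> w' x \<le> w x) = energy p K g (\<lambda>x. u x < v x \<and> w' x \<le> w x)"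
  proof (rule energy_cong_AE)
    show "AE x in lebesgue. x \<in> K \<longrightarrow> u x < v x \<and> w' x \<le> w x \<longrightarrow> gw' x = g x"
      using weak_gradient_agree[OF assms(1) sobolev_locD(1)[OF gw'] sobolev_locD(1)[OF g]]
      by eventually_elim (use K(2) u in auto)
  qed (auto simp: u)
  moreover have "energy p K gb (\<lambda>x. w' x < max (w' x) (v x)) = energy p K h (\<lambda>x. w' x < v x)"
    by (rule energy_cong_AE) (auto simp: gb_def)
  ultimately have I2: "energy p K gw' (\<lambda>x. w x < w' x \<and> w' x < v x) + energy p K g (\<lambda>x. u x < v x \<and> w' x \<le> w x)
     \<le> Q' * energy p K h (\<lambda>x. w' x < v x)"
    by simp
  have S1: "energy p K g (\<lambda>x. u x < v x)
     = energy p K g (\<lambda>x. u x < v x \<and> w x < w' x) + energy p K g (\<lambda>x. u x < v x \<and> w' x \<le> w x)"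
    by (rule energy_split[OF K(1) Lg]) (auto intro!: mc m Lu Lv Lw Lw')
  have S2: "energy p K h (\<lambda>x. u x < v x)
     = energy p K h (\<lambda>x. w x < v x \<and> v x \<le> w' x) + energy p K h (\<lambda>x. w' x < v x)"
    by (rule energy_split[OF K(1) Lh]) (auto intro!: mc m Lv Lw Lw' simp: u)
  define E1 where "E1 = energy p K g (\<lambda>x. u x < v x \<and> w x < w' x)"
  define E2 where "E2 = energy p K g (\<lambda>x. u x < v x \<and> w' x \<le> w x)"
  define M where "M = energy p K gw' (\<lambda>x. w x < w' x \<and> w' x < v x)"
  define a where "a = energy p K h (\<lambda>x. w x < v x \<and> v x \<le> w' x)"
  define b where "b = energy p K h (\<lambda>x. w' x < v x)"
  \<comment> \<open>The energy \<open>M\<close> of \<open>w'\<close> between \<open>w\<close> and \<open>v\<close> cancels.\<close>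
  have "E1 + Q * E2 \<le> Q * (M + a) + Q * (Q' * b - M)"
    using I1 I2 Q unfolding E1_def[symmetric] E2_def[symmetric] M_def[symmetric] a_def[symmetric] b_def[symmetric]
    by (intro add_mono mult_left_mono) auto
  also have "\<dots> = Q * a + Q * Q' * b" by (simp add: algebra_simps)
  also have "Q * a \<le> Q * Q' * a"
    using Q Q' energy_nonneg[of p K h] unfolding a_def by (intro mult_right_mono) auto
  finally show ?thesis
    unfolding S1 S2 E1_def[symmetric] E2_def[symmetric] a_def[symmetric] b_def[symmetric]
    by (simp add: algebra_simps)
qed

lemma disjoint_energies:
  fixes u v :: "'a::euclidean_space \<Rightarrow> real"
  assumes K: "compact K" "in_Lp p K g" and "{x \<in> K. A x} \<in> sets lebesgue" "{x \<in> K. B x} \<in> sets lebesgue"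
    "{x \<in> K. C x} \<in> sets lebesgue" "{x \<in> K. T x} \<in> sets lebesgue"
    and sub: "\<And>x. A x \<Longrightarrow> T x" "\<And>x. B x \<Longrightarrow> T x" "\<And>x. C x \<Longrightarrow> T x"
    and disj: "\<And>x. A x \<Longrightarrow> B x \<Longrightarrow> False" "\<And>x. B x \<Longrightarrow> C x \<Longrightarrow> False" "\<And>x. A x \<Longrightarrow> C x \<Longrightarrow> False"
  shows "energy p K g A + energy p K g B + energy p K g C \<le> energy p K g T"
proof -
  note i = energy_integrable[OF K]
  have "energy p K g A + energy p K g B + energy p K g C
    = (LINT x|lebesgue. ((if x \<in> K \<and> A x then norm (g x) powr p else 0)
      + (if x \<in> K \<and> B x then norm (g x) powr p else 0)) + (if x \<in> K \<and> C x then norm (g x) powr p else 0))"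
    unfolding energy_def using i[OF assms(3)] i[OF assms(4)] i[OF assms(5)]
    by (simp add: Bochner_Integration.integral_add Bochner_Integration.integrable_add)
  also have "\<dots> \<le> energy p K g T"
    unfolding energy_def
  proof (rule integral_mono)
    show "integrable lebesgue (\<lambda>x. ((if x \<in> K \<and> A x then norm (g x) powr p else 0)
      + (if x \<in> K \<and> B x then norm (g x) powr p else 0)) + (if x \<in> K \<and> C x then norm (g x) powr p else 0))"
      using i[OF assms(3)] i[OF assms(4)] i[OF assms(5)] by (intro Bochner_Integration.integrable_add)
    show "integrable lebesgue (\<lambda>x. if x \<in> K \<and> T x then norm (g x) powr p else 0)" by (rule i[OF assms(6)])
    fix x
    show "((if x \<in> K \<and> A x then norm (g x) powr p else 0)
      + (if x \<in> K \<and> B x then norm (g x) powr p else 0)) + (if x \<in> K \<and> C x then norm (g x) powr p else 0)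
      \<le> (if x \<in> K \<and> T x then norm (g x) powr p else 0)"
      using sub[of x] disj[of x] by auto
  qed
  finally show ?thesis .
qed

section \<open>Constants for minima of two and three functions\<close>

lemma sobolev_loc_min_exists:
  fixes w w' :: "'a::euclidean_space \<Rightarrow> real"
  assumes "open \<Omega>" "p \<ge> 0" "local_qsm p Q \<Omega> w" "local_qsm p Q' \<Omega> w'"
  shows "\<exists>g. sobolev_loc p \<Omega> (\<lambda>x. min (w x) (w' x)) g"
  using local_qsmD(2)[OF assms(3)] local_qsmD(2)[OF assms(4)] sobolev_loc_min[OF assms(1,2)] by blast

text \<open>
  For \<open>Q = 1\<close> the partial energy in \<open>min_competitor\<close> drops out.
\<close>

lemma local_qsm_min_superminimizer:
  fixes w w' :: "'a::euclidean_space \<Rightarrow> real"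
  assumes "open \<Omega>" "p \<ge> 0" and w: "local_qsm p 1 \<Omega> w" and w': "local_qsm p Q' \<Omega> w'"
  shows "local_qsm p Q' \<Omega> (\<lambda>x. min (w x) (w' x))"
  unfolding local_qsm_def
proof (intro conjI allI impI local_qsmD(1)[OF w'] sobolev_loc_min_exists[OF assms])
  fix g v h K
  assume "sobolev_loc p \<Omega> (\<lambda>x. min (w x) (w' x)) g \<and> sobolev_loc p \<Omega> v h \<and> compact K \<and> K \<subseteq> \<Omega> \<and>
       (\<forall>x. min (w x) (w' x) \<le> v x) \<and> (\<forall>x. x \<notin> K \<longrightarrow> v x = min (w x) (w' x))"
  then show "energy p K g (\<lambda>x. min (w x) (w' x) < v x) \<le> Q' * energy p K h (\<lambda>x. min (w x) (w' x) < v x)"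
    using min_competitor[OF assms(1,2) w w' refl, of g v h K] by simp
qed

definition pair_const :: "real \<Rightarrow> real \<Rightarrow> real" where
  "pair_const a b = a * b * (a + b - 2) / (a * b - 1)"

lemma pair_const_facts:
  assumes "a \<ge> 1" "b \<ge> 1" "\<not> (a = 1 \<and> b = 1)"
  shows "a * b > 1" "1 \<le> pair_const a b" "(a - 1) * (b - 1) * pair_const a b = a * b * R_const a b"
proof -
  have x: "a * b - 1 = (a - 1) + (b - 1) + (a - 1) * (b - 1)" by (simp add: algebra_simps)
  have "(a - 1) + (b - 1) > 0" "(a - 1) * (b - 1) \<ge> 0" using assms by auto
  then show 1: "a * b > 1" using x by linarith
  have "a * b * (a + b - 2) - (a * b - 1)
     = (a - 1)\<^sup>2 + (a - 1) * (b - 1) + (b - 1)\<^sup>2 + (a - 1) * (b - 1) * (a + b - 2)"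
    by (simp add: power2_eq_square algebra_simps)
  also have "\<dots> \<ge> 0"
    using assms \<open>(a - 1) * (b - 1) \<ge> 0\<close> by (intro add_nonneg_nonneg mult_nonneg_nonneg) auto
  finally show "1 \<le> pair_const a b" using 1 by (simp add: pair_const_def le_divide_eq)
  have "R_const a b = (a - 1) * (b - 1) * (a - 1 + b - 1) / (a * b - 1)"
    using assms(3) by (simp add: R_const_def)
  also have "a - 1 + b - 1 = a + b - 2" by simp
  finally show "(a - 1) * (b - 1) * pair_const a b = a * b * R_const a b"
    by (simp add: pair_const_def)
qed

text \<open>
  Use \<open>min_competitor\<close> in both orders, with the weights \<open>Q2 - 1\<close> and \<open>Q1 - 1\<close>. The two partial
  energies, over \<open>{w1 < w2}\<close> and \<open>{w2 < w1}\<close>, then have the common factor \<open>(Q1 - 1) * (Q2 - 1)\<close>, and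
  their sum is at most the total energy.
\<close>

lemma local_qsm_min2:
  fixes w1 w2 :: "'a::euclidean_space \<Rightarrow> real"
  assumes "open \<Omega>" "p \<ge> 0" and w1: "local_qsm p Q1 \<Omega> w1" and w2: "local_qsm p Q2 \<Omega> w2"
    and ne: "\<not> (Q1 = 1 \<and> Q2 = 1)"
  shows "local_qsm p (pair_const Q1 Q2) \<Omega> (\<lambda>x. min (w1 x) (w2 x))"
  unfolding local_qsm_def
proof (intro conjI allI impI sobolev_loc_min_exists[OF assms(1-4)])
  note Q1 = local_qsmD(1)[OF w1] and Q2 = local_qsmD(1)[OF w2]
  note c = pair_const_facts[OF Q1 Q2 ne]
  show "1 \<le> pair_const Q1 Q2" by (rule c(2))
  fix g v h K
  assume a: "sobolev_loc p \<Omega> (\<lambda>x. min (w1 x) (w2 x)) g \<and> sobolev_loc p \<Omega> v h \<and> compact K \<and> K \<subseteq> \<Omega> \<and>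
       (\<forall>x. min (w1 x) (w2 x) \<le> v x) \<and> (\<forall>x. x \<notin> K \<longrightarrow> v x = min (w1 x) (w2 x))"
  then have g: "sobolev_loc p \<Omega> (\<lambda>x. min (w1 x) (w2 x)) g" and h: "sobolev_loc p \<Omega> v h"
    and K: "compact K" "K \<subseteq> \<Omega>" by auto
  obtain g1 g2 where gw: "sobolev_loc p \<Omega> w1 g1" "sobolev_loc p \<Omega> w2 g2"
    using local_qsmD(2)[OF w1] local_qsmD(2)[OF w2] by blast
  define E where "E = energy p K g (\<lambda>x. min (w1 x) (w2 x) < v x)"
  define V where "V = energy p K h (\<lambda>x. min (w1 x) (w2 x) < v x)"
  define E1 where "E1 = energy p K g (\<lambda>x. min (w1 x) (w2 x) < v x \<and> w1 x < w2 x)"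
  define E2 where "E2 = energy p K g (\<lambda>x. min (w1 x) (w2 x) < v x \<and> w2 x < w1 x)"
  have "Q1 * E - (Q1 - 1) * E1 \<le> Q1 * Q2 * V"
    unfolding E_def V_def E1_def
    by (rule min_competitor[OF assms(1,2) w1 w2]) (use a in auto)
  moreover have "Q2 * E - (Q2 - 1) * E2 \<le> Q2 * Q1 * V"
    unfolding E_def V_def E2_def
    by (rule min_competitor[OF assms(1,2) w2 w1]) (use a in auto)
  ultimately have "(Q2 - 1) * (Q1 * E - (Q1 - 1) * E1) + (Q1 - 1) * (Q2 * E - (Q2 - 1) * E2)
      \<le> (Q2 - 1) * (Q1 * Q2 * V) + (Q1 - 1) * (Q2 * Q1 * V)"
    using Q1 Q2 by (intro add_mono mult_left_mono) auto
  moreover have "E1 + E2 \<le> E"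
  proof -
    note L = sobolev_locD(2)[OF g K] sobolev_locD(2)[OF h K] sobolev_locD(2)[OF gw(1) K] sobolev_locD(2)[OF gw(2) K]
    have "E1 + E2 + energy p K g (\<lambda>x. False) \<le> E"
      unfolding E1_def E2_def E_def
      by (rule disjoint_energies[OF K(1) sobolev_locD(3)[OF g K]])
        (auto intro!: sets_Collect_conj_on sublevel_measurable[OF K(1)] L simp del: min_less_iff_disj)
    then show ?thesis using energy_nonneg[of p K g "\<lambda>x. False"] by linarith
  qed
  then have "(Q1 - 1) * (Q2 - 1) * (E1 + E2) \<le> (Q1 - 1) * (Q2 - 1) * E"
    using Q1 Q2 by (intro mult_left_mono mult_nonneg_nonneg) auto
  ultimately have "(Q1 * Q2 - 1) * E \<le> Q1 * Q2 * (Q1 + Q2 - 2) * V"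
    by (simp add: algebra_simps)
  then have "E \<le> Q1 * Q2 * (Q1 + Q2 - 2) * V / (Q1 * Q2 - 1)"
    using c(1) by (simp add: pos_le_divide_eq mult.commute)
  then show "energy p K g (\<lambda>x. min (w1 x) (w2 x) < v x) \<le> pair_const Q1 Q2 * energy p K h (\<lambda>x. min (w1 x) (w2 x) < v x)"
    unfolding E_def V_def pair_const_def by simp
qed

text \<open>
  Use \<open>min_competitor\<close> three times, comparing each of the functions with the minimum of the other
  two, to which \<open>local_qsm_min2\<close> applies. With \<open>a = Q1 - 1\<close>, \<open>b = Q2 - 1\<close> and \<open>c = Q3 - 1\<close>, the
  weights \<open>b * c\<close>, \<open>c * a\<close> and \<open>a * b\<close> give all three partial energies the factor \<open>a * b * c\<close>. These
  energies belong to disjoint sets, so their sum is at most the total energy, which is left with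
  the factor \<open>P_const Q1 Q2 Q3\<close>. The products of weights and pair constants on the other side are
  the terms with \<open>R_const\<close>.
\<close>

lemma local_qsm_min3:
  fixes u1 u2 u3 :: "'a::euclidean_space \<Rightarrow> real"
  assumes "open \<Omega>" "p \<ge> 0" and u1: "local_qsm p Q1 \<Omega> u1" and u2: "local_qsm p Q2 \<Omega> u2" and u3: "local_qsm p Q3 \<Omega> u3"
    and ne: "\<not> (Q1 = 1 \<and> Q2 = 1)" "\<not> (Q2 = 1 \<and> Q3 = 1)" "\<not> (Q3 = 1 \<and> Q1 = 1)"
  shows "local_qsm p (Q1 * Q2 * Q3 / P_const Q1 Q2 Q3 * (R_const Q2 Q3 + R_const Q3 Q1 + R_const Q1 Q2)) \<Omega>
    (\<lambda>x. min (u1 x) (min (u2 x) (u3 x)))"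
proof -
  note Q1 = local_qsmD(1)[OF u1] and Q2 = local_qsmD(1)[OF u2] and Q3 = local_qsmD(1)[OF u3]
  define a b c where "a = Q1 - 1" "b = Q2 - 1" "c = Q3 - 1"
  have abc: "a \<ge> 0" "b \<ge> 0" "c \<ge> 0" and Qs: "Q1 = a + 1" "Q2 = b + 1" "Q3 = c + 1"
    using Q1 Q2 Q3 by (auto simp: a_b_c_def)
  note c12 = pair_const_facts[OF Q1 Q2 ne(1)] and c23 = pair_const_facts[OF Q2 Q3 ne(2)]
    and c31 = pair_const_facts[OF Q3 Q1 ne(3)]
  define P where "P = P_const Q1 Q2 Q3"
  have P_eq: "P = a * b + b * c + c * a + 2 * (a * b * c)"
    unfolding P_def P_const_def Qs by (simp add: algebra_simps)
  \<comment> \<open>At most one of \<open>a\<close>, \<open>b\<close>, \<open>c\<close> vanishes, so the denominator \<open>P\<close> is positive.\<close>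
  have "a * b > 0 \<or> b * c > 0 \<or> c * a > 0"
    using ne abc Qs by (auto simp: zero_less_mult_iff)
  moreover have nn: "a * b \<ge> 0" "b * c \<ge> 0" "c * a \<ge> 0" "a * b * c \<ge> 0" using abc by auto
  ultimately have "P > 0" unfolding P_eq by linarith
  define Qbar where "Qbar = Q1 * Q2 * Q3 / P * (R_const Q2 Q3 + R_const Q3 Q1 + R_const Q1 Q2)"
  have Qbar_P: "Qbar * P = b * c * Q1 * pair_const Q2 Q3 + c * a * Q2 * pair_const Q3 Q1 + a * b * Q3 * pair_const Q1 Q2"
  proof -
    have "b * c * Q1 * pair_const Q2 Q3 = Q1 * (b * c * pair_const Q2 Q3)"
      "c * a * Q2 * pair_const Q3 Q1 = Q2 * (c * a * pair_const Q3 Q1)"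
      "a * b * Q3 * pair_const Q1 Q2 = Q3 * (a * b * pair_const Q1 Q2)"
      by simp_all
    then have "b * c * Q1 * pair_const Q2 Q3 + c * a * Q2 * pair_const Q3 Q1 + a * b * Q3 * pair_const Q1 Q2
      = Q1 * (Q2 * Q3 * R_const Q2 Q3) + Q2 * (Q3 * Q1 * R_const Q3 Q1) + Q3 * (Q1 * Q2 * R_const Q1 Q2)"
      using c12(3) c23(3) c31(3) unfolding a_b_c_def by (simp only:)
    also have "\<dots> = Q1 * Q2 * Q3 * (R_const Q2 Q3 + R_const Q3 Q1 + R_const Q1 Q2)"
      by (simp add: distrib_left mult.assoc mult.left_commute)
    finally have "b * c * Q1 * pair_const Q2 Q3 + c * a * Q2 * pair_const Q3 Q1 + a * b * Q3 * pair_const Q1 Q2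
      = Q1 * Q2 * Q3 * (R_const Q2 Q3 + R_const Q3 Q1 + R_const Q1 Q2)" .
    then show ?thesis using \<open>P > 0\<close> by (simp add: Qbar_def)
  qed
  have "local_qsm p Qbar \<Omega> (\<lambda>x. min (u1 x) (min (u2 x) (u3 x)))"
    unfolding local_qsm_def
  proof (intro conjI allI impI)
    note q12 = local_qsm_min2[OF assms(1,2) u1 u2 ne(1)] and q23 = local_qsm_min2[OF assms(1,2) u2 u3 ne(2)]
      and q31 = local_qsm_min2[OF assms(1,2) u3 u1 ne(3)]
    show "\<exists>g. sobolev_loc p \<Omega> (\<lambda>x. min (u1 x) (min (u2 x) (u3 x))) g"
      by (rule sobolev_loc_min_exists[OF assms(1,2) u1 q23])
    have "1 * P \<le> b * c * Q1 * 1 + c * a * Q2 * 1 + a * b * Q3 * 1"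
      unfolding P_eq Qs using nn by (simp add: algebra_simps)
    also have "\<dots> \<le> Qbar * P"
      unfolding Qbar_P using c12(2) c23(2) c31(2) abc Q1 Q2 Q3
      by (intro add_mono mult_left_mono mult_nonneg_nonneg) auto
    finally show "1 \<le> Qbar" using \<open>P > 0\<close> by simp
    fix g v h K
    let ?u = "\<lambda>x. min (u1 x) (min (u2 x) (u3 x))"
    assume as: "sobolev_loc p \<Omega> ?u g \<and> sobolev_loc p \<Omega> v h \<and> compact K \<and> K \<subseteq> \<Omega> \<and>
         (\<forall>x. ?u x \<le> v x) \<and> (\<forall>x. x \<notin> K \<longrightarrow> v x = ?u x)"
    then have g: "sobolev_loc p \<Omega> ?u g" and h: "sobolev_loc p \<Omega> v h"
      and K: "compact K" "K \<subseteq> \<Omega>" and v: "\<forall>x. ?u x \<le> v x" "\<forall>x. x \<notin> K \<longrightarrow> v x = ?u x" by auto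
    obtain g1 g2 g3 where gw: "sobolev_loc p \<Omega> u1 g1" "sobolev_loc p \<Omega> u2 g2" "sobolev_loc p \<Omega> u3 g3"
      using local_qsmD(2)[OF u1] local_qsmD(2)[OF u2] local_qsmD(2)[OF u3] by blast
    define E where "E = energy p K g (\<lambda>x. ?u x < v x)"
    define V where "V = energy p K h (\<lambda>x. ?u x < v x)"
    define E1 where "E1 = energy p K g (\<lambda>x. ?u x < v x \<and> u1 x < min (u2 x) (u3 x))"
    define E2 where "E2 = energy p K g (\<lambda>x. ?u x < v x \<and> u2 x < min (u3 x) (u1 x))"
    define E3 where "E3 = energy p K g (\<lambda>x. ?u x < v x \<and> u3 x < min (u1 x) (u2 x))"
    have "Q1 * E - (Q1 - 1) * E1 \<le> Q1 * pair_const Q2 Q3 * V"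
      unfolding E_def V_def E1_def
      by (rule min_competitor[OF assms(1,2) u1 q23 _ g h K v]) simp
    then have i1: "b * c * (Q1 * E - a * E1) \<le> b * c * (Q1 * pair_const Q2 Q3 * V)"
      using nn by (intro mult_left_mono) (auto simp: a_b_c_def)
    have "Q2 * E - (Q2 - 1) * E2 \<le> Q2 * pair_const Q3 Q1 * V"
      unfolding E_def V_def E2_def
      by (rule min_competitor[OF assms(1,2) u2 q31 _ g h K v]) (simp add: ac_simps)
    then have i2: "c * a * (Q2 * E - b * E2) \<le> c * a * (Q2 * pair_const Q3 Q1 * V)"
      using nn by (intro mult_left_mono) (auto simp: a_b_c_def)
    have "Q3 * E - (Q3 - 1) * E3 \<le> Q3 * pair_const Q1 Q2 * V"
      unfolding E_def V_def E3_def
      by (rule min_competitor[OF assms(1,2) u3 q12 _ g h K v]) (simp add: ac_simps)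
    then have i3: "a * b * (Q3 * E - c * E3) \<le> a * b * (Q3 * pair_const Q1 Q2 * V)"
      using nn by (intro mult_left_mono) (auto simp: a_b_c_def)
    have dis: "E1 + E2 + E3 \<le> E"
    proof -
      note L = sobolev_locD(2)[OF g K] sobolev_locD(2)[OF h K] sobolev_locD(2)[OF gw(1) K]
        sobolev_locD(2)[OF gw(2) K] sobolev_locD(2)[OF gw(3) K]
      obtain m1 m2 m3 where "sobolev_loc p \<Omega> (\<lambda>x. min (u2 x) (u3 x)) m1"
        "sobolev_loc p \<Omega> (\<lambda>x. min (u3 x) (u1 x)) m2" "sobolev_loc p \<Omega> (\<lambda>x. min (u1 x) (u2 x)) m3"
        using local_qsmD(2)[OF q23] local_qsmD(2)[OF q31] local_qsmD(2)[OF q12] by blast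
      note L' = sobolev_locD(2)[OF this(1) K] sobolev_locD(2)[OF this(2) K] sobolev_locD(2)[OF this(3) K]
      note s = sublevel_measurable(1)[OF K(1)]
      show ?thesis unfolding E1_def E2_def E3_def E_def
      proof (rule disjoint_energies[OF K(1) sobolev_locD(3)[OF g K]])
        show "{x \<in> K. ?u x < v x \<and> u1 x < min (u2 x) (u3 x)} \<in> sets lebesgue"
          by (rule sets_Collect_conj_on[OF s[OF L(1,2)] s[OF L(3) L'(1)]])
        show "{x \<in> K. ?u x < v x \<and> u2 x < min (u3 x) (u1 x)} \<in> sets lebesgue"
          by (rule sets_Collect_conj_on[OF s[OF L(1,2)] s[OF L(4) L'(2)]])
        show "{x \<in> K. ?u x < v x \<and> u3 x < min (u1 x) (u2 x)} \<in> sets lebesgue"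
          by (rule sets_Collect_conj_on[OF s[OF L(1,2)] s[OF L(5) L'(3)]])
        show "{x \<in> K. ?u x < v x} \<in> sets lebesgue" by (rule s[OF L(1,2)])
      qed auto
    qed
    have "a * b * c * (E1 + E2 + E3) \<le> a * b * c * E" by (intro mult_left_mono dis nn)
    then have "P * E \<le> (b * c * Q1 + c * a * Q2 + a * b * Q3) * E - a * b * c * (E1 + E2 + E3)"
      unfolding P_eq Qs by (simp add: algebra_simps)
    also have "\<dots> = b * c * (Q1 * E - a * E1) + c * a * (Q2 * E - b * E2) + a * b * (Q3 * E - c * E3)"
      by (simp add: algebra_simps)
    also have "\<dots> \<le> b * c * (Q1 * pair_const Q2 Q3 * V) + c * a * (Q2 * pair_const Q3 Q1 * V) + a * b * (Q3 * pair_const Q1 Q2 * V)"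
      by (intro add_mono i1 i2 i3)
    also have "\<dots> = (Qbar * P) * V" unfolding Qbar_P by (simp add: algebra_simps)
    finally have "P * E \<le> P * (Qbar * V)" by (simp add: ac_simps)
    then have "E \<le> Qbar * V" using \<open>P > 0\<close> by simp
    then show "energy p K g (\<lambda>x. ?u x < v x) \<le> Qbar * energy p K h (\<lambda>x. ?u x < v x)"
      unfolding E_def V_def .
  qed
  then show ?thesis unfolding Qbar_def P_def .
qed

section \<open>From compactly supported to general variations\<close>

text \<open>
  The difference of a competitor and \<open>u\<close> has compact support, hence is an admissible \<open>\<phi>\<close>.
\<close>

lemma quasisuperminimizer_imp_local_qsm:
  fixes u :: "'a::euclidean_space \<Rightarrow> real"
  assumes "open \<Omega>" "p \<ge> 1" and q: "quasisuperminimizer p Q \<Omega> u"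
  shows "local_qsm p Q \<Omega> u"
  unfolding local_qsm_def
proof (intro conjI allI impI)
  show Q: "1 \<le> Q" using q by (simp add: quasisuperminimizer_def)
  show "\<exists>g. sobolev_loc p \<Omega> u g"
    using q W1p_loc_imp_sobolev_loc[OF assms(1)] by (simp add: quasisuperminimizer_def)
  fix g v h K
  assume "sobolev_loc p \<Omega> u g \<and> sobolev_loc p \<Omega> v h \<and> compact K \<and> K \<subseteq> \<Omega> \<and>
       (\<forall>x. u x \<le> v x) \<and> (\<forall>x. x \<notin> K \<longrightarrow> v x = u x)"
  then have g: "sobolev_loc p \<Omega> u g" and h: "sobolev_loc p \<Omega> v h" and K: "compact K" "K \<subseteq> \<Omega>"
    and v: "\<And>x. u x \<le> v x" "\<And>x. x \<notin> K \<Longrightarrow> v x = u x" by auto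
  define \<phi> where "\<phi> x = v x + (-1) * u x" for x
  have "sobolev_loc p \<Omega> \<phi> (\<lambda>x. h x + (-1) *\<^sub>R g x)"
    unfolding \<phi>_def using assms(2) by (intro sobolev_loc_add sobolev_loc_scale g h) auto
  then have "\<phi> \<in> W1p_0 p \<Omega>"
    by (rule compact_support_W1p_0[OF assms(1,2) _ K]) (simp add: \<phi>_def v(2))
  moreover have "AE x in lebesgue_on \<Omega>. 0 \<le> \<phi> x" using v(1) by (intro AE_I2) (simp add: \<phi>_def)
  ultimately have I: "(\<integral>\<^sup>+x\<in>{x\<in>\<Omega>. \<phi> x \<noteq> 0}. ennreal (norm (weak_gradient \<Omega> u x) powr p) \<partial>lebesgue)
        \<le> ennreal Q * (\<integral>\<^sup>+x\<in>{x\<in>\<Omega>. \<phi> x \<noteq> 0}. ennreal (norm (weak_gradient \<Omega> (\<lambda>y. u y + \<phi> y) x) powr p) \<partial>lebesgue)"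
    using q unfolding quasisuperminimizer_def by blast
  have sum: "(\<lambda>y. u y + \<phi> y) = v" by (auto simp: \<phi>_def)
  have set: "{x\<in>\<Omega>. \<phi> x \<noteq> 0} = {x \<in> K. u x < v x}"
  proof (rule set_eqI)
    fix x
    show "x \<in> {x\<in>\<Omega>. \<phi> x \<noteq> 0} \<longleftrightarrow> x \<in> {x \<in> K. u x < v x}"
      using v(1)[of x] v(2)[of x] K(2) by (auto simp: \<phi>_def)
  qed
  note m = sublevel_measurable(1)[OF K(1) sobolev_locD(2)[OF g K] sobolev_locD(2)[OF h K]]
  have "(\<integral>\<^sup>+x\<in>{x \<in> K. u x < v x}. ennreal (norm (weak_gradient \<Omega> f x) powr p) \<partial>lebesgue)
      = ennreal (energy p K f' (\<lambda>x. u x < v x))" if f: "sobolev_loc p \<Omega> f f'" for f f'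
  proof -
    have "(\<integral>\<^sup>+x\<in>{x \<in> K. u x < v x}. ennreal (norm (weak_gradient \<Omega> f x) powr p) \<partial>lebesgue)
      = (\<integral>\<^sup>+x\<in>{x \<in> K. u x < v x}. ennreal (norm (f' x) powr p) \<partial>lebesgue)"
      by (rule nn_integral_cong_AE)
        (use weak_gradient_eq(2)[OF assms(1) sobolev_locD(1)[OF f]] in eventually_elim, use K(2) in \<open>auto simp: indicator_def\<close>)
    also have "\<dots> = ennreal (energy p K f' (\<lambda>x. u x < v x))"
      by (rule energy_nn_integral[OF K(1) sobolev_locD(3)[OF f K] m])
    finally show ?thesis .
  qed
  from I[unfolded sum set this[OF g] this[OF h]]
  have "ennreal (energy p K g (\<lambda>x. u x < v x)) \<le> ennreal (Q * energy p K h (\<lambda>x. u x < v x))"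
    using Q by (simp add: ennreal_mult energy_nonneg)
  then show "energy p K g (\<lambda>x. u x < v x) \<le> Q * energy p K h (\<lambda>x. u x < v x)"
    using Q energy_nonneg[of p K h] by (subst (asm) ennreal_le_iff) auto
qed

lemma locally_integrable_measurable:
  fixes f :: "'a::euclidean_space \<Rightarrow> 'b::euclidean_space"
  assumes "open \<Omega>" and f: "locally_integrable_on f \<Omega>"
  shows "(\<lambda>x. indicator \<Omega> x *\<^sub>R f x) \<in> borel_measurable lebesgue"
proof -
  obtain C :: "nat \<Rightarrow> 'a set" where C: "\<forall>n. compact (C n) \<and> C n \<subseteq> \<Omega> \<and> C n \<subseteq> interior (C (Suc n))"
    "\<forall>K. compact K \<longrightarrow> K \<subseteq> \<Omega> \<longrightarrow> (\<exists>N. \<forall>n\<ge>N. K \<subseteq> C n)"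
    using compact_exhaustion[OF assms(1)] by (elim exE conjE)
  show ?thesis
  proof (rule borel_measurable_LIMSEQ_metric)
    show "(\<lambda>x. indicator (C n) x *\<^sub>R f x) \<in> borel_measurable lebesgue" for n
      using C(1) by (intro borel_measurable_integrable locally_integrable_indicator[OF f]) auto
    fix x
    show "(\<lambda>n. indicator (C n) x *\<^sub>R f x) \<longlonglongrightarrow> indicator \<Omega> x *\<^sub>R f x"
    proof (cases "x \<in> \<Omega>")
      case True
      then obtain N where N: "\<And>n. n \<ge> N \<Longrightarrow> x \<in> C n" using C(2)[rule_format, of "{x}"] by auto
      show ?thesis
        by (rule tendsto_eventually) (use N True in \<open>auto simp: eventually_sequentially indicator_def\<close>)
    next
      case False
      then have "x \<notin> C n" for n using C(1) by auto
      then show ?thesis using False by simp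
    qed
  qed
qed

lemma test_function_in_Lp:
  fixes \<psi> :: "'a::euclidean_space \<Rightarrow> real"
  assumes "open \<Omega>" "p \<ge> 0" and \<psi>: "\<psi> \<in> test_functions \<Omega>"
  shows "in_Lp p \<Omega> \<psi>" "in_Lp p \<Omega> (grad \<psi>)"
proof -
  let ?K = "closure {x. \<psi> x \<noteq> 0}"
  note K = test_functionsD(2,3)[OF \<psi>]
  have z: "\<psi> x = 0" "grad \<psi> x = 0" if "x \<notin> ?K" for x
  proof -
    show "\<psi> x = 0" by (rule test_functions_outside(1)[OF \<psi> that])
    show "grad \<psi> x = 0" unfolding grad_def test_functions_outside(2)[OF \<psi> that] by simp
  qed
  have e: "indicator \<Omega> x *\<^sub>R \<psi> x = indicator ?K x *\<^sub>R \<psi> x" "indicator \<Omega> x *\<^sub>R grad \<psi> x = indicator ?K x *\<^sub>R grad \<psi> x" for x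
    using z[of x] K(2) by (cases "x \<in> ?K"; auto simp: indicator_def)+
  note L = in_Lp_iff[OF open_lebesgue[OF assms(1)]] in_Lp_iff[OF compact_lebesgue[OF K(1)]]
  show "in_Lp p \<Omega> \<psi>"
    using in_Lp_continuous[OF C_k_continuous[OF test_functionsD(1)[OF \<psi>]] K(1) assms(2)] unfolding L e .
  show "in_Lp p \<Omega> (grad \<psi>)"
    using in_Lp_continuous[OF grad_continuous[OF \<psi>] K(1) assms(2)] unfolding L e .
qed

lemma W1p_0_approx:
  fixes \<phi> :: "'a::euclidean_space \<Rightarrow> real"
  assumes "open \<Omega>" "p \<ge> 1" and \<phi>: "\<phi> \<in> W1p_0 p \<Omega>" and "\<epsilon> > 0"
  shows "\<exists>\<psi>\<in>test_functions \<Omega>. (\<integral>\<^sup>+x. ennreal (norm (indicator \<Omega> x *\<^sub>R (\<phi> x - \<psi> x)) powr p) \<partial>lebesgue) \<le> ennreal \<epsilon> \<and>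
    (\<integral>\<^sup>+x. ennreal (norm (indicator \<Omega> x *\<^sub>R (weak_gradient \<Omega> \<phi> x - grad \<psi> x)) powr p) \<partial>lebesgue) \<le> ennreal \<epsilon>"
proof -
  note \<Omega>_sets = open_lebesgue[OF assms(1)]
  have W: "in_Lp p \<Omega> \<phi>" "in_Lp p \<Omega> (weak_gradient \<Omega> \<phi>)" "\<exists>g. has_weak_gradient \<Omega> \<phi> g"
    using \<phi> by (auto simp: W1p_0_def W1p_def)
  have hw: "has_weak_gradient \<Omega> \<phi> (weak_gradient \<Omega> \<phi>)" using W(3) weak_gradient_eq(1)[OF assms(1)] by blast
  obtain \<psi> where \<psi>: "\<psi> \<in> test_functions \<Omega>" "W1p_norm p \<Omega> (\<lambda>x. \<phi> x - \<psi> x) < \<epsilon> powr (1 / p)"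
    using \<phi> \<open>\<epsilon> > 0\<close> unfolding W1p_0_def by (auto dest!: spec[of _ "\<epsilon> powr (1 / p)"])
  let ?d = "weak_gradient \<Omega> (\<lambda>x. \<phi> x - \<psi> x)"
  have hd: "has_weak_gradient \<Omega> (\<lambda>x. \<phi> x - \<psi> x) (\<lambda>x. weak_gradient \<Omega> \<phi> x - grad \<psi> x)"
    using weak_gradient_add[OF hw weak_gradient_scale[OF test_function_weak_gradient[OF \<psi>(1)], where c="- 1"]] by simp
  have p0: "p \<ge> 0" using assms(2) by simp
  note L\<psi> = test_function_in_Lp[OF assms(1) p0 \<psi>(1)]
  have L1: "in_Lp p \<Omega> (\<lambda>x. \<phi> x - \<psi> x)"
    using in_Lp_add[OF \<Omega>_sets p0 W(1) in_Lp_scale[OF \<Omega>_sets L\<psi>(1), of "- 1"]] by simp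
  have L2: "in_Lp p \<Omega> (\<lambda>x. weak_gradient \<Omega> \<phi> x - grad \<psi> x)"
    using in_Lp_add[OF \<Omega>_sets p0 W(2) in_Lp_scale[OF \<Omega>_sets L\<psi>(2), of "- 1"]] by simp
  have L3: "in_Lp p \<Omega> ?d"
    by (rule in_Lp_cong_AE[OF \<Omega>_sets L2]) (use weak_gradient_eq(2)[OF assms(1) hd] in eventually_elim, simp)
  define D where "D = (LINT x|lebesgue_on \<Omega>. \<bar>\<phi> x - \<psi> x\<bar> powr p + norm (?d x) powr p)"
  have i: "integrable (lebesgue_on \<Omega>) (\<lambda>x. \<bar>\<phi> x - \<psi> x\<bar> powr p + norm (?d x) powr p)"
    using L1 L3 unfolding in_Lp_def by (intro Bochner_Integration.integrable_add) auto
  have "D \<le> \<epsilon>"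
  proof (rule ccontr)
    assume "\<not> D \<le> \<epsilon>"
    then have "\<epsilon> powr (1 / p) \<le> D powr (1 / p)" using \<open>\<epsilon> > 0\<close> assms(2) by (intro powr_mono2) auto
    then show False using \<psi>(2) by (simp add: W1p_norm_def D_def)
  qed
  have "(\<integral>\<^sup>+x. ennreal (\<bar>\<phi> x - \<psi> x\<bar> powr p + norm (?d x) powr p) \<partial>lebesgue_on \<Omega>) = ennreal D"
    unfolding D_def by (rule nn_integral_eq_integral[OF i]) auto
  then have le: "(\<integral>\<^sup>+x. ennreal (\<bar>\<phi> x - \<psi> x\<bar> powr p + norm (?d x) powr p) * indicator \<Omega> x \<partial>lebesgue) \<le> ennreal \<epsilon>"
    using \<open>D \<le> \<epsilon>\<close> \<Omega>_sets by (simp add: nn_integral_restrict_space ennreal_leI)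
  have "(\<integral>\<^sup>+x. ennreal (norm (indicator \<Omega> x *\<^sub>R (\<phi> x - \<psi> x)) powr p) \<partial>lebesgue)
    \<le> (\<integral>\<^sup>+x. ennreal (\<bar>\<phi> x - \<psi> x\<bar> powr p + norm (?d x) powr p) * indicator \<Omega> x \<partial>lebesgue)"
    by (intro nn_integral_mono) (auto simp: indicator_def intro!: ennreal_leI)
  moreover have "(\<integral>\<^sup>+x. ennreal (norm (indicator \<Omega> x *\<^sub>R (weak_gradient \<Omega> \<phi> x - grad \<psi> x)) powr p) \<partial>lebesgue)
    \<le> (\<integral>\<^sup>+x. ennreal (\<bar>\<phi> x - \<psi> x\<bar> powr p + norm (?d x) powr p) * indicator \<Omega> x \<partial>lebesgue)"
    by (rule nn_integral_mono_AE)
      (use weak_gradient_eq(2)[OF assms(1) hd] in eventually_elim, auto simp: indicator_def intro!: ennreal_leI)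
  ultimately show ?thesis using le \<psi>(1) by (meson order_trans)
qed

text \<open>
  Convergence of gradients in \<open>L\<^sup>p\<close> comes from the definition of \<open>W1p_0\<close>; almost everywhere
  convergence of the functions themselves holds along a subsequence.
\<close>

lemma W1p_0_approx_sequence:
  fixes \<phi> :: "'a::euclidean_space \<Rightarrow> real"
  assumes "open \<Omega>" "p \<ge> 1" and \<phi>: "\<phi> \<in> W1p_0 p \<Omega>"
  shows "\<exists>\<psi>::nat \<Rightarrow> 'a \<Rightarrow> real. (\<forall>n. \<psi> n \<in> test_functions \<Omega> \<and>
    (\<integral>\<^sup>+x. ennreal (norm (indicator \<Omega> x *\<^sub>R (weak_gradient \<Omega> \<phi> x - grad (\<psi> n) x)) powr p) \<partial>lebesgue) \<le> ennreal (inverse (real (Suc n)))) \<and>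
    (AE x in lebesgue. x \<in> \<Omega> \<longrightarrow> (\<lambda>n. \<psi> n x) \<longlonglongrightarrow> \<phi> x)"
proof -
  note \<Omega>_sets = open_lebesgue[OF assms(1)]
  have p0: "p \<ge> 0" using assms(2) by simp
  have "\<forall>n. \<exists>\<psi>. \<psi> \<in> test_functions \<Omega> \<and>
    (\<integral>\<^sup>+x. ennreal (norm (indicator \<Omega> x *\<^sub>R (\<phi> x - \<psi> x)) powr p) \<partial>lebesgue) \<le> ennreal (inverse (real (Suc n))) \<and>
    (\<integral>\<^sup>+x. ennreal (norm (indicator \<Omega> x *\<^sub>R (weak_gradient \<Omega> \<phi> x - grad \<psi> x)) powr p) \<partial>lebesgue) \<le> ennreal (inverse (real (Suc n)))"
    (is "\<forall>n. ?P n")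
  proof
    fix n
    have "inverse (real (Suc n)) > 0" by simp
    from W1p_0_approx[OF assms this] show "?P n" by blast
  qed
  from choice[OF this] obtain \<psi> where \<psi>': "\<forall>n. \<psi> n \<in> test_functions \<Omega> \<and>
    (\<integral>\<^sup>+x. ennreal (norm (indicator \<Omega> x *\<^sub>R (\<phi> x - \<psi> n x)) powr p) \<partial>lebesgue) \<le> ennreal (inverse (real (Suc n))) \<and>
    (\<integral>\<^sup>+x. ennreal (norm (indicator \<Omega> x *\<^sub>R (weak_gradient \<Omega> \<phi> x - grad (\<psi> n) x)) powr p) \<partial>lebesgue) \<le> ennreal (inverse (real (Suc n)))"
    by (elim exE)
  have \<psi>: "\<And>n. \<psi> n \<in> test_functions \<Omega>"
    "\<And>n. (\<integral>\<^sup>+x. ennreal (norm (indicator \<Omega> x *\<^sub>R (\<phi> x - \<psi> n x)) powr p) \<partial>lebesgue) \<le> ennreal (inverse (real (Suc n)))"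
    "\<And>n. (\<integral>\<^sup>+x. ennreal (norm (indicator \<Omega> x *\<^sub>R (weak_gradient \<Omega> \<phi> x - grad (\<psi> n) x)) powr p) \<partial>lebesgue) \<le> ennreal (inverse (real (Suc n)))"
    using \<psi>' by blast+
  have W: "in_Lp p \<Omega> \<phi>" using \<phi> by (auto simp: W1p_0_def W1p_def)
  define f where "f n x = norm (indicator \<Omega> x *\<^sub>R (\<phi> x - \<psi> n x)) powr p" for n x
  have "in_Lp p \<Omega> (\<lambda>x. \<phi> x - \<psi> n x)" for n
    using in_Lp_add[OF \<Omega>_sets p0 W in_Lp_scale[OF \<Omega>_sets test_function_in_Lp(1)[OF assms(1) p0 \<psi>(1)], of "- 1"]] by simp
  then have m: "(\<lambda>x. indicator \<Omega> x *\<^sub>R (\<phi> x - \<psi> n x)) \<in> borel_measurable lebesgue" for n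
    unfolding in_Lp_iff[OF \<Omega>_sets] by blast
  have fi: "integrable lebesgue (f n)" for n
  proof (rule integrableI_nonneg)
    show "f n \<in> borel_measurable lebesgue" unfolding f_def using m[of n] by measurable
    show "(\<integral>\<^sup>+x. ennreal (f n x) \<partial>lebesgue) < \<infinity>"
      unfolding f_def using \<psi>(2)[of n] by (rule le_less_trans) simp
  qed (simp add: f_def)
  have "(\<lambda>n. ennreal (inverse (real (Suc n)))) \<longlonglongrightarrow> 0"
    using tendsto_ennrealI[OF LIMSEQ_inverse_real_of_nat] by simp
  then have "(\<lambda>n. \<integral>\<^sup>+x. ennreal \<bar>f n x - 0\<bar> \<partial>lebesgue) \<longlonglongrightarrow> 0"
    by (rule ennreal_squeeze_0) (use \<psi>(2) in \<open>simp add: f_def del: of_nat_Suc\<close>)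
  then obtain s :: "nat \<Rightarrow> nat" where s: "strict_mono s" "AE x in lebesgue. (\<lambda>n. f (s n) x) \<longlonglongrightarrow> 0"
    using L1_limit_AE_subseq[of lebesgue f "\<lambda>x. 0"] fi by auto
  have "AE x in lebesgue. x \<in> \<Omega> \<longrightarrow> (\<lambda>n. \<psi> (s n) x) \<longlonglongrightarrow> \<phi> x"
    using s(2)
  proof eventually_elim
    case (elim x)
    show ?case
    proof
      assume x: "x \<in> \<Omega>"
      have "(\<lambda>n. (f (s n) x) powr (1 / p)) \<longlonglongrightarrow> 0"
        using assms(2) by (intro tendsto_zero_powrI[OF elim tendsto_const]) (auto simp: f_def)
      then have "(\<lambda>n. \<bar>\<phi> x - \<psi> (s n) x\<bar>) \<longlonglongrightarrow> 0"
        using x assms(2) by (simp add: f_def powr_powr)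
      then have "(\<lambda>n. \<phi> x - \<psi> (s n) x) \<longlonglongrightarrow> 0" by (rule tendsto_rabs_zero_cancel)
      from tendsto_diff[OF tendsto_const[of "\<phi> x"] this]
      show "(\<lambda>n. \<psi> (s n) x) \<longlonglongrightarrow> \<phi> x" by simp
    qed
  qed
  moreover have le: "ennreal (inverse (real (Suc (s n)))) \<le> ennreal (inverse (real (Suc n)))" for n
    using seq_suble[OF s(1), of n] by (intro ennreal_leI le_imp_inverse_le) auto
  ultimately show ?thesis
    by (intro exI[of _ "\<lambda>n. \<psi> (s n)"] conjI allI \<psi>(1) order_trans[OF \<psi>(3) le])
qed

text \<open>
  Let \<open>\<psi> n\<close> be test functions that converge to \<open>\<phi>\<close>. The competitors \<open>u + max 0 (min \<phi> (\<psi> n))\<close> differ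
  from \<open>u\<close> in compact sets only. They exceed \<open>u\<close> where both \<open>\<phi>\<close> and \<open>\<psi> n\<close> are positive, and these sets
  exhaust \<open>{\<phi> \<noteq> 0}\<close> up to null sets, so Fatou's lemma handles the left-hand side. On these sets the
  gradient of the competitor differs from that of \<open>u + \<phi>\<close> by at most the gradient of \<open>\<phi> - \<psi> n\<close>, which
  tends to \<open>0\<close> in \<open>L\<^sup>p\<close>; by \<open>powr_add_le\<close> the constant \<open>Q\<close> is lost only up to a factor close to \<open>1\<close>.
\<close>

lemma local_qsm_imp_quasisuperminimizer:
  fixes u :: "'a::euclidean_space \<Rightarrow> real"
  assumes "open \<Omega>" "p \<ge> 1" and q: "local_qsm p Q \<Omega> u"
  shows "quasisuperminimizer p Q \<Omega> u"
  unfolding quasisuperminimizer_def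
proof (intro conjI ballI impI)
  note \<Omega>_sets = open_lebesgue[OF assms(1)]
  have p0: "p \<ge> 0" using assms(2) by simp
  show Q: "1 \<le> Q" by (rule local_qsmD(1)[OF q])
  obtain g where g: "sobolev_loc p \<Omega> u g" using local_qsmD(2)[OF q] by blast
  show "u \<in> W1p_loc p \<Omega>" by (rule sobolev_loc_imp_W1p_loc[OF g])
  fix \<phi> assume \<phi>: "\<phi> \<in> W1p_0 p \<Omega>" and "AE x in lebesgue_on \<Omega>. 0 \<le> \<phi> x"
  then have pos: "AE x in lebesgue. x \<in> \<Omega> \<longrightarrow> 0 \<le> \<phi> x"
    using \<Omega>_sets by (simp add: AE_restrict_space_iff)
  define G where "G = weak_gradient \<Omega> \<phi>"
  have W: "in_Lp p \<Omega> \<phi>" "in_Lp p \<Omega> G" "\<exists>g. has_weak_gradient \<Omega> \<phi> g"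
    using \<phi> by (auto simp: W1p_0_def W1p_def G_def)
  have hG: "has_weak_gradient \<Omega> \<phi> G" using W(3) weak_gradient_eq(1)[OF assms(1)] unfolding G_def by blast
  have s\<phi>: "sobolev_loc p \<Omega> \<phi> G"
    by (intro sobolev_locI hG in_Lp_subset[OF W(1) \<Omega>_sets] in_Lp_subset[OF W(2) \<Omega>_sets] compact_lebesgue)
  define A where "A = {x\<in>\<Omega>. \<phi> x \<noteq> 0}"
  have [measurable]: "(\<lambda>x. indicator \<Omega> x * \<phi> x) \<in> borel_measurable lebesgue"
    using W(1) unfolding in_Lp_iff[OF \<Omega>_sets] by simp
  have A_sets[measurable]: "A \<in> sets lebesgue"
  proof -
    have "A = {x \<in> space lebesgue. indicator \<Omega> x * \<phi> x \<noteq> 0}" by (auto simp: A_def indicator_def)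
    also have "\<dots> \<in> sets lebesgue" by measurable
    finally show ?thesis .
  qed
  have mg: "(\<lambda>x. indicator \<Omega> x *\<^sub>R g x) \<in> borel_measurable lebesgue"
    by (rule locally_integrable_measurable[OF assms(1) has_weak_gradientD(2)[OF sobolev_locD(1)[OF g]]])
  have mG: "(\<lambda>x. indicator \<Omega> x *\<^sub>R G x) \<in> borel_measurable lebesgue"
    using W(2) unfolding in_Lp_iff[OF \<Omega>_sets] by blast
  have meas: "(\<lambda>x. ennreal (norm (f x) powr p) * indicator B x) \<in> borel_measurable lebesgue"
    if [measurable]: "(\<lambda>x. indicator \<Omega> x *\<^sub>R f x) \<in> borel_measurable lebesgue" "B \<in> sets lebesgue" and B: "B \<subseteq> \<Omega>"
    for f :: "'a \<Rightarrow> 'a" and B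
  proof -
    have "(\<lambda>x. ennreal (norm (indicator \<Omega> x *\<^sub>R f x) powr p) * indicator B x) \<in> borel_measurable lebesgue"
      by measurable
    moreover have "(\<lambda>x. ennreal (norm (indicator \<Omega> x *\<^sub>R f x) powr p) * indicator B x)
       = (\<lambda>x. ennreal (norm (f x) powr p) * indicator B x)"
      using B by (auto simp: fun_eq_iff indicator_def)
    ultimately show ?thesis by simp
  qed
  have A\<Omega>: "A \<subseteq> \<Omega>" by (auto simp: A_def)
  have mgG: "(\<lambda>x. indicator \<Omega> x *\<^sub>R (g x + G x)) \<in> borel_measurable lebesgue"
    unfolding scaleR_add_right using mg mG by measurable
  define X where "X = (\<integral>\<^sup>+x\<in>A. ennreal (norm (g x + G x) powr p) \<partial>lebesgue)"
  have eqg: "(\<integral>\<^sup>+x\<in>A. ennreal (norm (weak_gradient \<Omega> u x) powr p) \<partial>lebesgue) = (\<integral>\<^sup>+x\<in>A. ennreal (norm (g x) powr p) \<partial>lebesgue)"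
    by (rule nn_integral_cong_AE)
      (use weak_gradient_eq(2)[OF assms(1) sobolev_locD(1)[OF g]] in eventually_elim, use A\<Omega> in \<open>auto simp: indicator_def\<close>)
  have eqX: "(\<integral>\<^sup>+x\<in>A. ennreal (norm (weak_gradient \<Omega> (\<lambda>y. u y + \<phi> y) x) powr p) \<partial>lebesgue) = X"
    unfolding X_def
    by (rule nn_integral_cong_AE)
      (use weak_gradient_eq(2)[OF assms(1) weak_gradient_add[OF sobolev_locD(1)[OF g] hG]] in eventually_elim,
        use A\<Omega> in \<open>auto simp: indicator_def\<close>)
  have "(\<integral>\<^sup>+x\<in>A. ennreal (norm (g x) powr p) \<partial>lebesgue) \<le> ennreal Q * X"
  proof (cases "X = \<infinity>")
    case True
    then show ?thesis using Q by (simp add: ennreal_mult_top)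
  next
    case False
    obtain \<psi> :: "nat \<Rightarrow> 'a \<Rightarrow> real" where \<psi>: "\<forall>n. \<psi> n \<in> test_functions \<Omega> \<and>
      (\<integral>\<^sup>+x. ennreal (norm (indicator \<Omega> x *\<^sub>R (G x - grad (\<psi> n) x)) powr p) \<partial>lebesgue) \<le> ennreal (inverse (real (Suc n)))"
      and lim: "AE x in lebesgue. x \<in> \<Omega> \<longrightarrow> (\<lambda>n. \<psi> n x) \<longlonglongrightarrow> \<phi> x"
      using W1p_0_approx_sequence[OF assms(1,2) \<phi>] unfolding G_def by (elim exE conjE)
    have \<psi>t: "\<psi> n \<in> test_functions \<Omega>" for n using \<psi> by blast
    have m\<psi>[measurable]: "\<psi> n \<in> borel_measurable lebesgue" for n
      using borel_measurable_continuous_onI[OF C_k_continuous[OF test_functionsD(1)[OF \<psi>t]]]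
      by (intro measurable_completion) simp
    have mgrad[measurable]: "grad (\<psi> n) \<in> borel_measurable lebesgue" for n
      using borel_measurable_continuous_onI[OF grad_continuous[OF \<psi>t]]
      by (intro measurable_completion) simp
    define A' where "A' n = {x\<in>\<Omega>. 0 < \<phi> x \<and> 0 < \<psi> n x}" for n
    have A'_sets: "A' n \<in> sets lebesgue" for n
    proof -
      have "A' n = {x \<in> space lebesgue. 0 < indicator \<Omega> x * \<phi> x \<and> 0 < \<psi> n x}"
        by (auto simp: A'_def indicator_def split: if_splits)
      also have "\<dots> \<in> sets lebesgue" by measurable
      finally show ?thesis .
    qed
    have A'A: "A' n \<subseteq> A" for n by (auto simp: A'_def A_def)
    have step: "(\<integral>\<^sup>+x\<in>A' n. ennreal (norm (g x) powr p) \<partial>lebesgue)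
      \<le> ennreal Q * (ennreal ((1 + d) powr p) * X + ennreal ((1 + 1 / d) powr p) * ennreal (inverse (real (Suc n))))"
      if d: "d > 0" for n d
    proof -
      let ?K = "closure {x. \<psi> n x \<noteq> 0}"
      note K = test_functionsD(2,3)[OF \<psi>t[of n]]
      have out: "\<psi> n x = 0" if "x \<notin> ?K" for x by (rule test_functions_outside(1)[OF \<psi>t that])
      have s\<psi>: "sobolev_loc p \<Omega> (\<psi> n) (grad (\<psi> n))"
        by (intro sobolev_locI test_function_weak_gradient[OF \<psi>t] in_Lp_continuous[OF _ _ p0]
            C_k_continuous[OF test_functionsD(1)[OF \<psi>t]] grad_continuous[OF \<psi>t])
      define m where "m x = (if \<psi> n x < \<phi> x then grad (\<psi> n) x else G x)" for x
      define h where "h x = g x + (if min (\<phi> x) (\<psi> n x) > 0 then m x else 0)" for x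
      define v where "v x = u x + max 0 (min (\<phi> x) (\<psi> n x))" for x
      have sv: "sobolev_loc p \<Omega> v h"
        unfolding v_def h_def m_def
        by (intro sobolev_loc_add[OF p0 g] sobolev_loc_pos_part[OF assms(1) p0] sobolev_loc_min[OF assms(1) p0 s\<phi> s\<psi>])
      have e: "energy p ?K g (\<lambda>x. u x < v x) \<le> Q * energy p ?K h (\<lambda>x. u x < v x)"
      proof (rule local_qsmD(3)[OF q g sv K])
        show "\<forall>x. u x \<le> v x" by (simp add: v_def)
        show "\<forall>x. x \<notin> ?K \<longrightarrow> v x = u x"
        proof (intro allI impI)
          fix x assume "x \<notin> ?K"
          from out[OF this] show "v x = u x" by (simp add: v_def)
        qed
      qed
      have set: "{x \<in> ?K. u x < v x} = A' n"
      proof (rule set_eqI)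
        fix x
        have "u x < v x \<longleftrightarrow> 0 < \<phi> x \<and> 0 < \<psi> n x" by (auto simp: v_def)
        moreover have "x \<in> ?K" if "0 < \<psi> n x" using out[of x] that by (cases "x \<in> ?K") auto
        ultimately show "x \<in> {x \<in> ?K. u x < v x} \<longleftrightarrow> x \<in> A' n"
          using K(2) unfolding A'_def by blast
      qed
      note en = energy_nn_integral[OF K(1), where A="\<lambda>x. u x < v x", unfolded set, OF _ A'_sets]
      have "(\<integral>\<^sup>+x\<in>A' n. ennreal (norm (g x) powr p) \<partial>lebesgue) \<le> ennreal Q * (\<integral>\<^sup>+x\<in>A' n. ennreal (norm (h x) powr p) \<partial>lebesgue)"
        unfolding en[OF sobolev_locD(3)[OF g K]] en[OF sobolev_locD(3)[OF sv K]]
        using e Q by (simp add: ennreal_mult[symmetric] energy_nonneg ennreal_leI)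
      also have "\<dots> \<le> ennreal Q * (ennreal ((1 + d) powr p) * X + ennreal ((1 + 1 / d) powr p) * ennreal (inverse (real (Suc n))))"
      proof (rule mult_left_mono)
        let ?F1 = "\<lambda>x. ennreal (norm (g x + G x) powr p) * indicator A x"
        let ?F2 = "\<lambda>x. ennreal (norm (indicator \<Omega> x *\<^sub>R (G x - grad (\<psi> n) x)) powr p)"
        have m1[measurable]: "?F1 \<in> borel_measurable lebesgue" by (rule meas[OF mgG A_sets A\<Omega>])
        have m2[measurable]: "?F2 \<in> borel_measurable lebesgue"
        proof -
          note [measurable] = mG \<Omega>_sets
          have "(\<lambda>x. ennreal (norm (indicator \<Omega> x *\<^sub>R G x - indicator \<Omega> x *\<^sub>R grad (\<psi> n) x) powr p)) \<in> borel_measurable lebesgue"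
            by measurable
          then show ?thesis unfolding scaleR_diff_right .
        qed
        have "(\<integral>\<^sup>+x\<in>A' n. ennreal (norm (h x) powr p) \<partial>lebesgue)
          \<le> (\<integral>\<^sup>+x. ennreal ((1 + d) powr p) * ?F1 x + ennreal ((1 + 1 / d) powr p) * ?F2 x \<partial>lebesgue)"
        proof (rule nn_integral_mono)
          fix x
          show "ennreal (norm (h x) powr p) * indicator (A' n) x
            \<le> ennreal ((1 + d) powr p) * ?F1 x + ennreal ((1 + 1 / d) powr p) * ?F2 x"
          proof (cases "x \<in> A' n")
            case True
            then have x: "x \<in> A" "x \<in> \<Omega>" "0 < \<phi> x" "0 < \<psi> n x" using A'A A\<Omega> by (auto simp: A'_def)
            \<comment> \<open>The last summand is either \<open>0\<close> or the gradient of \<open>\<psi> n - \<phi>\<close>.\<close>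
            have hx: "h x = (g x + G x) + (m x - G x)" using x by (simp add: h_def)
            have "norm (h x) \<le> norm (g x + G x) + norm (m x - G x)"
              unfolding hx by (rule norm_triangle_ineq)
            also have "norm (m x - G x) \<le> norm (G x - grad (\<psi> n) x)"
              by (simp add: m_def norm_minus_commute)
            finally have "norm (h x) powr p \<le> (norm (g x + G x) + norm (G x - grad (\<psi> n) x)) powr p"
              using p0 by (intro powr_mono2) auto
            also have "\<dots> \<le> (1 + d) powr p * norm (g x + G x) powr p + (1 + 1 / d) powr p * norm (G x - grad (\<psi> n) x) powr p"
              using d p0 by (intro powr_add_le) auto
            finally have "ennreal (norm (h x) powr p)
              \<le> ennreal ((1 + d) powr p * norm (g x + G x) powr p + (1 + 1 / d) powr p * norm (G x - grad (\<psi> n) x) powr p)"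
              by (rule ennreal_leI)
            then show ?thesis using True x by (simp add: ennreal_plus ennreal_mult)
          qed simp
        qed
        also have "\<dots> = ennreal ((1 + d) powr p) * X + ennreal ((1 + 1 / d) powr p) * (\<integral>\<^sup>+x. ?F2 x \<partial>lebesgue)"
          unfolding X_def nn_integral_cmult[OF m1, symmetric] nn_integral_cmult[OF m2, symmetric]
          by (rule nn_integral_add) measurable
        also have "\<dots> \<le> ennreal ((1 + d) powr p) * X + ennreal ((1 + 1 / d) powr p) * ennreal (inverse (real (Suc n)))"
          using \<psi> by (intro add_left_mono mult_left_mono) auto
        finally show "(\<integral>\<^sup>+x\<in>A' n. ennreal (norm (h x) powr p) \<partial>lebesgue)
          \<le> ennreal ((1 + d) powr p) * X + ennreal ((1 + 1 / d) powr p) * ennreal (inverse (real (Suc n)))" .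
      qed simp
      finally show ?thesis .
    qed
    let ?I = "\<integral>\<^sup>+x\<in>A. ennreal (norm (g x) powr p) \<partial>lebesgue"
    have fatou: "?I \<le> liminf (\<lambda>n. \<integral>\<^sup>+x\<in>A' n. ennreal (norm (g x) powr p) \<partial>lebesgue)"
    proof -
      have "?I \<le> (\<integral>\<^sup>+x. liminf (\<lambda>n. ennreal (norm (g x) powr p) * indicator (A' n) x) \<partial>lebesgue)"
      proof (rule nn_integral_mono_AE)
        show "AE x in lebesgue. ennreal (norm (g x) powr p) * indicator A x
          \<le> liminf (\<lambda>n. ennreal (norm (g x) powr p) * indicator (A' n) x)"
          using lim pos
        proof eventually_elim
          case (elim x)
          show ?case
          proof (cases "x \<in> A")
            case True
            then have x: "x \<in> \<Omega>" "0 < \<phi> x" using elim by (auto simp: A_def)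
            have "\<forall>\<^sub>F n in sequentially. 0 < \<psi> n x"
              using order_tendstoD(1)[of "\<lambda>n. \<psi> n x" "\<phi> x" sequentially 0] elim x by auto
            then have "\<forall>\<^sub>F n in sequentially. ennreal (norm (g x) powr p) * indicator (A' n) x = ennreal (norm (g x) powr p)"
              by eventually_elim (use x in \<open>simp add: A'_def\<close>)
            then have "(\<lambda>n. ennreal (norm (g x) powr p) * indicator (A' n) x) \<longlonglongrightarrow> ennreal (norm (g x) powr p)"
              by (rule tendsto_eventually)
            from lim_imp_Liminf[OF _ this] show ?thesis using True by simp
          qed simp
        qed
      qed
      also have "\<dots> \<le> liminf (\<lambda>n. \<integral>\<^sup>+x\<in>A' n. ennreal (norm (g x) powr p) \<partial>lebesgue)"
        by (rule nn_integral_liminf) (rule meas[OF mg A'_sets order_trans[OF A'A A\<Omega>]])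
      finally show ?thesis .
    qed
    have bound: "?I \<le> ennreal Q * (ennreal ((1 + d) powr p) * X)" if d: "d > 0" for d
    proof -
      have "(\<lambda>n. ennreal (inverse (real (Suc n)))) \<longlonglongrightarrow> 0"
        using tendsto_ennrealI[OF LIMSEQ_inverse_real_of_nat] by simp
      then have "(\<lambda>n. ennreal Q * (ennreal ((1 + d) powr p) * X + ennreal ((1 + 1 / d) powr p) * ennreal (inverse (real (Suc n)))))
        \<longlonglongrightarrow> ennreal Q * (ennreal ((1 + d) powr p) * X + ennreal ((1 + 1 / d) powr p) * 0)"
        by (intro ennreal_tendsto_cmult tendsto_add tendsto_const) auto
      then have l: "liminf (\<lambda>n. ennreal Q * (ennreal ((1 + d) powr p) * X + ennreal ((1 + 1 / d) powr p) * ennreal (inverse (real (Suc n)))))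
        = ennreal Q * (ennreal ((1 + d) powr p) * X)"
        by (intro lim_imp_Liminf) (simp_all del: of_nat_Suc)
      have "?I \<le> liminf (\<lambda>n. \<integral>\<^sup>+x\<in>A' n. ennreal (norm (g x) powr p) \<partial>lebesgue)" by (rule fatou)
      also have "\<dots> \<le> liminf (\<lambda>n. ennreal Q * (ennreal ((1 + d) powr p) * X + ennreal ((1 + 1 / d) powr p) * ennreal (inverse (real (Suc n)))))"
        by (intro Liminf_mono always_eventually allI step[OF d])
      finally show ?thesis unfolding l .
    qed
    \<comment> \<open>Finally let \<open>d = inverse (Suc n)\<close> tend to \<open>0\<close>.\<close>
    have "(\<lambda>n. (1 + inverse (real (Suc n))) powr p) \<longlonglongrightarrow> (1 + 0) powr p"
      by (intro tendsto_intros LIMSEQ_inverse_real_of_nat) auto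
    then have "(\<lambda>n. X * ennreal Q * ennreal ((1 + inverse (real (Suc n))) powr p)) \<longlonglongrightarrow> X * ennreal Q * ennreal ((1 + 0) powr p)"
      using False by (intro ennreal_tendsto_cmult tendsto_ennrealI) (auto simp: ennreal_mult_less_top less_top)
    then have "(\<lambda>n. X * ennreal Q * ennreal ((1 + inverse (real (Suc n))) powr p)) \<longlonglongrightarrow> ennreal Q * X"
      by (simp add: mult.commute del: of_nat_Suc)
    moreover have "?I \<le> X * ennreal Q * ennreal ((1 + inverse (real (Suc n))) powr p)" for n
      using bound[of "inverse (real (Suc n))"] by (simp add: ac_simps del: of_nat_Suc)
    ultimately show ?thesis by (intro LIMSEQ_le_const) auto
  qed
  then show "(\<integral>\<^sup>+x\<in>{x\<in>\<Omega>. \<phi> x \<noteq> 0}. ennreal (norm (weak_gradient \<Omega> u x) powr p) \<partial>lebesgue)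
        \<le> ennreal Q * (\<integral>\<^sup>+x\<in>{x\<in>\<Omega>. \<phi> x \<noteq> 0}. ennreal (norm (weak_gradient \<Omega> (\<lambda>y. u y + \<phi> y) x) powr p) \<partial>lebesgue)"
    unfolding A_def[symmetric] eqg eqX .
qed

section \<open>The minimum of three quasisuperminimizers\<close>

theorem theorem4p2:
  fixes p Q1 Q2 Q3 :: real
    and \<Omega> :: "(real ^ 'n) set"
    and u1 u2 u3 :: "real ^ 'n \<Rightarrow> real"
  assumes "1 < p"
    and "open \<Omega>" and "\<Omega> \<noteq> {}"
    and "Q1 \<ge> 1" and "Q2 \<ge> 1" and "Q3 \<ge> 1"
    and "quasisuperminimizer p Q1 \<Omega> u1"
    and "quasisuperminimizer p Q2 \<Omega> u2"
    and "quasisuperminimizer p Q3 \<Omega> u3"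
  shows "(\<not> (Q1 = 1 \<and> Q2 = 1 \<or> Q2 = 1 \<and> Q3 = 1 \<or> Q3 = 1 \<and> Q1 = 1) \<longrightarrow>
           quasisuperminimizer p
             (Q1 * Q2 * Q3 / P_const Q1 Q2 Q3 *
               (R_const Q2 Q3 + R_const Q3 Q1 + R_const Q1 Q2))
             \<Omega> (\<lambda>x. min (u1 x) (min (u2 x) (u3 x))))
       \<and> (Q2 = 1 \<and> Q3 = 1 \<longrightarrow>
           quasisuperminimizer p Q1 \<Omega> (\<lambda>x. min (u1 x) (min (u2 x) (u3 x))))
       \<and> (Q3 = 1 \<and> Q1 = 1 \<longrightarrow>
           quasisuperminimizer p Q2 \<Omega> (\<lambda>x. min (u1 x) (min (u2 x) (u3 x))))
       \<and> (Q1 = 1 \<and> Q2 = 1 \<longrightarrow>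
           quasisuperminimizer p Q3 \<Omega> (\<lambda>x. min (u1 x) (min (u2 x) (u3 x))))"
proof -
  have p: "p \<ge> 1" "p \<ge> 0" using assms(1) by auto
  note L = quasisuperminimizer_imp_local_qsm[OF assms(2) p(1)]
  note u1 = L[OF assms(7)] and u2 = L[OF assms(8)] and u3 = L[OF assms(9)]
  note G = local_qsm_imp_quasisuperminimizer[OF assms(2) p(1)]
  note S = local_qsm_min_superminimizer[OF assms(2) p(2)]
  let ?u = "\<lambda>x. min (u1 x) (min (u2 x) (u3 x))"
  show ?thesis
  proof (intro conjI impI)
    assume "\<not> (Q1 = 1 \<and> Q2 = 1 \<or> Q2 = 1 \<and> Q3 = 1 \<or> Q3 = 1 \<and> Q1 = 1)"
    then show "quasisuperminimizer p (Q1 * Q2 * Q3 / P_const Q1 Q2 Q3 *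
               (R_const Q2 Q3 + R_const Q3 Q1 + R_const Q1 Q2)) \<Omega> ?u"
      by (intro G local_qsm_min3[OF assms(2) p(2) u1 u2 u3]) auto
  next
    assume "Q2 = 1 \<and> Q3 = 1"
    then have "local_qsm p 1 \<Omega> u2" "local_qsm p 1 \<Omega> u3" using u2 u3 by auto
    from G[OF S[OF S[OF this] u1]] show "quasisuperminimizer p Q1 \<Omega> ?u" by (simp add: min.commute)
  next
    assume "Q3 = 1 \<and> Q1 = 1"
    then have "local_qsm p 1 \<Omega> u3" "local_qsm p 1 \<Omega> u1" using u3 u1 by auto
    from G[OF S[OF this(2) S[OF this(1) u2]]] show "quasisuperminimizer p Q2 \<Omega> ?u" by (simp add: min.commute)
  next
    assume "Q1 = 1 \<and> Q2 = 1"
    then have "local_qsm p 1 \<Omega> u1" "local_qsm p 1 \<Omega> u2" using u1 u2 by auto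
    from G[OF S[OF this(1) S[OF this(2) u3]]] show "quasisuperminimizer p Q3 \<Omega> ?u" .
  qed
qed

end
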